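(* Let $T\in(0,\infty)$, let $m\in\mathbb{N}$ with $m\ge 1$, and let $$0\le\gamma<1,\qquad 0<\vartheta_j\le q_j\quad(1\le j\le m),\qquad q:=\max\{q_j: 1\le j\le m\}>0,\qquad 0<\xi<\min\Big\{1,\frac1q\Big\}.$$ Assume that $f\in C\big((0,T]\times E_\xi,E_\gamma\big)$ and that there is a constant $C>0$ such that $$\|f(t,u)\|_\gamma\le C\big(1+\|u\|_\xi\big)$$ and $$\|f(t,u)-f(t,v)\|_\gamma\le C\sum_{j=1}^m\big(1+\|u\|_\xi^{q_j-\vartheta_j}+\|v\|_\xi^{q_j-\vartheta_j}\big)\|u-v\|_\xi^{\vartheta_j}$$ for all $t\in(0,T]$ and $u,v\in E_\xi$. If $\gamma=0$, assume additionally that there exists $\vartheta_0\in(0,1)$ such that for each $R>0$ there is a constant $K(R)>0$ with $$\|f(t,u)-f(s,u)\|_0\le K(R)\,|t-s|^{\vartheta_0},\qquad t,s\in(0,T],\quad u\in E_\xi\cap\bar{\mathbb{B}}_{E_0}(0,R).$$ Then, given $u^0\in E_0$, the Cauchy problem $$u'=Au+f(t,u),\quad t\in(0,T],\qquad u(0)=u^0,$$ possesses a global strong solution $$u\in C^1\big((0,T],E_0\big)\cap C\big((0,T],E_1\big)\cap C\big([0,T],E_0\big).$$ Furthermore, if $u^0\in E_\alpha$ for some $\alpha\in[0,\min\{1,1+\gamma-\xi\})$, then $u\in C\big([0,T],E_\alpha\big)$.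
   Context: $E_0$ and $E_1$ are Banach spaces over $\mathbb{K}\in\{\mathbb{R},\mathbb{C}\}$ such that $E_1$ is continuously, densely and compactly embedded in $E_0$. For each $\theta\in(0,1)$, $(\cdot,\cdot)_\theta$ is an arbitrary admissible interpolation functor of exponent $\theta$ (admissible meaning that $E_1$ is dense in $(E_0,E_1)_\theta$ whenever $E_1$ is densely embedded in $E_0$), and $E_\theta:=(E_0,E_1)_\theta$ is the corresponding interpolation space with norm $\|\cdot\|_\theta$; $\|\cdot\|_0$ is the norm of $E_0$. Then for $0<\vartheta<\theta<1$ the embeddings $E_1\hookrightarrow E_\theta\hookrightarrow E_\vartheta\hookrightarrow E_0$ are all dense and compact. $A:E_1\to E_0$ is the infinitesimal generator (with domain $E_1$) of a strongly continuous analytic semigroup $\{e^{tA}:t\ge0\}\subset\mathcal{L}(E_0)$. $\bar{\mathbb{B}}_X(0,R)$ denotes the closed ball in $X$ with center $0$ and radius $R$. A global strong solution is a function $u$ with the stated regularity satisfying $u'(t)=Au(t)+f(t,u(t))$ in $E_0$ for all $t\in(0,T]$ and $u(0)=u^0$. *)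

theory Defs
  imports "HOL-Analysis.Analysis"
begin

section \<open>Normed spaces carried by linear subspaces\<close>

text \<open>
  The scalar field is a set \<open>K :: complex set\<close>, either \<open>\<real>\<close> or \<open>UNIV\<close>. The space \<open>E\<^sub>0\<close> is a whole
  type \<open>'a :: banach\<close> together with a scalar multiplication \<open>scl\<close> by elements of \<open>K\<close> which extends
  \<open>scaleR\<close> (for \<open>K = \<real>\<close> it is just \<open>scaleR\<close>; values of \<open>scl\<close> at scalars outside \<open>K\<close> are never used).
  All other spaces are linear subspaces of this vector space with norms of their own, so that
  an embedding is an inclusion. The norm of such a space is arbitrary outside its carrier.
\<close>

definition scalar_action :: "complex set \<Rightarrow> (complex \<Rightarrow> 'a::banach \<Rightarrow> 'a) \<Rightarrow> bool" where
  "scalar_action K scl \<longleftrightarrow>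
     (\<forall>r x. scl (of_real r) x = r *\<^sub>R x) \<and>
     (\<forall>a\<in>K. \<forall>x y. scl a (x + y) = scl a x + scl a y) \<and>
     (\<forall>a\<in>K. \<forall>b\<in>K. \<forall>x. scl (a + b) x = scl a x + scl b x) \<and>
     (\<forall>a\<in>K. \<forall>b\<in>K. \<forall>x. scl a (scl b x) = scl (a * b) x) \<and>
     (\<forall>a\<in>K. \<forall>x. norm (scl a x) = cmod a * norm x)"

record 'a nspace =
  carr :: "'a set"
  nrm :: "'a \<Rightarrow> real"

definition whole_space :: "'a::banach nspace" where
  "whole_space = \<lparr>carr = UNIV, nrm = norm\<rparr>"

text \<open>The value outside the carrier is set to 0 because the locale \<^locale>\<open>Metric_space\<close> requires the
  distance to be nonnegative and symmetric on the whole type.\<close>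

definition ndist :: "'a::banach nspace \<Rightarrow> 'a \<Rightarrow> 'a \<Rightarrow> real" where
  "ndist X x y = (if x \<in> carr X \<and> y \<in> carr X then nrm X (x - y) else 0)"

definition ntop :: "'a::banach nspace \<Rightarrow> 'a topology" where
  "ntop X = Metric_space.mtopology (carr X) (ndist X)"

definition banach_space :: "complex set \<Rightarrow> (complex \<Rightarrow> 'a::banach \<Rightarrow> 'a) \<Rightarrow> 'a nspace \<Rightarrow> bool" where
  "banach_space K scl X \<longleftrightarrow>
     0 \<in> carr X \<and>
     (\<forall>x\<in>carr X. \<forall>y\<in>carr X. x + y \<in> carr X) \<and>
     (\<forall>k\<in>K. \<forall>x\<in>carr X. scl k x \<in> carr X) \<and>
     (\<forall>x\<in>carr X. 0 \<le> nrm X x) \<and>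
     (\<forall>x\<in>carr X. nrm X x = 0 \<longleftrightarrow> x = 0) \<and>
     (\<forall>x\<in>carr X. \<forall>y\<in>carr X. nrm X (x + y) \<le> nrm X x + nrm X y) \<and>
     (\<forall>k\<in>K. \<forall>x\<in>carr X. nrm X (scl k x) = cmod k * nrm X x) \<and>
     Metric_space.mcomplete (carr X) (ndist X)"

definition embedded :: "'a::banach nspace \<Rightarrow> 'a nspace \<Rightarrow> bool" where
  "embedded X Y \<longleftrightarrow> carr X \<subseteq> carr Y \<and> (\<exists>c. \<forall>x\<in>carr X. nrm Y x \<le> c * nrm X x)"

definition densely_embedded :: "'a::banach nspace \<Rightarrow> 'a nspace \<Rightarrow> bool" where
  "densely_embedded X Y \<longleftrightarrow> embedded X Y \<and> ntop Y closure_of carr X = carr Y"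

definition compactly_embedded :: "'a::banach nspace \<Rightarrow> 'a nspace \<Rightarrow> bool" where
  "compactly_embedded X Y \<longleftrightarrow>
     embedded X Y \<and> compactin (ntop Y) (ntop Y closure_of {x \<in> carr X. nrm X x \<le> 1})"

section \<open>Interpolation functors\<close>

text \<open>Interpolation couples: both spaces are continuously embedded in a common Hausdorff topological
  vector space. Its underlying vector space may be taken to be all of \<open>'a\<close>, because every
  Hausdorff vector topology on a subspace extends to the whole space.\<close>

definition couple ::
  "complex set \<Rightarrow> (complex \<Rightarrow> 'a::banach \<Rightarrow> 'a) \<Rightarrow> 'a nspace \<Rightarrow> 'a nspace \<Rightarrow> bool" where
  "couple K scl X0 X1 \<longleftrightarrow> banach_space K scl X0 \<and> banach_space K scl X1 \<and>
     (\<exists>\<tau>. topspace \<tau> = UNIV \<and> Hausdorff_space \<tau> \<and>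
        continuous_map (prod_topology \<tau> \<tau>) \<tau> (\<lambda>(x, y). x + y) \<and>
        continuous_map (prod_topology (top_of_set K) \<tau>) \<tau> (\<lambda>(k, x). scl k x) \<and>
        continuous_map (ntop X0) \<tau> (\<lambda>x. x) \<and>
        continuous_map (ntop X1) \<tau> (\<lambda>x. x))"

definition inter_space :: "'a::banach nspace \<Rightarrow> 'a nspace \<Rightarrow> 'a nspace" where
  "inter_space X0 X1 = \<lparr>carr = carr X0 \<inter> carr X1, nrm = (\<lambda>x. max (nrm X0 x) (nrm X1 x))\<rparr>"

definition sum_space :: "'a::banach nspace \<Rightarrow> 'a nspace \<Rightarrow> 'a nspace" where
  "sum_space X0 X1 =
     \<lparr>carr = {a + b | a b. a \<in> carr X0 \<and> b \<in> carr X1},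
      nrm = (\<lambda>x. Inf {nrm X0 a + nrm X1 b | a b. a \<in> carr X0 \<and> b \<in> carr X1 \<and> x = a + b})\<rparr>"

definition linear_from ::
  "complex set \<Rightarrow> (complex \<Rightarrow> 'a::banach \<Rightarrow> 'a) \<Rightarrow> 'a set \<Rightarrow> ('a \<Rightarrow> 'a) \<Rightarrow> bool" where
  "linear_from K scl V L \<longleftrightarrow>
     (\<forall>x\<in>V. \<forall>y\<in>V. L (x + y) = L x + L y) \<and> (\<forall>k\<in>K. \<forall>x\<in>V. L (scl k x) = scl k (L x))"

definition bounded_between :: "'a::banach nspace \<Rightarrow> 'a nspace \<Rightarrow> ('a \<Rightarrow> 'a) \<Rightarrow> bool" where
  "bounded_between X Y L \<longleftrightarrow>
     L ` carr X \<subseteq> carr Y \<and> (\<exists>c. \<forall>x\<in>carr X. nrm Y (L x) \<le> c * nrm X x)"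

definition opnorm :: "'a::banach nspace \<Rightarrow> 'a nspace \<Rightarrow> ('a \<Rightarrow> 'a) \<Rightarrow> real" where
  "opnorm X Y L = Inf {c. 0 \<le> c \<and> (\<forall>x\<in>carr X. nrm Y (L x) \<le> c * nrm X x)}"

definition couple_morphism ::
  "complex set \<Rightarrow> (complex \<Rightarrow> 'a::banach \<Rightarrow> 'a) \<Rightarrow> 'a nspace \<Rightarrow> 'a nspace \<Rightarrow> 'a nspace \<Rightarrow> 'a nspace
     \<Rightarrow> ('a \<Rightarrow> 'a) \<Rightarrow> bool" where
  "couple_morphism K scl X0 X1 Y0 Y1 L \<longleftrightarrow>
     linear_from K scl (carr (sum_space X0 X1)) L \<and>
     bounded_between X0 Y0 L \<and> bounded_between X1 Y1 L"

text \<open>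
  Interpolation functors of exponent \<open>\<theta>\<close>. On morphisms the functor is restriction, so the
  functor laws hold automatically and only the object map \<open>F\<close> is data. The constant \<open>c\<close> may depend
  on the two couples; functors with a uniform constant are a special case. The couples range
  over all those formed by linear subspaces of \<open>'a\<close>, with no relation required between their norms
  and the norm of \<open>'a\<close>; a functor on the category of all couples restricts to these.
\<close>

definition interpolation_functor ::
  "complex set \<Rightarrow> (complex \<Rightarrow> 'a::banach \<Rightarrow> 'a) \<Rightarrow> real \<Rightarrow> ('a nspace \<Rightarrow> 'a nspace \<Rightarrow> 'a nspace)
     \<Rightarrow> bool" where
  "interpolation_functor K scl \<theta> F \<longleftrightarrow>
     (\<forall>X0 X1. couple K scl X0 X1 \<longrightarrow>
        banach_space K scl (F X0 X1) \<and>
        embedded (inter_space X0 X1) (F X0 X1) \<and>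
        embedded (F X0 X1) (sum_space X0 X1)) \<and>
     (\<forall>X0 X1 Y0 Y1. couple K scl X0 X1 \<and> couple K scl Y0 Y1 \<longrightarrow>
        (\<exists>c. \<forall>L. couple_morphism K scl X0 X1 Y0 Y1 L \<longrightarrow>
           bounded_between (F X0 X1) (F Y0 Y1) L \<and>
           opnorm (F X0 X1) (F Y0 Y1) L
             \<le> c * opnorm X0 Y0 L powr (1 - \<theta>) * opnorm X1 Y1 L powr \<theta>))"

definition admissible_functor ::
  "complex set \<Rightarrow> (complex \<Rightarrow> 'a::banach \<Rightarrow> 'a) \<Rightarrow> real \<Rightarrow> ('a nspace \<Rightarrow> 'a nspace \<Rightarrow> 'a nspace)
     \<Rightarrow> bool" where
  "admissible_functor K scl \<theta> F \<longleftrightarrow>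
     interpolation_functor K scl \<theta> F \<and>
     (\<forall>X0 X1. couple K scl X0 X1 \<and> densely_embedded X1 X0 \<longrightarrow> densely_embedded X1 (F X0 X1))"

text \<open>The scale \<open>E\<^sub>\<theta>\<close> for \<open>0 \<le> \<theta> < 1\<close>.\<close>

definition interp_scale ::
  "(real \<Rightarrow> 'a::banach nspace \<Rightarrow> 'a nspace \<Rightarrow> 'a nspace) \<Rightarrow> 'a nspace \<Rightarrow> real \<Rightarrow> 'a nspace" where
  "interp_scale F E1 \<theta> = (if \<theta> = 0 then whole_space else F \<theta> whole_space E1)"

section \<open>Analytic semigroups\<close>

definition C0_semigroup ::
  "complex set \<Rightarrow> (complex \<Rightarrow> 'a::banach \<Rightarrow> 'a) \<Rightarrow> (real \<Rightarrow> 'a \<Rightarrow> 'a) \<Rightarrow> bool" where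
  "C0_semigroup K scl S \<longleftrightarrow>
     (\<forall>t\<ge>0. bounded_linear (S t) \<and> (\<forall>k\<in>K. \<forall>x. S t (scl k x) = scl k (S t x))) \<and>
     S 0 = id \<and>
     (\<forall>s\<ge>0. \<forall>t\<ge>0. S (s + t) = S s \<circ> S t) \<and>
     (\<forall>x. continuous_on {0..} (\<lambda>t. S t x))"

definition is_generator :: "(real \<Rightarrow> 'a::banach \<Rightarrow> 'a) \<Rightarrow> 'a set \<Rightarrow> ('a \<Rightarrow> 'a) \<Rightarrow> bool" where
  "is_generator S D A \<longleftrightarrow>
     D = {x. \<exists>y. ((\<lambda>t. (1 / t) *\<^sub>R (S t x - x)) \<longlongrightarrow> y) (at_right 0)} \<and>
     (\<forall>x\<in>D. ((\<lambda>t. (1 / t) *\<^sub>R (S t x - x)) \<longlongrightarrow> A x) (at_right 0))"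

definition sector :: "real \<Rightarrow> complex set" where
  "sector \<delta> = {z. z \<noteq> 0 \<and> \<bar>Arg z\<bar> < \<delta>}"

text \<open>A semigroup on a complex Banach space is analytic if it extends to some sector as a semigroup of
  bounded complex-linear operators, holomorphic in the operator norm and strongly continuous at 0 on
  each smaller sector.\<close>

definition complex_analytic_semigroup ::
  "(complex \<Rightarrow> 'b::banach \<Rightarrow> 'b) \<Rightarrow> (real \<Rightarrow> 'b \<Rightarrow> 'b) \<Rightarrow> bool" where
  "complex_analytic_semigroup scl S \<longleftrightarrow>
     (\<exists>\<delta> Z. 0 < \<delta> \<and> \<delta> \<le> pi / 2 \<and>
        (\<forall>t\<ge>0. Z (of_real t) = S t) \<and>
        (\<forall>z\<in>sector \<delta>. bounded_linear (Z z) \<and> (\<forall>k x. Z z (scl k x) = scl k (Z z x))) \<and>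
        (\<forall>z\<in>sector \<delta>. \<forall>w\<in>sector \<delta>. Z (z + w) = Z z \<circ> Z w) \<and>
        (\<forall>z\<in>sector \<delta>. \<exists>D. bounded_linear D \<and>
           ((\<lambda>h. onorm (\<lambda>x. scl (inverse h) (Z (z + h) x - Z z x) - D x)) \<longlongrightarrow> 0) (at 0)) \<and>
        (\<forall>\<delta>'. 0 < \<delta>' \<and> \<delta>' < \<delta> \<longrightarrow> (\<forall>x. ((\<lambda>z. Z z x) \<longlongrightarrow> x) (at 0 within sector \<delta>'))))"

text \<open>Complex scalar multiplication on the complexification \<open>'a \<times> 'a\<close>, where \<open>(x, y)\<close> stands for
  \<open>x + i y\<close>. The norm of the product type is not homogeneous for complex scalars, but it
  is equivalent to the usual complexified norms, and only the topology matters for analyticity.\<close>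

definition complexified_scale :: "complex \<Rightarrow> 'a::banach \<times> 'a \<Rightarrow> 'a \<times> 'a" where
  "complexified_scale z p =
     (Re z *\<^sub>R fst p - Im z *\<^sub>R snd p, Im z *\<^sub>R fst p + Re z *\<^sub>R snd p)"

definition analytic_semigroup ::
  "complex set \<Rightarrow> (complex \<Rightarrow> 'a::banach \<Rightarrow> 'a) \<Rightarrow> (real \<Rightarrow> 'a \<Rightarrow> 'a) \<Rightarrow> bool" where
  "analytic_semigroup K scl S \<longleftrightarrow> C0_semigroup K scl S \<and>
     (if K = UNIV then complex_analytic_semigroup scl S
      else complex_analytic_semigroup complexified_scale (\<lambda>t. map_prod (S t) (S t)))"

definition generates_analytic_semigroup ::
  "complex set \<Rightarrow> (complex \<Rightarrow> 'a::banach \<Rightarrow> 'a) \<Rightarrow> 'a set \<Rightarrow> ('a \<Rightarrow> 'a) \<Rightarrow> bool" where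
  "generates_analytic_semigroup K scl D A \<longleftrightarrow> (\<exists>S. analytic_semigroup K scl S \<and> is_generator S D A)"

section \<open>The Cauchy problem\<close>

text \<open>Real powers of nonnegative numbers with \<open>0\<^sup>0 = 1\<close>; in contrast, \<^term>\<open>0 powr 0 = (0::real)\<close>.\<close>

definition rpow :: "real \<Rightarrow> real \<Rightarrow> real" where
  "rpow x a = (if a = 0 then 1 else x powr a)"

text \<open>At \<open>t = T\<close> the derivative is one-sided.\<close>

definition global_strong_solution ::
  "real \<Rightarrow> 'a::banach nspace \<Rightarrow> ('a \<Rightarrow> 'a) \<Rightarrow> (real \<Rightarrow> 'a \<Rightarrow> 'a) \<Rightarrow> 'a \<Rightarrow> (real \<Rightarrow> 'a) \<Rightarrow> bool" where
  "global_strong_solution T E1 A f u0 u \<longleftrightarrow>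
     (\<exists>u'. (\<forall>t\<in>{0<..T}. (u has_vector_derivative u' t) (at t within {0<..T})) \<and>
        continuous_on {0<..T} u' \<and>
        (\<forall>t\<in>{0<..T}. u' t = A (u t) + f t (u t))) \<and>
     continuous_map (top_of_set {0<..T}) (ntop E1) u \<and>
     continuous_on {0..T} u \<and>
     u 0 = u0"

end

theory Submission
  imports Defs "HOL-Library.Diagonal_Subsequence"
begin

text \<open>
  Write \<open>S t = exp (t * A)\<close>. Analyticity gives \<open>norm (A (S t x)) \<le> M / t * norm x\<close>, and interpolation gives
  \<open>\<parallel>S t x\<parallel>\<^sub>\<theta> \<le> c * t powr - \<theta> * norm x\<close> and \<open>norm (A (S t x)) \<le> c * t powr (\<theta> - 1) * \<parallel>x\<parallel>\<^sub>\<theta>\<close>. Conversely, if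
  \<open>norm (A (S t w)) = O(t powr (\<beta> - 1))\<close> as \<open>t \<rightarrow> 0\<close>, then \<open>w\<close> lies in every \<open>E\<^sub>\<theta>\<close> with \<open>\<theta> < \<beta>\<close>; thus all
  estimates on the convolution \<open>\<integral> S (t - s) (g s) ds\<close> reduce to integrals in \<open>E\<^sub>0\<close>. Mild solutions are limits
  of solutions of equations with a small delay in the argument of \<open>f\<close>: these are bounded uniformly, by linear
  growth and a norm with an exponential weight, and a subsequence converges because \<open>S t\<close> maps bounded sets of \<open>E\<^sub>0\<close> to
  relatively compact ones. A mild solution \<open>u\<close> is strong because \<open>A (S \<eta> (u t))\<close> converges locally
  uniformly in \<open>t\<close> as \<open>\<eta> \<rightarrow> 0\<close>. This holds if the forcing takes values in \<open>E\<^sub>\<gamma>\<close> with \<open>\<gamma> > 0\<close>; if \<open>\<gamma> = 0\<close>, it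
  holds because the forcing is Hoelder continuous in time.
\<close>

section \<open>Banach spaces carried by linear subspaces\<close>

text \<open>Three obstacles shape the proof. The nonlinearity may be merely Hoelder continuous in
  \<open>u\<close>, so that no contraction is at hand and existence has to come from compactness.
  The initial value lies only in \<open>E_0\<close>; hence \<open>S t u0\<close> may grow like
  \<open>t powr - \<xi>\<close> in the norm of index \<open>\<xi>\<close>, linear growth hands this
  rate to the forcing, and \<open>\<xi> < 1\<close> keeps it integrable. The functors are arbitrary
  and unrelated for different exponents, so neither reiteration nor fractional powers connect the
  spaces; the decay of \<open>A (S \<sigma> w)\<close> is the common yardstick, and a strict
  inequality of exponents pays for each passage into an interpolation space. The range
  \<open>\<alpha> < 1 + \<gamma> - \<xi>\<close> is what allows some
  \<open>\<beta> > \<alpha>\<close> for which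
  \<open>t powr (1 - (\<beta> - \<gamma>) - \<xi>)\<close>, the factor in the decay estimate of the
  convolution, tends to 0 with \<open>t\<close>.\<close>

locale normed_subspace =
  fixes X :: "'a::banach nspace"
  assumes zero_mem: "0 \<in> carr X"
    and add_mem: "\<And>x y. x \<in> carr X \<Longrightarrow> y \<in> carr X \<Longrightarrow> x + y \<in> carr X"
    and scale_mem: "\<And>r x. x \<in> carr X \<Longrightarrow> r *\<^sub>R x \<in> carr X"
    and nrm_ge0: "\<And>x. x \<in> carr X \<Longrightarrow> 0 \<le> nrm X x"
    and nrm_eq0: "\<And>x. x \<in> carr X \<Longrightarrow> nrm X x = 0 \<longleftrightarrow> x = 0"
    and nrm_triangle: "\<And>x y. x \<in> carr X \<Longrightarrow> y \<in> carr X \<Longrightarrow> nrm X (x + y) \<le> nrm X x + nrm X y"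
    and nrm_scale: "\<And>r x. x \<in> carr X \<Longrightarrow> nrm X (r *\<^sub>R x) = \<bar>r\<bar> * nrm X x"
begin

lemma minus_mem: "x \<in> carr X \<Longrightarrow> - x \<in> carr X"
  using scale_mem[of x "-1"] by simp

lemma diff_mem: "x \<in> carr X \<Longrightarrow> y \<in> carr X \<Longrightarrow> x - y \<in> carr X"
  using add_mem[of x "-y"] minus_mem by simp

lemma nrm_minus: "x \<in> carr X \<Longrightarrow> nrm X (- x) = nrm X x"
  using nrm_scale[of x "-1"] by simp

lemma nrm_0 [simp]: "nrm X 0 = 0"
  using nrm_eq0 zero_mem by blast

lemma nrm_diff_commute: "x \<in> carr X \<Longrightarrow> y \<in> carr X \<Longrightarrow> nrm X (x - y) = nrm X (y - x)"
  using nrm_minus[of "x - y"] diff_mem by simp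

lemma nrm_diff_triangle:
  "x \<in> carr X \<Longrightarrow> y \<in> carr X \<Longrightarrow> z \<in> carr X \<Longrightarrow> nrm X (x - z) \<le> nrm X (x - y) + nrm X (y - z)"
  using nrm_triangle[of "x - y" "y - z"] diff_mem by simp

lemma nrm_diff_le: "x \<in> carr X \<Longrightarrow> y \<in> carr X \<Longrightarrow> nrm X (x - y) \<le> nrm X x + nrm X y"
  using nrm_triangle[of x "-y"] minus_mem nrm_minus by simp

lemma nrm_le_add_diff: "x \<in> carr X \<Longrightarrow> y \<in> carr X \<Longrightarrow> nrm X x \<le> nrm X y + nrm X (x - y)"
  using nrm_triangle[of y "x - y"] diff_mem by simp

sublocale M: Metric_space "carr X" "ndist X"
proof
  show "0 \<le> ndist X x y" for x y
    using nrm_ge0 diff_mem by (auto simp: ndist_def)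
  show "ndist X x y = ndist X y x" for x y
    using nrm_diff_commute by (auto simp: ndist_def)
  show "ndist X x y = 0 \<longleftrightarrow> x = y" if "x \<in> carr X" "y \<in> carr X" for x y
    using nrm_eq0[of "x - y"] diff_mem that by (auto simp: ndist_def)
  show "ndist X x z \<le> ndist X x y + ndist X y z"
    if "x \<in> carr X" "y \<in> carr X" "z \<in> carr X" for x y z
    using nrm_diff_triangle that by (auto simp: ndist_def)
qed

lemma topspace_ntop [simp]: "topspace (ntop X) = carr X"
  by (simp add: ntop_def)

lemma limitin_ntop:
  assumes "\<And>i. s i \<in> carr X"
  shows "limitin (ntop X) s l G \<longleftrightarrow> l \<in> carr X \<and> ((\<lambda>i. nrm X (s i - l)) \<longlongrightarrow> 0) G"
proof -
  have "(\<forall>\<epsilon>>0. \<forall>\<^sub>F i in G. s i \<in> carr X \<and> ndist X (s i) l < \<epsilon>) \<longleftrightarrow>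
    ((\<lambda>i. nrm X (s i - l)) \<longlongrightarrow> 0) G" if "l \<in> carr X"
    using assms that nrm_ge0 diff_mem unfolding tendsto_iff ndist_def dist_real_def
    by (auto simp: abs_of_nonneg)
  then show ?thesis
    by (auto simp: ntop_def M.limitin_metric)
qed

end

text \<open>The inclusion into the ambient Banach space is continuous, so that the limit of a
  sequence for \<open>nrm X\<close> and its ambient limit coincide. Real scalars suffice here;
  \<open>K\<close>-linearity returns when functors are applied.\<close>

locale banach_subspace = normed_subspace X for X :: "'a::banach nspace" +
  assumes mcomplete_X: "Metric_space.mcomplete (carr X) (ndist X)"
    and norm_le_nrm: "\<exists>c. \<forall>x\<in>carr X. norm x \<le> c * nrm X x"
begin

lemma embed_const: obtains c where "c > 0" "\<And>x. x \<in> carr X \<Longrightarrow> norm x \<le> c * nrm X x"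
proof -
  obtain c where c: "\<forall>x\<in>carr X. norm x \<le> c * nrm X x"
    using norm_le_nrm by blast
  have "norm x \<le> max c 1 * nrm X x" if "x \<in> carr X" for x
    using c that nrm_ge0[OF that] by (meson max.cobounded1 mult_right_mono order_trans)
  then show ?thesis
    using that[of "max c 1"] by auto
qed

lemma convergent_of_Cauchy:
  assumes s: "\<And>n. s n \<in> carr X"
    and Cauchy: "\<And>e. e > 0 \<Longrightarrow> \<exists>N. \<forall>m\<ge>N. \<forall>n\<ge>N. nrm X (s m - s n) < e"
  shows "\<exists>l\<in>carr X. (\<lambda>n. nrm X (s n - l)) \<longlonglongrightarrow> 0"
proof -
  have "M.MCauchy s"
    using assms by (auto simp: M.MCauchy_def ndist_def)
  then obtain l where "limitin M.mtopology s l sequentially"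
    using mcomplete_X by (auto simp: M.mcomplete_def)
  then show ?thesis
    using limitin_ntop[where s = s, OF s] by (auto simp: ntop_def)
qed

lemma tendsto_of_nrm:
  assumes "\<And>i. s i \<in> carr X" "l \<in> carr X" "((\<lambda>i. nrm X (s i - l)) \<longlongrightarrow> 0) G"
  shows "(s \<longlongrightarrow> l) G"
proof -
  obtain c where c: "c > 0" "\<And>x. x \<in> carr X \<Longrightarrow> norm x \<le> c * nrm X x"
    using embed_const by blast
  have "((\<lambda>i. c * nrm X (s i - l)) \<longlongrightarrow> 0) G"
    using tendsto_mult_right_zero[OF assms(3)] by simp
  moreover have "\<forall>\<^sub>F i in G. norm (s i - l) \<le> c * nrm X (s i - l)"
    using c assms diff_mem by (intro always_eventually allI) blast
  ultimately have "((\<lambda>i. s i - l) \<longlongrightarrow> 0) G"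
    by (rule Lim_null_comparison[rotated])
  then show ?thesis
    by (rule LIM_zero_cancel)
qed

text \<open>Completeness yields some limit in \<open>X\<close>, and the continuous inclusion
  identifies it with the limit already known in the ambient norm. In this way a vector given only as
  an ambient limit is shown to lie in \<open>X\<close>.\<close>

lemma limit_mem:
  assumes s: "\<And>n. s n \<in> carr X"
    and Cauchy: "\<And>e. e > 0 \<Longrightarrow> \<exists>N. \<forall>m\<ge>N. \<forall>n\<ge>N. nrm X (s m - s n) < e"
    and lim: "s \<longlonglongrightarrow> l"
  shows "l \<in> carr X" "(\<lambda>n. nrm X (s n - l)) \<longlonglongrightarrow> 0"
proof -
  obtain l' where l': "l' \<in> carr X" "(\<lambda>n. nrm X (s n - l')) \<longlonglongrightarrow> 0"
    using convergent_of_Cauchy[OF s Cauchy] by blast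
  then have "s \<longlonglongrightarrow> l'"
    by (intro tendsto_of_nrm s)
  then have "l' = l"
    using lim LIMSEQ_unique by blast
  with l' show "l \<in> carr X" "(\<lambda>n. nrm X (s n - l)) \<longlonglongrightarrow> 0"
    by auto
qed

lemma nrm_limit_le:
  assumes "\<And>n. s n \<in> carr X" "l \<in> carr X" "(\<lambda>n. nrm X (s n - l)) \<longlonglongrightarrow> 0"
    and "\<And>n. nrm X (s n) \<le> b"
  shows "nrm X l \<le> b"
proof (rule LIMSEQ_le_const)
  show "(\<lambda>n. b + nrm X (s n - l)) \<longlonglongrightarrow> b"
    using tendsto_add[OF tendsto_const assms(3)] by simp
  have "nrm X l \<le> b + nrm X (s n - l)" for n
    using nrm_le_add_diff[OF assms(2) assms(1)[of n]] assms(4)[of n] nrm_diff_commute[OF assms(2) assms(1)[of n]]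
    by linarith
  then show "\<exists>N. \<forall>n\<ge>N. nrm X l \<le> b + nrm X (s n - l)"
    by blast
qed

lemma nrm_geometric_le:
  assumes s: "\<And>n. s n \<in> carr X"
    and step: "\<And>n. nrm X (s (Suc n) - s n) \<le> C * r ^ n"
    and r: "0 \<le> r" "r < 1" and mn: "m \<le> n"
  shows "nrm X (s n - s m) \<le> C * r ^ m / (1 - r)"
proof -
  have C: "0 \<le> C"
    using step[of 0] nrm_ge0[OF diff_mem[OF s[of "Suc 0"] s[of 0]]] by simp
  have "nrm X (s (m + k) - s m) \<le> C * r ^ m * (1 - r ^ k) / (1 - r)" for k
  proof (induction k)
    case (Suc k)
    have "nrm X (s (m + Suc k) - s m) \<le> C * r ^ (m + k) + C * r ^ m * (1 - r ^ k) / (1 - r)"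
      using nrm_diff_triangle[of "s (m + Suc k)" "s (m + k)" "s m", OF s s s] step[of "m + k"] Suc.IH by simp
    also have "\<dots> = C * r ^ m * (1 - r ^ Suc k) / (1 - r)"
      using r by (simp add: field_simps power_add)
    finally show ?case .
  qed simp
  from this[of "n - m"] have "nrm X (s n - s m) \<le> C * r ^ m * (1 - r ^ (n - m)) / (1 - r)"
    using mn by simp
  also have "\<dots> \<le> C * r ^ m / (1 - r)"
    using C r by (intro divide_right_mono mult_left_le) auto
  finally show ?thesis .
qed

lemma geometric_limit:
  assumes s: "\<And>n. s n \<in> carr X"
    and step: "\<And>n. nrm X (s (Suc n) - s n) \<le> C * r ^ n"
    and r: "0 \<le> r" "r < 1" and lim: "s \<longlonglongrightarrow> l"
  shows "l \<in> carr X" "nrm X (l - s 0) \<le> C / (1 - r)" "(\<lambda>n. nrm X (s n - l)) \<longlonglongrightarrow> 0"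
proof -
  have *: "(\<lambda>n. C * r ^ n / (1 - r)) \<longlonglongrightarrow> C * 0 / (1 - r)"
    using r by (intro tendsto_intros LIMSEQ_realpow_zero) auto
  have Cauchy: "\<exists>N. \<forall>m\<ge>N. \<forall>n\<ge>N. nrm X (s m - s n) < e" if "e > 0" for e
  proof -
    have "\<forall>\<^sub>F n in sequentially. C * r ^ n / (1 - r) < e / 2"
      using order_tendstoD(2)[OF *, of "e / 2"] \<open>e > 0\<close> by simp
    then obtain N where N: "\<And>n. n \<ge> N \<Longrightarrow> C * r ^ n / (1 - r) < e / 2"
      by (auto simp: eventually_sequentially)
    have "nrm X (s m - s N) < e / 2" if "m \<ge> N" for m
      using nrm_geometric_le[OF s step r that] N[of N] by linarith
    then have "nrm X (s m - s n) < e" if "m \<ge> N" "n \<ge> N" for m n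
      using nrm_diff_triangle[of "s m" "s N" "s n", OF s s s] nrm_diff_commute[of "s N" "s n", OF s s] that
      by (smt (verit) field_sum_of_halves)
    then show ?thesis by blast
  qed
  note L = limit_mem[OF s Cauchy lim]
  show "l \<in> carr X" "(\<lambda>n. nrm X (s n - l)) \<longlonglongrightarrow> 0"
    using L by auto
  show "nrm X (l - s 0) \<le> C / (1 - r)"
  proof (rule nrm_limit_le[where s = "\<lambda>n. s n - s 0"])
    show "nrm X (s n - s 0) \<le> C / (1 - r)" for n
      using nrm_geometric_le[OF s step r, of 0 n] by simp
  qed (use L s diff_mem in auto)
qed

lemma continuous_map_ntop_iff:
  fixes u :: "'b::metric_space \<Rightarrow> 'a"
  shows "continuous_map (top_of_set I) (ntop X) u \<longleftrightarrow>
    (\<forall>t\<in>I. u t \<in> carr X \<and> ((\<lambda>s. nrm X (u s - u t)) \<longlongrightarrow> 0) (at t within I))"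
    (is "?L \<longleftrightarrow> ?R")
proof
  assume L: ?L
  then have mem: "u t \<in> carr X" if "t \<in> I" for t
    using that by (auto simp: continuous_map_def)
  have "((\<lambda>s. nrm X (u s - u t)) \<longlongrightarrow> 0) (at t within I)" if t: "t \<in> I" for t
  proof (rule tendstoI)
    fix e :: real assume "e > 0"
    then obtain U where U: "openin (top_of_set I) U" "t \<in> U" "\<forall>y\<in>U. u y \<in> M.mball (u t) e"
      using L t unfolding ntop_def M.continuous_map_to_metric topspace_euclidean_subtopology by blast
    then obtain d where d: "d > 0" "ball t d \<inter> I \<subseteq> U"
      unfolding openin_euclidean_subtopology_iff
      by (metis Int_iff dist_commute mem_ball subsetI)
    have "nrm X (u y - u t) < e" if "y \<in> I" "dist y t < d" for y
    proof -
      have "u y \<in> M.mball (u t) e"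
        using U d that by (auto simp: dist_commute)
      then show ?thesis
        using nrm_diff_commute by (auto simp: M.in_mball ndist_def)
    qed
    then show "\<forall>\<^sub>F s in at t within I. dist (nrm X (u s - u t)) 0 < e"
      unfolding eventually_at using d(1) mem t nrm_ge0 diff_mem by (auto intro!: exI[of _ d])
  qed
  with mem show ?R by blast
next
  assume R: ?R
  show ?L
    unfolding ntop_def M.continuous_map_to_metric topspace_euclidean_subtopology
  proof (intro ballI allI impI)
    fix t and e :: real
    assume t: "t \<in> I" and e: "e > 0"
    have "\<forall>\<^sub>F s in at t within I. nrm X (u s - u t) < e"
      using order_tendstoD(2)[of _ 0] R t e by blast
    then obtain d where d: "d > 0" "\<forall>y\<in>I. y \<noteq> t \<and> dist y t < d \<longrightarrow> nrm X (u y - u t) < e"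
      by (auto simp: eventually_at)
    have "u y \<in> M.mball (u t) e" if "y \<in> I \<inter> ball t d" for y
      using d that R t nrm_diff_commute[of "u t" "u y"] e
      by (cases "y = t") (auto simp: M.in_mball ndist_def dist_commute)
    then show "\<exists>U. openin (top_of_set I) U \<and> t \<in> U \<and> (\<forall>y\<in>U. u y \<in> M.mball (u t) e)"
      using t d(1) by (intro exI[of _ "I \<inter> ball t d"]) (auto simp: openin_open_Int)
  qed
qed

lemma continuous_map_id_ntop: "continuous_map (ntop X) euclidean (\<lambda>x. x)"
proof -
  obtain c where c: "c > 0" "\<And>x. x \<in> carr X \<Longrightarrow> norm x \<le> c * nrm X x"
    using embed_const by blast
  have "\<exists>d>0. \<forall>x. x \<in> carr X \<and> ndist X a x < d \<longrightarrow> dist a x < e"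
    if "a \<in> carr X" "e > 0" for a e
  proof (intro exI conjI allI impI)
    show "e / c > 0" using that c by simp
    fix x assume x: "x \<in> carr X \<and> ndist X a x < e / c"
    have "dist a x \<le> c * nrm X (a - x)"
      using c x that diff_mem by (simp add: dist_norm)
    also have "\<dots> < e"
      using x that c by (auto simp: ndist_def field_simps split: if_splits)
    finally show "dist a x < e" .
  qed
  then have "continuous_map M.mtopology Met_TC.mtopology (\<lambda>x. x)"
    by (subst M.metric_continuous_map[OF Met_TC.Metric_space_axioms]) auto
  then show ?thesis
    by (simp add: ntop_def)
qed

end

section \<open>Completeness criterion and consequences of Baire's theorem\<close>

lemma (in normed_subspace) banach_subspaceI:
  assumes complete: "\<And>s. (\<And>n. s n \<in> carr X) \<Longrightarrow>
      (\<And>e. e > 0 \<Longrightarrow> \<exists>N. \<forall>m\<ge>N. \<forall>n\<ge>N. nrm X (s m - s n) < e) \<Longrightarrow>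
      \<exists>l\<in>carr X. (\<lambda>n. nrm X (s n - l)) \<longlonglongrightarrow> 0"
    and embed: "\<And>x. x \<in> carr X \<Longrightarrow> norm x \<le> c * nrm X x"
  shows "banach_subspace X"
proof
  show "M.mcomplete"
    unfolding M.mcomplete_def
  proof (intro allI impI)
    fix s assume "M.MCauchy s"
    then have s: "s n \<in> carr X" and C: "e > 0 \<Longrightarrow> \<exists>N. \<forall>m n. N \<le> m \<longrightarrow> N \<le> n \<longrightarrow> ndist X (s m) (s n) < e" for n e
      unfolding M.MCauchy_def by auto
    have "\<exists>N. \<forall>m\<ge>N. \<forall>n\<ge>N. nrm X (s m - s n) < e" if "e > 0" for e
      using C[OF that] s by (auto simp: ndist_def)
    from complete[OF s this] obtain l where l: "l \<in> carr X" "(\<lambda>n. nrm X (s n - l)) \<longlonglongrightarrow> 0"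
      by blast
    then show "\<exists>l. limitin M.mtopology s l sequentially"
      using limitin_ntop[where s = s, OF s] by (auto simp: ntop_def)
  qed
  show "\<exists>c. \<forall>x\<in>carr X. norm x \<le> c * nrm X x"
    using embed by blast
qed

text \<open>Two complete norms that are both finer than the norm of the ambient space are comparable.
  Baire's theorem makes some closure of a ball \<open>{nrm Y \<le> n}\<close> a neighbourhood for \<open>nrm X\<close>, and successive
  approximation removes the closure.\<close>

lemma nrm_comparison:
  assumes "banach_subspace X" "banach_subspace Y" and sub: "carr X \<subseteq> carr Y"
  shows "\<exists>c. \<forall>x\<in>carr X. nrm Y x \<le> c * nrm X x"
proof -
  interpret X: banach_subspace X by fact
  interpret Y: banach_subspace Y by fact
  define B where "B n = {x \<in> carr X. nrm Y x \<le> real n}" for n :: nat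
  have cover: "\<Union>(range (\<lambda>n. X.M.mtopology closure_of (B n))) = carr X"
  proof
    show "\<Union>(range (\<lambda>n. X.M.mtopology closure_of (B n))) \<subseteq> carr X"
      using closure_of_subset_topspace[of X.M.mtopology] by auto
    show "carr X \<subseteq> \<Union>(range (\<lambda>n. X.M.mtopology closure_of (B n)))"
    proof
      fix x assume "x \<in> carr X"
      moreover obtain n where "nrm Y x \<le> real n" using real_arch_simple by blast
      ultimately have "x \<in> B n" by (simp add: B_def)
      moreover have "B n \<subseteq> X.M.mtopology closure_of (B n)"
        by (rule closure_of_subset) (auto simp: B_def)
      ultimately show "x \<in> \<Union>(range (\<lambda>n. X.M.mtopology closure_of (B n)))" by blast
    qed
  qed
  have "\<exists>n. X.M.mtopology interior_of (X.M.mtopology closure_of (B n)) \<noteq> {}"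
  proof (rule ccontr)
    assume "\<not> ?thesis"
    then have "X.M.mtopology interior_of \<Union>(range (\<lambda>n. X.M.mtopology closure_of (B n))) = {}"
      by (intro X.M.metric_Baire_category_alt[OF X.mcomplete_X]) auto
    then have "X.M.mtopology interior_of (carr X) = {}"
      by (simp add: cover)
    moreover have "X.M.mtopology interior_of (carr X) = carr X"
      using interior_of_topspace[of X.M.mtopology] by simp
    ultimately show False using X.zero_mem by blast
  qed
  then obtain n x0 where "x0 \<in> X.M.mtopology interior_of (X.M.mtopology closure_of (B n))" by blast
  then obtain U where U: "openin X.M.mtopology U" "x0 \<in> U" "U \<subseteq> X.M.mtopology closure_of (B n)"
    by (auto simp: interior_of_def)
  then obtain r where r: "r > 0" "X.M.mball x0 r \<subseteq> U"
    by (auto simp: X.M.openin_mtopology)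
  have x0: "x0 \<in> carr X"
    using U(1,2) X.M.openin_mtopology by blast
  have near: "\<exists>y\<in>B n. nrm X (x - y) < e" if "x \<in> carr X" "nrm X (x - x0) < r" "e > 0" for x e
  proof -
    have "x \<in> X.M.mtopology closure_of (B n)"
      using that x0 r U(3) X.nrm_diff_commute by (force simp: ndist_def)
    then obtain y where "y \<in> B n" "y \<in> X.M.mball x e"
      using \<open>e > 0\<close> by (auto simp: X.M.metric_closure_of)
    then show ?thesis by (auto simp: ndist_def B_def split: if_splits)
  qed
  \<comment> \<open>The centre \<open>x0\<close> is removed by subtracting an approximant of
    \<open>x0\<close> from one of \<open>x0 + x\<close>; the two errors \<open>r / 4\<close> add up
    to \<open>r / 2\<close>, and the bound \<open>n\<close> doubles.\<close>
  have near0: "\<exists>y\<in>carr X. nrm Y y \<le> real n + real n \<and> nrm X (x - y) < r / 2"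
    if x: "x \<in> carr X" "nrm X x < r" for x
  proof -
    have "x0 + x \<in> carr X" using X.add_mem x0 that by blast
    then obtain y where y: "y \<in> B n" "nrm X (x0 + x - y) < r / 4"
      using near[of "x0 + x" "r / 4"] x r by auto
    obtain z where z: "z \<in> B n" "nrm X (x0 - z) < r / 4"
      using near[of x0 "r / 4"] x0 r by auto
    have mem: "y \<in> carr X" "z \<in> carr X" using y z by (auto simp: B_def)
    have eq: "x - (y - z) = (x0 + x - y) - (x0 - z)" by simp
    have "nrm X ((x0 + x - y) - (x0 - z)) \<le> nrm X (x0 + x - y) + nrm X (x0 - z)"
      using mem x0 x X.add_mem X.diff_mem by (intro X.nrm_diff_le) auto
    then have "nrm X (x - (y - z)) < r / 2"
      unfolding eq using y z by linarith
    moreover have "nrm Y (y - z) \<le> real n + real n"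
      using Y.nrm_diff_le[of y z] y z mem[THEN subsetD[OF sub]] by (auto simp: B_def)
    ultimately show ?thesis using mem X.diff_mem by blast
  qed
  have near_scaled: "\<exists>y\<in>carr X. nrm Y y \<le> (real n + real n) * a \<and> nrm X (x - y) < r * a / 2"
    if x: "x \<in> carr X" "nrm X x < r * a" "a > 0" for x a
  proof -
    obtain y where y: "y \<in> carr X" "nrm Y y \<le> real n + real n" "nrm X ((1 / a) *\<^sub>R x - y) < r / 2"
      using near0[of "(1 / a) *\<^sub>R x"] x X.scale_mem X.nrm_scale by (auto simp: field_simps)
    have "x - a *\<^sub>R y = a *\<^sub>R ((1 / a) *\<^sub>R x - y)"
      using that by (simp add: scaleR_right_diff_distrib)
    then have "nrm X (x - a *\<^sub>R y) < r * a / 2"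
      using X.nrm_scale[of "(1 / a) *\<^sub>R x - y" a] y that X.scale_mem X.diff_mem by simp
    moreover have "nrm Y (a *\<^sub>R y) \<le> (real n + real n) * a"
      using Y.nrm_scale[of y a] y sub that by (auto simp: mult.commute mult_right_mono)
    ultimately show ?thesis
      using X.scale_mem y by blast
  qed
  \<comment> \<open>Each correction halves the bound on the remainder \<open>z k\<close>, and the
    partial sums are \<open>x - z k\<close>. They tend to \<open>x\<close> in the ambient norm, so
    that their limit in \<open>Y\<close> can only be \<open>x\<close>; \<open>4 * n\<close> is the
    geometric sum that starts with \<open>2 * n\<close>.\<close>
  have bound: "nrm Y x \<le> 4 * real n" if x: "x \<in> carr X" "nrm X x < r" for x
  proof -
    have "\<forall>z k. \<exists>y. z \<in> carr X \<and> nrm X z < r * (1 / 2) ^ k \<longrightarrow>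
        y \<in> carr X \<and> nrm Y y \<le> (real n + real n) * (1 / 2) ^ k \<and> nrm X (z - y) < r * (1 / 2) ^ k / 2"
      using near_scaled by (metis zero_less_divide_1_iff zero_less_numeral zero_less_power)
    then obtain Q where Q: "\<And>z k. z \<in> carr X \<Longrightarrow> nrm X z < r * (1 / 2) ^ k \<Longrightarrow>
        Q z k \<in> carr X \<and> nrm Y (Q z k) \<le> (real n + real n) * (1 / 2) ^ k \<and>
        nrm X (z - Q z k) < r * (1 / 2) ^ k / 2"
      by metis
    define z where "z = rec_nat x (\<lambda>k w. w - Q w k)"
    have z0: "z 0 = x" and zS: "\<And>k. z (Suc k) = z k - Q (z k) k"
      by (simp_all add: z_def)
    have z: "z k \<in> carr X \<and> nrm X (z k) < r * (1 / 2) ^ k" for k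
    proof (induction k)
      case (Suc k)
      then show ?case using Q[of "z k" k] X.diff_mem by (simp add: zS)
    qed (use x in \<open>simp add: z0\<close>)
    have "z \<longlonglongrightarrow> 0"
    proof (rule X.tendsto_of_nrm)
      have lim: "(\<lambda>k. r * (1 / 2) ^ k) \<longlonglongrightarrow> 0"
        using tendsto_mult_right_zero[OF LIMSEQ_realpow_zero[of "1 / 2"], of r] by simp
      have "norm (nrm X (z k - 0)) \<le> r * (1 / 2) ^ k" for k
        using z[of k] X.nrm_ge0[of "z k"] by simp
      then show "(\<lambda>k. nrm X (z k - 0)) \<longlonglongrightarrow> 0"
        by (intro Lim_null_comparison[OF _ lim] always_eventually allI)
    qed (use z X.zero_mem in auto)
    then have "(\<lambda>k. x - z k) \<longlonglongrightarrow> x"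
      using tendsto_diff[OF tendsto_const, of z 0 sequentially x] by simp
    then have "nrm Y (x - (x - z 0)) \<le> (real n + real n) / (1 - 1 / 2)"
    proof (rule Y.geometric_limit(2)[rotated 4])
      show "x - z k \<in> carr Y" for k using z x sub X.diff_mem by blast
      show "nrm Y (x - z (Suc k) - (x - z k)) \<le> (real n + real n) * (1 / 2) ^ k" for k
        using Q[of "z k" k] z by (simp add: zS)
    qed auto
    then show ?thesis
      by (simp add: z0)
  qed
  have "nrm Y x \<le> 8 * real n / r * nrm X x" if x: "x \<in> carr X" for x
  proof (cases "x = 0")
    case False
    then have pos: "nrm X x > 0" using X.nrm_ge0 X.nrm_eq0 x by force
    define a where "a = r / (2 * nrm X x)"
    have a: "a > 0" using pos r by (simp add: a_def)
    have "nrm X (a *\<^sub>R x) < r"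
      using X.nrm_scale[OF x, of a] a pos r by (simp add: a_def)
    then have "nrm Y (a *\<^sub>R x) \<le> 4 * real n"
      using bound X.scale_mem x by blast
    then have "a * nrm Y x \<le> 4 * real n"
      using Y.nrm_scale[of x a] x sub a by auto
    then show ?thesis
      using pos r by (simp add: a_def field_simps)
  qed simp
  then show ?thesis by blast
qed

text \<open>Banach-Steinhaus: by Baire some closed set \<open>C k\<close> contains a ball of radius
  \<open>r\<close> around \<open>x0\<close>, and differences of values on this ball give the
  constant \<open>2 * k / r\<close>.\<close>

lemma uniform_boundedness:
  fixes T :: "'i \<Rightarrow> 'b::banach \<Rightarrow> 'c::real_normed_vector"
  assumes lin: "\<And>i. bounded_linear (T i)" and bdd: "\<And>x. \<exists>B. \<forall>i. norm (T i x) \<le> B"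
  shows "\<exists>B. \<forall>i x. norm (T i x) \<le> B * norm x"
proof -
  define C where "C k = {x. \<forall>i. norm (T i x) \<le> real k}" for k :: nat
  have closed: "closed (C k)" for k
    unfolding C_def using lin
    by (intro closed_Collect_all closed_Collect_le continuous_on_norm continuous_on_const linear_continuous_on)
  have cover: "\<Union>(range C) = UNIV"
  proof -
    have "\<exists>k. x \<in> C k" for x
    proof -
      obtain B where B: "\<forall>i. norm (T i x) \<le> B" using bdd by blast
      obtain k where "B \<le> real k" using real_arch_simple by blast
      with B have "x \<in> C k" by (auto simp: C_def intro: order_trans)
      then show ?thesis ..
    qed
    then show ?thesis by auto
  qed
  have "\<exists>k. interior (C k) \<noteq> {}"
  proof (rule ccontr)
    assume "\<not> ?thesis"
    moreover have "Met_TC.mcomplete (TYPE('b))"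
      by (simp add: mcomplete_iff_complete complete_UNIV)
    ultimately have "euclidean interior_of \<Union>(range C) = {}"
      using Met_TC.metric_Baire_category_alt[where 'a = 'b, of "range C"] closed by auto
    then show False by (simp add: cover)
  qed
  then obtain k x0 where "x0 \<in> interior (C k)" by blast
  then obtain r where r: "r > 0" "cball x0 r \<subseteq> C k"
    by (auto simp: mem_interior_cball)
  have "norm (T i x) \<le> 2 * real k / r * norm x" for i x
  proof (cases "x = 0")
    case False
    define a where "a = r / norm x"
    have a: "a > 0" using False r by (simp add: a_def)
    have "x0 + a *\<^sub>R x \<in> cball x0 r" "x0 \<in> cball x0 r"
      using False r by (auto simp: a_def dist_norm)
    then have "x0 + a *\<^sub>R x \<in> C k" "x0 \<in> C k" using r by blast+
    then have "norm (T i (x0 + a *\<^sub>R x)) \<le> real k" "norm (T i x0) \<le> real k"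
      by (auto simp: C_def)
    then have "norm (T i (x0 + a *\<^sub>R x) - T i x0) \<le> 2 * real k"
      using norm_triangle_ineq4[of "T i (x0 + a *\<^sub>R x)" "T i x0"] by linarith
    also have "T i (x0 + a *\<^sub>R x) - T i x0 = a *\<^sub>R T i x"
      using linear_diff[OF bounded_linear.linear[OF lin[of i]], of "x0 + a *\<^sub>R x" x0]
        linear_scale[OF bounded_linear.linear[OF lin[of i]], of a x] by simp
    finally show ?thesis
      using a False r by (simp add: a_def field_simps)
  qed (use linear_0[OF bounded_linear.linear[OF lin[of i]]] in simp)
  then show ?thesis by blast
qed

section \<open>Vector-valued holomorphic functions\<close>

text \<open>The factor \<open>c\<close> admits norms that are not homogeneous for complex scalars:
  it is 1 on a complex Banach space and 4 on the complexification with its product norm.\<close>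

locale complex_structure =
  fixes scl :: "complex \<Rightarrow> 'b::banach \<Rightarrow> 'b" and c :: real
  assumes scl_add_right: "scl z (x + y) = scl z x + scl z y"
    and scl_add_left: "scl (z + w) x = scl z x + scl w x"
    and scl_scl: "scl z (scl w x) = scl (z * w) x"
    and scl_of_real: "scl (of_real r) x = r *\<^sub>R x"
    and c_ge0: "0 \<le> c"
    and norm_scl_le: "norm (scl z x) \<le> c * cmod z * norm x"
begin

sublocale bounded_bilinear scl
proof
  show "scl (r *\<^sub>R z) x = r *\<^sub>R scl z x" for r z x
    by (metis scaleR_conv_of_real scl_of_real scl_scl)
  show "scl z (r *\<^sub>R x) = r *\<^sub>R scl z x" for r z x
    by (metis mult.commute scl_of_real scl_scl)
  show "\<exists>K. \<forall>a b. norm (scl a b) \<le> norm a * norm b * K"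
    using norm_scl_le by (intro exI[of _ c]) (simp add: mult_ac)
qed (simp_all add: scl_add_right scl_add_left)

lemma scl_1 [simp]: "scl 1 x = x"
  using scl_of_real[of 1 x] by simp

text \<open>The limit of complex difference quotients is recorded as the real-linear map
  \<open>\<lambda>h. scl h D\<close>, a form to which the chain rule along real curves
  applies.\<close>

lemma has_derivative_scl:
  assumes "((\<lambda>h. scl (inverse h) (F (z + h) - F z)) \<longlongrightarrow> D) (at 0)"
  shows "(F has_derivative (\<lambda>h. scl h D)) (at z)"
  unfolding has_derivative_at
proof
  show "bounded_linear (\<lambda>h. scl h D)" by (rule bounded_linear_left)
  have "((\<lambda>h. norm (scl (inverse h) (F (z + h) - F z) - D)) \<longlongrightarrow> 0) (at 0)"
    using assms by (simp add: tendsto_norm_zero_iff LIM_zero_iff)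
  then have lim: "((\<lambda>h. c * norm (scl (inverse h) (F (z + h) - F z) - D)) \<longlongrightarrow> 0) (at 0)"
    by (rule tendsto_mult_right_zero)
  have "norm (F (z + h) - F z - scl h D) / norm h \<le> c * norm (scl (inverse h) (F (z + h) - F z) - D)"
    if "h \<noteq> 0" for h
  proof -
    have "F (z + h) - F z - scl h D = scl h (scl (inverse h) (F (z + h) - F z) - D)"
      using that by (simp add: diff_right scl_scl)
    then have "norm (F (z + h) - F z - scl h D) \<le> c * cmod h * norm (scl (inverse h) (F (z + h) - F z) - D)"
      using norm_scl_le by metis
    then have "norm (F (z + h) - F z - scl h D) / norm h
        \<le> c * cmod h * norm (scl (inverse h) (F (z + h) - F z) - D) / norm h"
      by (rule divide_right_mono) simp
    then show ?thesis
      using that by simp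
  qed
  then show "((\<lambda>h. norm (F (z + h) - F z - scl h D) / norm h) \<longlongrightarrow> 0) (at 0)"
    by (intro Lim_null_comparison[OF _ lim]) (auto simp: eventually_at intro!: exI[of _ 1])
qed

text \<open>In place of Cauchy's formula, two circle averages are compared: \<open>J \<rho>\<close>
  of \<open>F\<close> against \<open>cis (-\<theta>)\<close>, and \<open>K \<rho>\<close> of
  \<open>F'\<close>. Differentiation under the integral, which rests on the continuity of
  \<open>F'\<close>, gives \<open>K\<close> as derivative of \<open>J\<close>; the vanishing
  integral of the angular derivative over a full period gives
  \<open>\<rho> *\<^sub>R K \<rho> = J \<rho>\<close>. Hence \<open>J \<rho> / \<rho>\<close> is
  constant, with limit \<open>K 0\<close>, which is \<open>2 * pi\<close> times \<open>F' a\<close>.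
  The bound then follows from the radius \<open>R / 2\<close>, where the circle lies inside the open
  ball.\<close>

lemma cauchy_estimate:
  assumes R: "R > 0"
    and F: "\<And>z. z \<in> ball a R \<Longrightarrow> (F has_derivative (\<lambda>h. scl h (F' z))) (at z)"
    and cont: "continuous_on (ball a R) F'"
    and m: "\<And>z. z \<in> ball a R \<Longrightarrow> norm (F z) \<le> m"
  shows "norm (F' a) \<le> 2 * c * m / R"
proof -
  define p where "p \<rho> \<theta> = a + of_real \<rho> * cis \<theta>" for \<rho> \<theta> :: real
  have p: "p \<rho> \<theta> \<in> ball a R" if "\<rho> \<in> {-R<..<R}" for \<rho> \<theta>
    using that by (auto simp: p_def dist_norm norm_mult)
  have contF: "continuous_on (ball a R) F"
    using F by (meson continuous_at_imp_continuous_on has_derivative_continuous)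
  have pd1: "((\<lambda>\<rho>. F (p \<rho> \<theta>)) has_vector_derivative scl (cis \<theta>) (F' (p \<rho> \<theta>))) (at \<rho>)"
    if "\<rho> \<in> {-R<..<R}" for \<rho> \<theta>
  proof -
    have "((\<lambda>\<rho>. p \<rho> \<theta>) has_vector_derivative cis \<theta>) (at \<rho>)"
      unfolding p_def by (auto intro!: derivative_eq_intros)
    from vector_derivative_diff_chain_within[OF this, of F "\<lambda>h. scl h (F' (p \<rho> \<theta>))"]
    show ?thesis
      using F[OF p[OF that]] by (simp add: has_derivative_at_withinI o_def)
  qed
  have pd2: "((\<lambda>\<theta>. F (p \<rho> \<theta>)) has_vector_derivative scl (\<i> * of_real \<rho> * cis \<theta>) (F' (p \<rho> \<theta>))) (at \<theta>)"
    if "\<rho> \<in> {-R<..<R}" for \<rho> \<theta>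
  proof -
    have "((\<lambda>z. a + of_real \<rho> * exp (\<i> * z)) has_field_derivative \<i> * of_real \<rho> * cis \<theta>) (at (of_real \<theta>))"
      by (auto intro!: derivative_eq_intros simp: cis_conv_exp)
    from has_vector_derivative_real_field[OF this]
    have "((\<lambda>\<theta>. p \<rho> \<theta>) has_vector_derivative \<i> * of_real \<rho> * cis \<theta>) (at \<theta>)"
      by (simp add: p_def cis_conv_exp)
    from vector_derivative_diff_chain_within[OF this, of F "\<lambda>h. scl h (F' (p \<rho> \<theta>))"]
    show ?thesis
      using F[OF p[OF that]] by (simp add: has_derivative_at_withinI o_def)
  qed
  define J where "J \<rho> = integral {0..2*pi} (\<lambda>\<theta>. scl (cis (-\<theta>)) (F (p \<rho> \<theta>)))" for \<rho>
  define K where "K \<rho> = integral {0..2*pi} (\<lambda>\<theta>. F' (p \<rho> \<theta>))" for \<rho>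
  have cont_cis [continuous_intros]: "continuous_on A (\<lambda>\<theta>. cis (g \<theta>))"
    if "continuous_on A g" for A :: "'x::topological_space set" and g
    unfolding cis_conv_exp using that by (intro continuous_intros)
  have contJ: "continuous_on {0..2*pi} (\<lambda>\<theta>. scl (cis (-\<theta>)) (F (p \<rho> \<theta>)))" if "\<rho> \<in> {-R<..<R}" for \<rho>
    using p[OF that] unfolding p_def
    by (intro continuous_on continuous_on_compose2[OF contF] continuous_intros) auto
  have contK: "continuous_on ({-R<..<R} \<times> {0..2*pi}) (\<lambda>(\<rho>, \<theta>). F' (p \<rho> \<theta>))"
    using p unfolding p_def case_prod_beta
    by (intro continuous_on_compose2[OF cont] continuous_intros) auto
  have JK: "(J has_vector_derivative K \<rho>) (at \<rho> within {-R<..<R})" if \<rho>: "\<rho> \<in> {-R<..<R}" for \<rho>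
    unfolding J_def[abs_def] K_def interval_cbox
  proof (rule leibniz_rule_vector_derivative)
    fix x t :: real assume x: "x \<in> {-R<..<R}"
    have "((\<lambda>\<rho>. scl (cis (-t)) (F (p \<rho> t))) has_vector_derivative scl (cis (-t)) (scl (cis t) (F' (p x t)))) (at x)"
      by (rule bounded_linear.has_vector_derivative[OF bounded_linear_right pd1[OF x]])
    then show "((\<lambda>x. scl (cis (-t)) (F (p x t))) has_vector_derivative F' (p x t)) (at x within {-R<..<R})"
      by (simp add: scl_scl cis_mult has_vector_derivative_at_within)
  qed (use \<rho> contJ contK in \<open>auto intro!: integrable_continuous_real simp: interval_cbox[symmetric]\<close>)
  have KJ: "\<rho> *\<^sub>R K \<rho> = J \<rho>" if \<rho>: "\<rho> \<in> {-R<..<R}" for \<rho>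
  proof -
    have "((\<lambda>\<theta>. scl (cis (-\<theta>)) (F (p \<rho> \<theta>))) has_vector_derivative
        scl (\<i> * of_real \<rho>) (F' (p \<rho> \<theta>)) - scl \<i> (scl (cis (-\<theta>)) (F (p \<rho> \<theta>)))) (at \<theta>)" for \<theta>
    proof -
      have "((\<lambda>z. exp (- (\<i> * z))) has_field_derivative - \<i> * cis (-\<theta>)) (at (of_real \<theta>))"
        by (auto intro!: derivative_eq_intros simp: cis_conv_exp)
      from has_vector_derivative_real_field[OF this]
      have 1: "((\<lambda>\<theta>. cis (-\<theta>)) has_vector_derivative - \<i> * cis (-\<theta>)) (at \<theta>)"
        by (simp add: cis_conv_exp)
      have "cis (-\<theta>) * (\<i> * of_real \<rho> * cis \<theta>) = \<i> * of_real \<rho> * (cis (-\<theta>) * cis \<theta>)"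
        by (simp only: mult_ac)
      also have "\<dots> = \<i> * of_real \<rho>" by (simp add: cis_mult)
      finally have 2: "scl (cis (-\<theta>)) (scl (\<i> * of_real \<rho> * cis \<theta>) x) = scl (\<i> * of_real \<rho>) x" for x
        by (simp only: scl_scl)
      have 3: "scl (- \<i> * cis (-\<theta>)) x = - scl \<i> (scl (cis (-\<theta>)) x)" for x
        by (simp only: scl_scl mult_minus_left minus_left)
      show ?thesis
        using has_vector_derivative[OF 1 pd2[OF \<rho>, of \<theta>]] unfolding 2 3 by (simp only: add.commute diff_conv_add_uminus)
    qed
    then have "((\<lambda>\<theta>. scl (\<i> * of_real \<rho>) (F' (p \<rho> \<theta>)) - scl \<i> (scl (cis (-\<theta>)) (F (p \<rho> \<theta>))))
        has_integral (scl (cis (- (2 * pi))) (F (p \<rho> (2 * pi))) - scl (cis (- 0)) (F (p \<rho> 0)))) {0..2*pi}"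
      by (intro fundamental_theorem_of_calculus) (auto intro: has_vector_derivative_at_within)
    moreover have "cis (- (2 * pi)) = 1" "cis (2 * pi) = 1" by (auto simp: complex_eq_iff)
    ultimately have z: "((\<lambda>\<theta>. scl (\<i> * of_real \<rho>) (F' (p \<rho> \<theta>)) - scl \<i> (scl (cis (-\<theta>)) (F (p \<rho> \<theta>))))
        has_integral 0) {0..2*pi}"
      by (simp add: p_def)
    have "continuous_on {0..2*pi} (\<lambda>\<theta>. F' (p \<rho> \<theta>))"
      using p[OF \<rho>] unfolding p_def
      by (intro continuous_on_compose2[OF cont] continuous_intros) auto
    then have "((\<lambda>\<theta>. scl (\<i> * of_real \<rho>) (F' (p \<rho> \<theta>))) has_integral scl (\<i> * of_real \<rho>) (K \<rho>)) {0..2*pi}"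
      unfolding K_def
      using has_integral_linear[OF integrable_integral[OF integrable_continuous_real] bounded_linear_right]
      by (auto simp: o_def)
    moreover have "((\<lambda>\<theta>. scl \<i> (scl (cis (-\<theta>)) (F (p \<rho> \<theta>)))) has_integral scl \<i> (J \<rho>)) {0..2*pi}"
      unfolding J_def
      using has_integral_linear[OF integrable_integral[OF integrable_continuous_real[OF contJ[OF \<rho>]]] bounded_linear_right]
      by (auto simp: o_def)
    ultimately have "((\<lambda>\<theta>. scl (\<i> * of_real \<rho>) (F' (p \<rho> \<theta>)) - scl \<i> (scl (cis (-\<theta>)) (F (p \<rho> \<theta>))))
        has_integral (scl (\<i> * of_real \<rho>) (K \<rho>) - scl \<i> (J \<rho>))) {0..2*pi}"
      by (rule has_integral_diff)
    from has_integral_unique[OF this z] have "scl (\<i> * of_real \<rho>) (K \<rho>) = scl \<i> (J \<rho>)"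
      by simp
    then have "scl (- \<i>) (scl (\<i> * of_real \<rho>) (K \<rho>)) = scl (- \<i>) (scl \<i> (J \<rho>))" by simp
    then show ?thesis by (simp add: scl_scl scl_of_real)
  qed
  have "((\<lambda>\<rho>. (1 / \<rho>) *\<^sub>R J \<rho>) has_vector_derivative 0) (at \<rho> within {0<..<R})" if \<rho>: "\<rho> \<in> {0<..<R}" for \<rho>
  proof -
    have 1: "(J has_vector_derivative K \<rho>) (at \<rho> within {0<..<R})"
      using JK[of \<rho>] \<rho> R by (auto intro: has_vector_derivative_within_subset)
    have "((\<lambda>\<rho>. 1 / \<rho>) has_real_derivative - (1 / \<rho>\<^sup>2)) (at \<rho> within {0<..<R})"
      using \<rho> by (auto intro!: derivative_eq_intros simp: power2_eq_square)
    from has_vector_derivative_scaleR[OF this 1]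
    have "((\<lambda>\<rho>. (1 / \<rho>) *\<^sub>R J \<rho>) has_vector_derivative ((1 / \<rho>) *\<^sub>R K \<rho> + (- (1 / \<rho>\<^sup>2)) *\<^sub>R J \<rho>)) (at \<rho> within {0<..<R})"
      by (simp add: add.commute)
    moreover have "(1 / \<rho>) *\<^sub>R K \<rho> + (- (1 / \<rho>\<^sup>2)) *\<^sub>R J \<rho> = 0"
    proof -
      have "J \<rho> = \<rho> *\<^sub>R K \<rho>" using KJ[of \<rho>] \<rho> by auto
      then show ?thesis using \<rho> by (simp add: power2_eq_square)
    qed
    ultimately show ?thesis by simp
  qed
  then obtain k where k: "\<And>\<rho>. \<rho> \<in> {0<..<R} \<Longrightarrow> (1 / \<rho>) *\<^sub>R J \<rho> = k"
    using has_vector_derivative_zero_constant[of "{0<..<R}" "\<lambda>\<rho>. (1 / \<rho>) *\<^sub>R J \<rho>"] by auto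
  have J0: "J 0 = 0" using KJ[of 0] R by simp
  have "(J has_vector_derivative K 0) (at 0 within {0<..<R})"
    by (rule has_vector_derivative_within_subset[OF JK[of 0]]) (use R in auto)
  then have "((\<lambda>\<rho>. (1 / \<bar>\<rho>\<bar>) *\<^sub>R (J \<rho> - \<rho> *\<^sub>R K 0)) \<longlongrightarrow> 0) (at 0 within {0<..<R})"
    unfolding has_vector_derivative_def has_derivative_within by (simp add: J0)
  then have "((\<lambda>\<rho>. (1 / \<rho>) *\<^sub>R J \<rho> - K 0) \<longlongrightarrow> 0) (at 0 within {0<..<R})"
    by (rule Lim_transform_eventually) (auto simp: eventually_at scaleR_diff_right intro!: exI[of _ 1])
  then have "((\<lambda>\<rho>. (1 / \<rho>) *\<^sub>R J \<rho>) \<longlongrightarrow> K 0) (at 0 within {0<..<R})"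
    by (rule LIM_zero_cancel)
  moreover have "((\<lambda>\<rho>. (1 / \<rho>) *\<^sub>R J \<rho>) \<longlongrightarrow> k) (at 0 within {0<..<R})"
    by (rule Lim_transform_eventually[OF tendsto_const]) (auto simp: eventually_at k intro!: exI[of _ 1])
  moreover have "at (0::real) within {0<..<R} \<noteq> bot"
    using R by (simp add: at_within_eq_bot_iff)
  ultimately have "k = K 0" using tendsto_unique by blast
  also have "K 0 = (2 * pi) *\<^sub>R F' a" by (simp add: K_def p_def)
  finally have eq: "(2 / R) *\<^sub>R J (R / 2) = (2 * pi) *\<^sub>R F' a"
    using k[of "R / 2"] R by simp
  have "norm (J (R / 2)) \<le> (c * m) * (2 * pi - 0)"
    unfolding J_def
  proof (rule integral_bound)
    fix \<theta>
    have "c * cmod (cis (-\<theta>)) * norm (F (p (R / 2) \<theta>)) \<le> c * m"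
      using m[OF p[of "R / 2" \<theta>]] R c_ge0 by (simp add: mult_left_mono)
    then show "norm (scl (cis (-\<theta>)) (F (p (R / 2) \<theta>))) \<le> c * m"
      using norm_scl_le order_trans by blast
  qed (use contJ[of "R / 2"] R in auto)
  moreover have "2 / R * norm (J (R / 2)) = 2 * pi * norm (F' a)"
    using arg_cong[OF eq, of norm] R by simp
  ultimately show ?thesis
    using R by (simp add: field_simps)
qed

end

text \<open>For \<open>\<delta> \<le> pi\<close> the sector avoids the negative real axis, where
  \<open>Arg\<close> jumps.\<close>

lemma open_sector:
  assumes "\<delta> \<le> pi"
  shows "open (sector \<delta>)"
proof -
  have "sector \<delta> = - \<real>\<^sub>\<le>\<^sub>0 \<inter> (\<lambda>z. \<bar>Arg z\<bar>) -` {..<\<delta>}"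
  proof (intro set_eqI iffI)
    fix z assume z: "z \<in> sector \<delta>"
    then have "Arg z \<noteq> pi" using assms by (auto simp: sector_def)
    then show "z \<in> - \<real>\<^sub>\<le>\<^sub>0 \<inter> (\<lambda>z. \<bar>Arg z\<bar>) -` {..<\<delta>}"
      using z by (auto simp: sector_def complex_nonpos_Reals_iff Arg_eq_pi complex_eq_iff)
  qed (auto simp: sector_def)
  moreover have "continuous_on (- \<real>\<^sub>\<le>\<^sub>0) (\<lambda>z. \<bar>Arg z\<bar>)"
    by (intro continuous_on_rabs continuous_on_Arg)
  ultimately show ?thesis
    by (simp add: continuous_open_preimage open_Compl closed_nonpos_Reals_complex)
qed

text \<open>Sectors are invariant under positive dilations, so that a ball around 1 can be scaled by
  \<open>t\<close>.\<close>

lemma ball_subset_sector: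
  assumes "0 < \<delta>" "\<delta> \<le> pi"
  obtains \<kappa> where "0 < \<kappa>" "\<kappa> < 1" "\<And>t. t > 0 \<Longrightarrow> ball (of_real t) (\<kappa> * t) \<subseteq> sector \<delta>"
proof -
  have "1 \<in> sector \<delta>" using assms by (simp add: sector_def)
  then obtain \<epsilon> where \<epsilon>: "\<epsilon> > 0" "ball 1 \<epsilon> \<subseteq> sector \<delta>"
    using open_sector[OF assms(2)] open_contains_ball by blast
  define \<kappa> where "\<kappa> = min \<epsilon> (1 / 2)"
  have "z \<in> sector \<delta>" if "t > 0" "z \<in> ball (of_real t) (\<kappa> * t)" for t z
  proof -
    have "dist 1 (z / of_real t) = dist (of_real t) z / t"
    proof -
      have "1 - z / of_real t = (of_real t - z) / of_real t"
        using that by (simp add: field_simps)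
      then show ?thesis using that by (simp add: dist_norm norm_divide)
    qed
    also have "\<dots> < \<kappa>" using that by (simp add: field_simps)
    also have "\<kappa> \<le> \<epsilon>" by (simp add: \<kappa>_def)
    finally have "z / of_real t \<in> sector \<delta>" using \<epsilon> by auto
    then show ?thesis using that by (auto simp: sector_def)
  qed
  moreover have "0 < \<kappa>" "\<kappa> < 1" using \<epsilon> by (auto simp: \<kappa>_def)
  ultimately show ?thesis using that by blast
qed

section \<open>Derivative bounds for analytic semigroups near time 0\<close>

context complex_structure
begin

text \<open>Cauchy's estimate on a disc around \<open>t\<close> of radius proportional to \<open>t\<close>; the uniform bound on the
  discs comes from strong continuity at \<open>0\<close> and uniform boundedness.\<close>

lemma analytic_semigroup_derivative:
  assumes "complex_analytic_semigroup scl S"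
  shows "\<exists>r>0. \<exists>M D. \<forall>t\<in>{0<..r}. \<forall>x. ((\<lambda>s. S s x) has_vector_derivative D t x) (at t) \<and>
           norm (D t x) \<le> M / t * norm x"
proof -
  obtain \<delta> Z where *: "0 < \<delta> \<and> \<delta> \<le> pi / 2 \<and> (\<forall>t\<ge>0. Z (of_real t) = S t) \<and>
      (\<forall>z\<in>sector \<delta>. bounded_linear (Z z) \<and> (\<forall>k x. Z z (scl k x) = scl k (Z z x))) \<and>
      (\<forall>z\<in>sector \<delta>. \<forall>w\<in>sector \<delta>. Z (z + w) = Z z \<circ> Z w) \<and>
      (\<forall>z\<in>sector \<delta>. \<exists>D. bounded_linear D \<and>
         ((\<lambda>h. onorm (\<lambda>x. scl (inverse h) (Z (z + h) x - Z z x) - D x)) \<longlongrightarrow> 0) (at 0)) \<and>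
      (\<forall>\<delta>'. 0 < \<delta>' \<and> \<delta>' < \<delta> \<longrightarrow> (\<forall>x. ((\<lambda>z. Z z x) \<longlongrightarrow> x) (at 0 within sector \<delta>')))"
    using assms unfolding complex_analytic_semigroup_def by (elim exE) (rule that)
  have \<delta>: "0 < \<delta>" "\<delta> \<le> pi / 2" using * by - (elim conjE, assumption)+
  have ZS: "Z (of_real t) = S t" if "t \<ge> 0" for t
    using * that by simp
  have Zlin: "bounded_linear (Z z)" and Zscl: "Z z (scl k x) = scl k (Z z x)" if "z \<in> sector \<delta>" for z k x
    using * that by simp_all
  have Zadd: "Z (z + w) = Z z \<circ> Z w" if "z \<in> sector \<delta>" "w \<in> sector \<delta>" for z w
    using * that by simp
  have Zdiff: "\<forall>z. \<exists>D. z \<in> sector \<delta> \<longrightarrow> bounded_linear D \<and>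
      ((\<lambda>h. onorm (\<lambda>x. scl (inverse h) (Z (z + h) x - Z z x) - D x)) \<longlongrightarrow> 0) (at 0)"
    using * by simp
  have Z0: "((\<lambda>z. Z z x) \<longlongrightarrow> x) (at 0 within sector \<delta>')" if "0 < \<delta>'" "\<delta>' < \<delta>" for \<delta>' x
    using * that by simp
  have "\<delta> \<le> pi" using \<delta> pi_gt_zero by linarith
  note op = open_sector[OF this]
  obtain D where D': "\<forall>z. z \<in> sector \<delta> \<longrightarrow> bounded_linear (D z) \<and>
      ((\<lambda>h. onorm (\<lambda>x. scl (inverse h) (Z (z + h) x - Z z x) - D z x)) \<longlongrightarrow> 0) (at 0)"
    using choice[OF Zdiff] by (elim exE) (rule that)
  have Dlin: "bounded_linear (D z)" if "z \<in> sector \<delta>" for z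
    using mp[OF spec[OF D'] that] by (rule conjunct1)
  have D: "((\<lambda>h. onorm (\<lambda>x. scl (inverse h) (Z (z + h) x - Z z x) - D z x)) \<longlongrightarrow> 0) (at 0)"
    if "z \<in> sector \<delta>" for z
    using mp[OF spec[OF D'] that] by (rule conjunct2)
  have near: "\<forall>\<^sub>F h in at 0. z + h \<in> sector \<delta>" if z: "z \<in> sector \<delta>" for z
  proof -
    obtain e where "e > 0" "ball z e \<subseteq> sector \<delta>"
      using openE[OF op z] by blast
    then show ?thesis
      unfolding eventually_at by (intro exI[of _ e]) (auto simp: dist_norm)
  qed
  have diff: "((\<lambda>h. scl (inverse h) (Z (z + h) x - Z z x)) \<longlongrightarrow> D z x) (at 0)" if z: "z \<in> sector \<delta>" for z x
  proof -
    have "((\<lambda>h. onorm (\<lambda>x. scl (inverse h) (Z (z + h) x - Z z x) - D z x) * norm x) \<longlongrightarrow> 0) (at 0)"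
      using D[OF z] by (rule tendsto_mult_left_zero)
    moreover have "\<forall>\<^sub>F h in at 0. norm (scl (inverse h) (Z (z + h) x - Z z x) - D z x) \<le>
        onorm (\<lambda>x. scl (inverse h) (Z (z + h) x - Z z x) - D z x) * norm x"
      using near[OF z]
    proof eventually_elim
      case (elim h)
      have "bounded_linear (\<lambda>x. scl (inverse h) (Z (z + h) x - Z z x) - D z x)"
        using bounded_linear_compose[OF bounded_linear_right bounded_linear_sub[OF Zlin[OF elim] Zlin[OF z]]] Dlin[OF z]
        by (intro bounded_linear_sub) auto
      then show ?case by (rule onorm)
    qed
    ultimately have "((\<lambda>h. scl (inverse h) (Z (z + h) x - Z z x) - D z x) \<longlongrightarrow> 0) (at 0)"
      by (rule Lim_null_comparison[rotated])
    then show ?thesis by (rule LIM_zero_cancel)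
  qed
  have deriv: "((\<lambda>z. Z z x) has_derivative (\<lambda>h. scl h (D z x))) (at z)" if "z \<in> sector \<delta>" for z x
    by (rule has_derivative_scl[OF diff[OF that]])
  \<comment> \<open>This supplies the continuity of the derivative that the Cauchy estimate
    requires: near \<open>t\<close> one has \<open>D z x = Z (z - t / 4) (D (t / 4) x)\<close>, and
    the orbits of \<open>Z\<close> are continuous.\<close>
  have D_shift: "D (z + w) x = Z z (D w x)" if z: "z \<in> sector \<delta>" and w: "w \<in> sector \<delta>" and zw: "z + w \<in> sector \<delta>" for z w x
  proof -
    have "((\<lambda>h. Z z (scl (inverse h) (Z (w + h) x - Z w x))) \<longlongrightarrow> Z z (D w x)) (at 0)"
      by (rule bounded_linear.tendsto[OF Zlin[OF z] diff[OF w]])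
    moreover have "\<forall>\<^sub>F h in at 0. Z z (scl (inverse h) (Z (w + h) x - Z w x)) =
        scl (inverse h) (Z (z + w + h) x - Z (z + w) x)"
      using near[OF w]
    proof eventually_elim
      case (elim h)
      then show ?case
        using Zadd[OF z elim] Zadd[OF z w] Zscl[OF z] linear_diff[OF bounded_linear.linear[OF Zlin[OF z]]]
        by (simp add: add.assoc)
    qed
    ultimately have "((\<lambda>h. scl (inverse h) (Z (z + w + h) x - Z (z + w) x)) \<longlongrightarrow> Z z (D w x)) (at 0)"
      by (rule Lim_transform_eventually)
    from tendsto_unique[OF at_neq_bot diff[OF zw] this] show ?thesis .
  qed
  \<comment> \<open>Strong continuity at 0 is available on strictly smaller sectors, hence the half
    angle.\<close>
  define \<delta>1 where "\<delta>1 = \<delta> / 2"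
  have \<delta>1: "0 < \<delta>1" "\<delta>1 < \<delta>" "\<delta>1 \<le> pi" using \<delta> \<open>\<delta> \<le> pi\<close> by (auto simp: \<delta>1_def)
  have sub: "sector \<delta>1 \<subseteq> sector \<delta>" using \<delta>1 by (auto simp: sector_def)
  obtain \<kappa>' where \<kappa>': "0 < \<kappa>'" "\<kappa>' < 1" "\<And>t. t > 0 \<Longrightarrow> ball (of_real t) (\<kappa>' * t) \<subseteq> sector \<delta>1"
    using ball_subset_sector[OF \<delta>1(1,3)] by blast
  \<comment> \<open>The factor 1/2 leaves room for shifting the disc by \<open>t / 4\<close>: the
    shifted disc is centred at \<open>3 / 4 * t\<close> and still lies in the sector.\<close>
  define \<kappa> where "\<kappa> = \<kappa>' / 2"
  have \<kappa>: "0 < \<kappa>" "\<kappa> < 1" using \<kappa>' by (auto simp: \<kappa>_def)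
  have ball1: "z \<in> sector \<delta>1" if "t > 0" "z \<in> ball (of_real t) (\<kappa> * t)" for z t
  proof -
    have "\<kappa> * t \<le> \<kappa>' * t" using that(1) \<kappa>' by (simp add: \<kappa>_def)
    then show ?thesis using \<kappa>'(3)[OF that(1)] that(2) subset_ball by blast
  qed
  have ball2: "z - of_real (t / 4) \<in> sector \<delta>" if "t > 0" "z \<in> ball (of_real t) (\<kappa> * t)" for z t
  proof -
    have "dist (of_real (3 / 4 * t)) (z - of_real (t / 4)) = dist (of_real t) z"
    proof -
      have "complex_of_real (3 / 4 * t) - (z - of_real (t / 4)) = of_real t - z"
        by (simp add: field_simps)
      then show ?thesis by (simp add: dist_norm)
    qed
    also have "\<dots> < \<kappa>' * (3 / 4 * t)"
    proof -
      have "\<kappa> * t \<le> \<kappa>' * (3 / 4 * t)" using that(1) \<kappa>' by (simp add: \<kappa>_def)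
      then show ?thesis using that(2) by simp
    qed
    finally have "z - of_real (t / 4) \<in> ball (of_real (3 / 4 * t)) (\<kappa>' * (3 / 4 * t))"
      by simp
    then show ?thesis using \<kappa>'(3)[of "3 / 4 * t"] that(1) sub by (auto simp del: of_real_mult)
  qed
  \<comment> \<open>Otherwise there are points \<open>z n\<close> in the sector that tend to 0 and
    whose operators violate the bound \<open>n\<close>. By strong continuity their orbits converge,
    so uniform boundedness bounds all \<open>Z (z n)\<close> at once.\<close>
  have "\<exists>r>0. \<exists>M0. \<forall>z\<in>sector \<delta>1. cmod z < r \<longrightarrow> (\<forall>x. norm (Z z x) \<le> M0 * norm x)"
  proof (rule ccontr)
    assume neg: "\<not> ?thesis"
    have "\<exists>z\<in>sector \<delta>1. cmod z < 1 / (real n + 1) \<and> (\<exists>x. \<not> norm (Z z x) \<le> real n * norm x)" for n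
    proof -
      have "\<exists>z\<in>sector \<delta>1. cmod z < r \<and> (\<exists>x. \<not> norm (Z z x) \<le> M0 * norm x)" if "r > 0" for r M0
        using neg that by blast
      then show ?thesis by simp
    qed
    then obtain z x where z: "\<And>n. z n \<in> sector \<delta>1" "\<And>n. cmod (z n) < 1 / (real n + 1)"
      and x: "\<And>n. \<not> norm (Z (z n) (x n)) \<le> real n * norm (x n)"
      by metis
    have "(\<lambda>n. 1 / (real n + 1)) \<longlonglongrightarrow> 0"
      using LIMSEQ_inverse_real_of_nat by (simp add: inverse_eq_divide add.commute)
    then have "z \<longlonglongrightarrow> 0"
      by (rule Lim_null_comparison[rotated]) (use z(2) less_imp_le in \<open>auto intro!: always_eventually\<close>)
    moreover have "z n \<noteq> 0" for n using z(1)[of n] by (auto simp: sector_def)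
    ultimately have "filterlim z (at 0 within sector \<delta>1) sequentially"
      using z(1) by (auto simp: filterlim_at)
    then have conv: "(\<lambda>n. Z (z n) y) \<longlonglongrightarrow> y" for y
      using filterlim_compose[OF Z0[OF \<delta>1(1,2)]] by blast
    have "\<exists>B. \<forall>n. norm (Z (z n) y) \<le> B" for y
      using convergent_imp_bounded[OF conv[of y]] by (auto simp: bounded_iff)
    then obtain B where B: "\<And>n y. norm (Z (z n) y) \<le> B * norm y"
      using uniform_boundedness[of "\<lambda>n. Z (z n)"] Zlin z(1) sub by blast
    obtain n where "B \<le> real n" using real_arch_simple by blast
    then have "norm (Z (z n) (x n)) \<le> real n * norm (x n)"
      using B[of n "x n"] by (meson mult_right_mono norm_ge_zero order_trans)
    with x show False by blast
  qed
  then obtain r M0 where r: "r > 0"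
    and M0: "\<And>z x. z \<in> sector \<delta>1 \<Longrightarrow> cmod z < r \<Longrightarrow> norm (Z z x) \<le> M0 * norm x" by blast
  \<comment> \<open>The restriction \<open>t \<le> r / 2\<close> keeps the disc within
    \<open>cmod z < r\<close>, since the points of the disc have modulus below
    \<open>2 * t\<close>.\<close>
  have main: "((\<lambda>s. S s x) has_vector_derivative D (of_real t) x) (at t) \<and>
      norm (D (of_real t) x) \<le> (2 * c * M0 / \<kappa>) / t * norm x" if t: "t \<in> {0<..r / 2}" for t x
  proof
    have t0: "t > 0" using t by simp
    have in_ball: "of_real t \<in> ball (of_real t) (\<kappa> * t)" using t0 \<kappa> by simp
    have in_sector: "complex_of_real t \<in> sector \<delta>" using ball1[OF t0 in_ball] sub by blast
    have "(complex_of_real has_vector_derivative 1) (at t)"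
      by (auto intro!: derivative_eq_intros)
    from vector_derivative_diff_chain_within[OF this, of "\<lambda>z. Z z x" "\<lambda>h. scl h (D (of_real t) x)"]
    have "((\<lambda>s. Z (of_real s) x) has_vector_derivative D (of_real t) x) (at t)"
      using deriv[OF in_sector] by (simp add: has_derivative_at_withinI o_def)
    then show "((\<lambda>s. S s x) has_vector_derivative D (of_real t) x) (at t)"
    proof (rule has_vector_derivative_transform_within_open[of _ _ _ "{0<..}"])
      show "Z (of_real s) x = S s x" if "s \<in> {0<..}" for s using ZS[of s] that by simp
    qed (use t0 in auto)
    have "norm (D (of_real t) x) \<le> 2 * c * (M0 * norm x) / (\<kappa> * t)"
    proof (rule cauchy_estimate)
      show "\<kappa> * t > 0" using t0 \<kappa> by simp
      fix z assume z: "z \<in> ball (complex_of_real t) (\<kappa> * t)"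
      show "((\<lambda>z. Z z x) has_derivative (\<lambda>h. scl h (D z x))) (at z)"
        using deriv ball1[OF t0 z] sub by blast
      have "cmod z \<le> t + dist (of_real t) z"
        using t0 norm_triangle_ineq4[of "of_real t" "of_real t - z"] by (simp add: dist_norm)
      also have "\<dots> < t + 1 * t" using z \<kappa> t0 by (auto intro: less_trans)
      finally show "norm (Z z x) \<le> M0 * norm x"
        using M0[OF ball1[OF t0 z]] t by simp
    next
      have t4: "complex_of_real (t / 4) \<in> sector \<delta>"
        using ball1[of "t / 4" "of_real (t / 4)"] t0 \<kappa> sub by auto
      have eq: "D z x = Z (z - of_real (t / 4)) (D (of_real (t / 4)) x)"
        if "z \<in> ball (complex_of_real t) (\<kappa> * t)" for z
        using D_shift[OF ball2[OF t0 that] t4, of x] ball1[OF t0 that] sub by (simp add: subset_iff)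
      have "continuous_on (sector \<delta>) (\<lambda>z. Z z y)" for y
        using deriv by (meson continuous_at_imp_continuous_on has_derivative_continuous)
      then have "continuous_on (ball (complex_of_real t) (\<kappa> * t)) (\<lambda>z. Z (z - of_real (t / 4)) (D (of_real (t / 4)) x))"
        by (rule continuous_on_compose2) (use ball2[OF t0] in \<open>auto intro!: continuous_intros\<close>)
      then show "continuous_on (ball (complex_of_real t) (\<kappa> * t)) (\<lambda>z. D z x)"
        by (rule continuous_on_eq) (rule eq[symmetric])
    qed
    then show "norm (D (of_real t) x) \<le> (2 * c * M0 / \<kappa>) / t * norm x"
      by (simp add: field_simps)
  qed
  show ?thesis
    by (rule exI[of _ "r / 2"], intro conjI exI[of _ "2 * c * M0 / \<kappa>"] exI[of _ "\<lambda>t. D (of_real t)"])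
      (use r main in auto)
qed

end

text \<open>Each of the two components is a sum of two terms of norm at most
  \<open>cmod z * norm p\<close>, which accounts for the constant 4.\<close>

lemma complex_structure_complexified:
  "complex_structure (complexified_scale :: complex \<Rightarrow> 'a::banach \<times> 'a \<Rightarrow> _) 4"
proof
  fix z and p :: "'a \<times> 'a"
  have 1: "norm (Re z *\<^sub>R x) \<le> cmod z * norm p" "norm (Im z *\<^sub>R x) \<le> cmod z * norm p"
    if "norm x \<le> norm p" for x :: 'a
    using that abs_Re_le_cmod[of z] abs_Im_le_cmod[of z] by (auto intro!: mult_mono)
  have 2: "norm (fst p) \<le> norm p" "norm (snd p) \<le> norm p"
    using norm_fst_le[of "fst p" "snd p"] norm_snd_le[of "snd p" "fst p"] by simp_all
  have "norm (complexified_scale z p) \<le>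
      norm (Re z *\<^sub>R fst p - Im z *\<^sub>R snd p) + norm (Im z *\<^sub>R fst p + Re z *\<^sub>R snd p)"
    unfolding complexified_scale_def by (rule norm_Pair_le)
  also have "\<dots> \<le> 4 * cmod z * norm p"
    using norm_triangle_ineq4[of "Re z *\<^sub>R fst p" "Im z *\<^sub>R snd p"]
      norm_triangle_ineq[of "Im z *\<^sub>R fst p" "Re z *\<^sub>R snd p"] 1[OF 2(1)] 1[OF 2(2)] by linarith
  finally show "norm (complexified_scale z p) \<le> 4 * cmod z * norm p" .
qed (auto simp: complexified_scale_def algebra_simps)

text \<open>Over the reals the result is applied to the complexified semigroup at
  \<open>(x, 0)\<close>; the first component of the derivative is the derivative sought.\<close>

lemma analytic_semigroup_derivative:
  assumes K: "K = \<real> \<or> K = UNIV" and scl: "scalar_action K scl" and S: "analytic_semigroup K scl S"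
  shows "\<exists>r>0. \<exists>M D. \<forall>t\<in>{0<..r}. \<forall>x. ((\<lambda>s. S s x) has_vector_derivative D t x) (at t) \<and>
           norm (D t x) \<le> M / t * norm x"
proof (cases "K = UNIV")
  case True
  interpret complex_structure scl 1
    using scl True by unfold_locales (auto simp: scalar_action_def)
  show ?thesis
    using S True by (intro analytic_semigroup_derivative) (simp add: analytic_semigroup_def)
next
  case False
  interpret complex_structure complexified_scale 4
    by (rule complex_structure_complexified)
  have "complex_analytic_semigroup complexified_scale (\<lambda>t. map_prod (S t) (S t))"
    using S False by (simp add: analytic_semigroup_def)
  from analytic_semigroup_derivative[OF this] obtain r M D where r: "r > 0"
    and D: "\<And>t x. t \<in> {0<..r} \<Longrightarrow>
      ((\<lambda>s. map_prod (S s) (S s) x) has_vector_derivative D t x) (at t) \<and> norm (D t x) \<le> M / t * norm x"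
    by blast
  have "((\<lambda>s. S s x) has_vector_derivative fst (D t (x, 0))) (at t) \<and> norm (fst (D t (x, 0))) \<le> M / t * norm x"
    if t: "t \<in> {0<..r}" for t x
  proof
    have "((\<lambda>s. fst (map_prod (S s) (S s) (x, 0))) has_vector_derivative fst (D t (x, 0))) (at t)"
      using D[OF t, of "(x, 0)"] by (intro bounded_linear.has_vector_derivative[OF bounded_linear_fst]) auto
    then show "((\<lambda>s. S s x) has_vector_derivative fst (D t (x, 0))) (at t)" by simp
    have "norm (fst (D t (x, 0))) \<le> norm (D t (x, 0))"
      using norm_fst_le[of "fst (D t (x, 0))" "snd (D t (x, 0))"] by simp
    also have "\<dots> \<le> M / t * norm (x, 0 :: 'a)" using D[OF t, of "(x, 0)"] by blast
    finally show "norm (fst (D t (x, 0))) \<le> M / t * norm x" by (simp add: norm_Pair)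
  qed
  then show ?thesis
    by (intro exI[of _ r] conjI r exI[of _ M] exI[of _ "\<lambda>t x. fst (D t (x, 0))"]) blast
qed

section \<open>Smoothing semigroups\<close>

text \<open>Estimates are needed at the times \<open>\<sigma> + t - s\<close> with \<open>\<sigma>, t \<le> T\<close>, hence the bound \<open>2 * T\<close>.\<close>

locale smoothing_semigroup =
  fixes S :: "real \<Rightarrow> 'a::banach \<Rightarrow> 'a" and Dom :: "'a set" and A :: "'a \<Rightarrow> 'a" and T M :: real
  assumes T_pos: "0 < T" and M_pos: "0 < M"
    and S_linear: "\<And>t. 0 \<le> t \<Longrightarrow> bounded_linear (S t)"
    and S_0 [simp]: "S 0 x = x"
    and S_add: "\<And>s t x. 0 \<le> s \<Longrightarrow> 0 \<le> t \<Longrightarrow> S (s + t) x = S s (S t x)"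
    and S_continuous: "\<And>x. continuous_on {0..} (\<lambda>t. S t x)"
    and generator: "is_generator S Dom A"
    and S_deriv: "\<And>t x. 0 < t \<Longrightarrow> ((\<lambda>s. S s x) has_vector_derivative A (S t x)) (at t)"
    and S_mem_Dom: "\<And>t x. 0 < t \<Longrightarrow> S t x \<in> Dom"
    and S_bound: "\<And>t x. 0 \<le> t \<Longrightarrow> t \<le> 2 * T \<Longrightarrow> norm (S t x) \<le> M * norm x"
    and AS_bound: "\<And>t x. 0 < t \<Longrightarrow> t \<le> 2 * T \<Longrightarrow> norm (A (S t x)) \<le> M / t * norm x"
begin

lemma Dom_iff: "x \<in> Dom \<longleftrightarrow> (\<exists>y. ((\<lambda>t. (1 / t) *\<^sub>R (S t x - x)) \<longlongrightarrow> y) (at_right 0))"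
  using generator unfolding is_generator_def by blast

lemma A_eqI:
  assumes "((\<lambda>t. (1 / t) *\<^sub>R (S t x - x)) \<longlongrightarrow> y) (at_right 0)"
  shows "x \<in> Dom" "A x = y"
proof -
  show "x \<in> Dom" using assms Dom_iff by blast
  then have "((\<lambda>t. (1 / t) *\<^sub>R (S t x - x)) \<longlongrightarrow> A x) (at_right 0)"
    using generator unfolding is_generator_def by blast
  from tendsto_unique[OF _ this assms] show "A x = y" by simp
qed

lemma A_lim: "x \<in> Dom \<Longrightarrow> ((\<lambda>t. (1 / t) *\<^sub>R (S t x - x)) \<longlongrightarrow> A x) (at_right 0)"
  using generator unfolding is_generator_def by blast

lemma eventually_ge0: "\<forall>\<^sub>F t in at_right (0::real). 0 < t"
  by (simp add: eventually_at_right_less)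

text \<open>Difference quotients at 0 pass through \<open>L\<close>. Applied to \<open>S t\<close>,
  to real multiples and to scalars from \<open>K\<close>, this gives the invariance of the domain
  and the algebraic rules for \<open>A\<close>, which is known only as a limit of such
  quotients.\<close>

lemma Dom_commute:
  assumes x: "x \<in> Dom" and L: "bounded_linear L" and comm: "\<And>t. 0 \<le> t \<Longrightarrow> S t (L x) = L (S t x)"
  shows "L x \<in> Dom" "A (L x) = L (A x)"
proof -
  have "((\<lambda>t. L ((1 / t) *\<^sub>R (S t x - x))) \<longlongrightarrow> L (A x)) (at_right 0)"
    by (rule bounded_linear.tendsto[OF L A_lim[OF x]])
  then have *: "((\<lambda>t. (1 / t) *\<^sub>R (S t (L x) - L x)) \<longlongrightarrow> L (A x)) (at_right 0)"
  proof (rule Lim_transform_eventually)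
    show "\<forall>\<^sub>F t in at_right 0. L ((1 / t) *\<^sub>R (S t x - x)) = (1 / t) *\<^sub>R (S t (L x) - L x)"
      using eventually_ge0
      by eventually_elim (simp add: comm linear_diff[OF bounded_linear.linear[OF L]] linear_scale[OF bounded_linear.linear[OF L]])
  qed
  from A_eqI[OF *] show "L x \<in> Dom" "A (L x) = L (A x)" .
qed

lemma S_Dom:
  assumes "x \<in> Dom" "0 \<le> t"
  shows "S t x \<in> Dom" "A (S t x) = S t (A x)"
proof -
  have "S s (S t x) = S t (S s x)" if "0 \<le> s" for s
    using S_add[of s t x] S_add[of t s x] that assms(2) by (simp add: add.commute)
  from Dom_commute[OF assms(1) S_linear[OF assms(2)] this]
  show "S t x \<in> Dom" "A (S t x) = S t (A x)" by auto
qed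

lemma A_scale:
  assumes "x \<in> Dom" shows "r *\<^sub>R x \<in> Dom" "A (r *\<^sub>R x) = r *\<^sub>R A x"
proof -
  have "S t (r *\<^sub>R x) = r *\<^sub>R S t x" if "0 \<le> t" for t
    by (rule linear_scale[OF bounded_linear.linear[OF S_linear[OF that]]])
  from Dom_commute[OF assms bounded_linear_scaleR_right this]
  show "r *\<^sub>R x \<in> Dom" "A (r *\<^sub>R x) = r *\<^sub>R A x" by auto
qed

lemma A_add:
  assumes "x \<in> Dom" "y \<in> Dom" shows "x + y \<in> Dom" "A (x + y) = A x + A y"
proof -
  have "((\<lambda>t. (1 / t) *\<^sub>R (S t x - x) + (1 / t) *\<^sub>R (S t y - y)) \<longlongrightarrow> A x + A y) (at_right 0)"
    by (intro tendsto_add A_lim assms)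
  then have *: "((\<lambda>t. (1 / t) *\<^sub>R (S t (x + y) - (x + y))) \<longlongrightarrow> A x + A y) (at_right 0)"
  proof (rule Lim_transform_eventually)
    show "\<forall>\<^sub>F t in at_right 0. (1 / t) *\<^sub>R (S t x - x) + (1 / t) *\<^sub>R (S t y - y) = (1 / t) *\<^sub>R (S t (x + y) - (x + y))"
      using eventually_ge0
      by eventually_elim (simp add: linear_add[OF bounded_linear.linear[OF S_linear]] algebra_simps)
  qed
  from A_eqI[OF *] show "x + y \<in> Dom" "A (x + y) = A x + A y" .
qed

lemma A_minus: "x \<in> Dom \<Longrightarrow> - x \<in> Dom" "x \<in> Dom \<Longrightarrow> A (- x) = - A x"
  using A_scale[of x "-1"] by simp_all

lemma A_diff: "x \<in> Dom \<Longrightarrow> y \<in> Dom \<Longrightarrow> x - y \<in> Dom" "x \<in> Dom \<Longrightarrow> y \<in> Dom \<Longrightarrow> A (x - y) = A x - A y"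
  using A_add[of x "-y"] A_minus[of y] by simp_all

lemmas S_add_right = linear_add[OF bounded_linear.linear[OF S_linear]]
lemmas S_diff = linear_diff[OF bounded_linear.linear[OF S_linear]]
lemmas S_scale = linear_scale[OF bounded_linear.linear[OF S_linear]]

text \<open>The bound on \<open>A (S t x)\<close> reaches up to the time \<open>2 * T\<close>;
  beyond it the bounded operator \<open>S (t - a)\<close> is split off.\<close>

lemma AS_linear:
  assumes "0 < t" shows "bounded_linear (\<lambda>x. A (S t x))"
proof -
  define a where "a = min t (2 * T)"
  have a: "0 < a" "a \<le> 2 * T" "a \<le> t" using assms T_pos by (auto simp: a_def)
  have eq: "A (S t x) = A (S a (S (t - a) x))" for x
    using S_add[of a "t - a" x] a by simp
    obtain C where C: "\<And>x. norm (S (t - a) x) \<le> norm x * C"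
      using bounded_linear.bounded[OF S_linear[of "t - a"]] a by auto
    have bd: "norm (A (S t x)) \<le> M / a * (norm x * C)" for x
    proof -
      have "norm (A (S t x)) \<le> M / a * norm (S (t - a) x)"
        unfolding eq by (rule AS_bound[OF a(1,2)])
      also have "\<dots> \<le> M / a * (norm x * C)"
        using C a M_pos by (intro mult_left_mono) auto
      finally show ?thesis .
    qed
  show ?thesis
  proof (rule bounded_linear_intro)
    show "A (S t (x + y)) = A (S t x) + A (S t y)" for x y
      using assms by (simp add: S_add_right A_add S_mem_Dom)
    show "A (S t (r *\<^sub>R x)) = r *\<^sub>R A (S t x)" for r x
      using assms by (simp add: S_scale A_scale S_mem_Dom)
    show "norm (A (S t x)) \<le> norm x * (M / a * C)" for x
      using bd[of x] by (simp add: mult_ac)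
  qed
qed

lemmas AS_add = linear_add[OF bounded_linear.linear[OF AS_linear]]
lemmas AS_diff = linear_diff[OF bounded_linear.linear[OF AS_linear]]

lemma AS_split:
  assumes "0 \<le> s" "0 < t"
  shows "A (S (s + t) x) = S s (A (S t x))"
  using S_Dom(2)[OF S_mem_Dom[OF assms(2)] assms(1)] S_add[of s t x] assms by simp

text \<open>The uniform bound \<open>M\<close> on \<open>S\<close> up to time \<open>2 * T\<close>
  turns strong continuity into joint continuity.\<close>

lemma S_continuous_pair:
  fixes p :: "'b::metric_space \<Rightarrow> real"
  assumes p: "continuous_on I p" "\<And>s. s \<in> I \<Longrightarrow> 0 \<le> p s" "\<And>s. s \<in> I \<Longrightarrow> p s \<le> 2 * T"
    and g: "continuous_on I g"
  shows "continuous_on I (\<lambda>s. S (p s) (g s))"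
  unfolding continuous_on_def
proof
  fix s0 assume s0: "s0 \<in> I"
  have "((\<lambda>s. g s - g s0) \<longlongrightarrow> 0) (at s0 within I)"
    using g s0 by (simp add: continuous_on_def LIM_zero_iff)
  then have "((\<lambda>s. M * norm (g s - g s0)) \<longlongrightarrow> 0) (at s0 within I)"
    by (intro tendsto_mult_right_zero tendsto_norm_zero)
  moreover have "continuous_on I (\<lambda>s. S (p s) (g s0))"
    by (rule continuous_on_compose2[OF S_continuous[of "g s0"] p(1)]) (use p(2) in auto)
  then have "((\<lambda>s. S (p s) (g s0)) \<longlongrightarrow> S (p s0) (g s0)) (at s0 within I)"
    using s0 by (simp add: continuous_on_def)
  moreover have "\<forall>\<^sub>F s in at s0 within I. norm (S (p s) (g s) - S (p s) (g s0)) \<le> M * norm (g s - g s0)"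
    unfolding eventually_at_topological
    by (rule exI[of _ UNIV]) (use S_bound p(2,3) in \<open>auto simp flip: S_diff\<close>)
  ultimately have "((\<lambda>s. (S (p s) (g s) - S (p s) (g s0)) + S (p s) (g s0)) \<longlongrightarrow> 0 + S (p s0) (g s0)) (at s0 within I)"
    by (intro tendsto_add) (rule Lim_null_comparison)
  then show "((\<lambda>s. S (p s) (g s)) \<longlongrightarrow> S (p s0) (g s0)) (at s0 within I)" by simp
qed

lemma AS_continuous: "continuous_on {0<..} (\<lambda>t. A (S t x))"
proof (rule continuous_at_imp_continuous_on, rule ballI)
  fix t :: real assume "t \<in> {0<..}"
  then have t: "t > 0" by simp
  have "continuous_on {t/2<..} (\<lambda>s. S (s - t / 2) (A (S (t / 2) x)))"
    by (rule continuous_on_compose2[OF S_continuous]) (auto intro!: continuous_intros)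
  then have "continuous_on {t/2<..} (\<lambda>s. A (S s x))"
  proof (rule continuous_on_eq)
    show "S (s - t / 2) (A (S (t / 2) x)) = A (S s x)" if "s \<in> {t / 2<..}" for s
      using AS_split[of "s - t / 2" "t / 2" x] t that by simp
  qed
  then show "isCont (\<lambda>s. A (S s x)) t"
    using t by (simp add: continuous_on_eq_continuous_at)
qed

text \<open>A mean value inequality with majorant. Since \<open>\<phi>\<close> is differentiated in
  the open interval and merely continuous at the ends, an integrable singularity of
  \<open>A (S \<sigma> x)\<close> at \<open>a = 0\<close> is allowed.\<close>

lemma norm_S_diff_le:
  assumes "0 \<le> a" "a < b" "continuous_on {a..b} \<phi>"
    and "\<And>\<sigma>. a < \<sigma> \<Longrightarrow> \<sigma> < b \<Longrightarrow> (\<phi> has_real_derivative \<phi>' \<sigma>) (at \<sigma>)"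
    and "\<And>\<sigma>. a < \<sigma> \<Longrightarrow> \<sigma> < b \<Longrightarrow> norm (A (S \<sigma> x)) \<le> \<phi>' \<sigma>"
  shows "norm (S b x - S a x) \<le> \<phi> b - \<phi> a"
proof (rule differentiable_bound_general[where \<phi>' = \<phi>'])
  show "continuous_on {a..b} (\<lambda>s. S s x)"
    by (rule continuous_on_subset[OF S_continuous]) (use assms in auto)
  show "((\<lambda>s. S s x) has_vector_derivative A (S \<sigma> x)) (at \<sigma>)" if "a < \<sigma>" "\<sigma> < b" for \<sigma>
    using S_deriv[of \<sigma> x] that assms by simp
  show "(\<phi> has_vector_derivative \<phi>' \<sigma>) (at \<sigma>)" if "a < \<sigma>" "\<sigma> < b" for \<sigma>
    using assms(4)[OF that] by (simp add: has_real_derivative_iff_has_vector_derivative)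
qed (use assms in auto)

lemma S_integral_Dom:
  assumes x: "x \<in> Dom" and t: "0 \<le> t"
  shows "((\<lambda>s. S s (A x)) has_integral (S t x - x)) {0..t}"
proof -
  have "((\<lambda>s. S s (A x)) has_integral (S t x - S 0 x)) {0..t}"
  proof (rule fundamental_theorem_of_calculus_interior[OF t])
    show "continuous_on {0..t} (\<lambda>s. S s x)" by (rule continuous_on_subset[OF S_continuous]) auto
    show "((\<lambda>s. S s x) has_vector_derivative S s (A x)) (at s)" if "s \<in> {0<..<t}" for s
      using S_deriv[of s x] S_Dom(2)[OF x, of s] that by simp
  qed
  then show ?thesis by simp
qed

text \<open>The identity \<open>S t x - x = integral {0..t} (\<lambda>s. S s (A x))\<close> survives
  the limit, because it contains \<open>A x\<close> only under bounded operators. Division by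
  \<open>t\<close> then recovers the generator at the limit point.\<close>

lemma A_closed:
  assumes x: "\<And>n. x n \<in> Dom" and lim: "x \<longlonglongrightarrow> y" and limA: "(\<lambda>n. A (x n)) \<longlonglongrightarrow> z"
  shows "y \<in> Dom" "A y = z"
proof -
  have int: "(\<lambda>s. S s w) integrable_on {0..t}" for w t
    by (intro integrable_continuous_real continuous_on_subset[OF S_continuous]) auto
  have eq: "S t y - y = integral {0..t} (\<lambda>s. S s z)" if t: "0 \<le> t" "t \<le> 2 * T" for t
  proof (rule LIMSEQ_unique)
    show "(\<lambda>n. S t (x n) - x n) \<longlonglongrightarrow> S t y - y"
      by (intro tendsto_diff bounded_linear.tendsto[OF S_linear] t lim)
    have lim0: "((\<lambda>n. M * norm (A (x n) - z) * t) \<longlongrightarrow> 0) sequentially"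
      using limA by (intro tendsto_mult_left_zero tendsto_mult_right_zero tendsto_norm_zero) (simp add: LIM_zero_iff)
    have bd: "norm (S t (x n) - x n - integral {0..t} (\<lambda>s. S s z)) \<le> M * norm (A (x n) - z) * t" for n
    proof -
      have "S t (x n) - x n - integral {0..t} (\<lambda>s. S s z) = integral {0..t} (\<lambda>s. S s (A (x n)) - S s z)"
        using integral_unique[OF S_integral_Dom[OF x t(1)]] by (simp add: integral_diff int)
      also have "norm \<dots> \<le> M * norm (A (x n) - z) * (t - 0)"
        using t S_bound
        by (intro integral_bound continuous_intros continuous_on_subset[OF S_continuous]) (auto simp flip: S_diff)
      finally show ?thesis by simp
    qed
    have "(\<lambda>n. S t (x n) - x n - integral {0..t} (\<lambda>s. S s z)) \<longlonglongrightarrow> 0"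
      by (rule Lim_null_comparison[OF always_eventually[OF allI[OF bd]] lim0])
    then show "(\<lambda>n. S t (x n) - x n) \<longlonglongrightarrow> integral {0..t} (\<lambda>s. S s z)"
      by (rule LIM_zero_cancel)
  qed
  have "((\<lambda>t. integral {0..t} (\<lambda>s. S s z)) has_vector_derivative S 0 z) (at 0 within {0..2 * T})"
    by (rule integral_has_vector_derivative) (use T_pos in \<open>auto intro: continuous_on_subset[OF S_continuous]\<close>)
  then have "((\<lambda>t. integral {0..t} (\<lambda>s. S s z)) has_vector_derivative z) (at 0 within {0<..<2 * T})"
    by (auto intro: has_vector_derivative_within_subset)
  then have "((\<lambda>t. (1 / \<bar>t\<bar>) *\<^sub>R (integral {0..t} (\<lambda>s. S s z) - t *\<^sub>R z)) \<longlongrightarrow> 0) (at 0 within {0<..<2 * T})"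
    unfolding has_vector_derivative_def has_derivative_within by simp
  then have "((\<lambda>t. (1 / t) *\<^sub>R (S t y - y) - z) \<longlongrightarrow> 0) (at 0 within {0<..<2 * T})"
    by (rule Lim_transform_eventually) (auto simp: eventually_at scaleR_diff_right eq[symmetric] intro!: exI[of _ 1])
  then have "((\<lambda>t. (1 / t) *\<^sub>R (S t y - y)) \<longlongrightarrow> z) (at 0 within {0<..<2 * T})"
    by (rule LIM_zero_cancel)
  moreover have "at 0 within {0<..<2 * T} = at_right 0"
    using T_pos by (intro at_within_nhd[of _ "{..<2 * T}"]) auto
  ultimately have "((\<lambda>t. (1 / t) *\<^sub>R (S t y - y)) \<longlongrightarrow> z) (at_right 0)" by simp
  from A_eqI[OF this] show "y \<in> Dom" "A y = z" .
qed

end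

text \<open>Analyticity controls the derivative only for times up to some \<open>r\<close>. For
  later times the semigroup law gives it as \<open>D r (S (t - r) x)\<close>, and boundedness of
  \<open>S\<close> on \<open>{0..2 * T}\<close> restores a bound of order
  \<open>1 / t\<close>.\<close>

lemma analytic_semigroup_imp_smoothing:
  assumes K: "K = \<real> \<or> K = UNIV" and scl: "scalar_action K scl" and S: "analytic_semigroup K scl S"
    and gen: "is_generator S Dom A" and T: "0 < T"
  shows "\<exists>M. smoothing_semigroup S Dom A T M"
proof -
  have "C0_semigroup K scl S"
    using S unfolding analytic_semigroup_def by (rule conjunct1)
  note C0 = this[unfolded C0_semigroup_def]
  have lin: "bounded_linear (S t)" if "0 \<le> t" for t
    using conjunct1[OF C0] that by blast
  have S0: "S 0 x = x" for x
    using C0 by (metis id_apply)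
  have Sadd: "S (s + t) x = S s (S t x)" if "0 \<le> s" "0 \<le> t" for s t x
    using conjunct1[OF conjunct2[OF conjunct2[OF C0]]] that by simp
  have cont: "continuous_on {0..} (\<lambda>t. S t x)" for x
    using conjunct2[OF conjunct2[OF conjunct2[OF C0]]] by (rule spec)
  obtain r M1 D where r: "r > 0" and D: "\<And>t x. t \<in> {0<..r} \<Longrightarrow>
      ((\<lambda>s. S s x) has_vector_derivative D t x) (at t) \<and> norm (D t x) \<le> M1 / t * norm x"
    using analytic_semigroup_derivative[OF K scl S] by blast
  \<comment> \<open>The family is extended by zero operators, since the index of the uniform
    boundedness principle runs over all reals.\<close>
  have "\<exists>B. \<forall>i x. norm ((if 0 \<le> i \<and> i \<le> 2 * T then S i else (\<lambda>_. 0)) x) \<le> B * norm x"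
  proof (rule uniform_boundedness)
    show "bounded_linear (if 0 \<le> i \<and> i \<le> 2 * T then S i else (\<lambda>_. 0))" for i :: real
      using lin by (auto intro: bounded_linear_zero)
    fix x
    have "bounded ((\<lambda>t. S t x) ` {0..2 * T})"
      by (intro compact_imp_bounded compact_continuous_image continuous_on_subset[OF cont]) auto
    then obtain B where "\<forall>t\<in>{0..2 * T}. norm (S t x) \<le> B" by (auto simp: bounded_iff)
    then have "norm ((if 0 \<le> i \<and> i \<le> 2 * T then S i else (\<lambda>_. 0)) x) \<le> max B 0" for i
      by (auto simp: le_max_iff_disj)
    then show "\<exists>B. \<forall>i. norm ((if 0 \<le> i \<and> i \<le> 2 * T then S i else (\<lambda>_. 0)) x) \<le> B" by blast
  qed
  then obtain B where *: "\<forall>i x. norm ((if 0 \<le> i \<and> i \<le> 2 * T then S i else (\<lambda>_. 0)) x) \<le> B * norm x" by blast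
  then have B: "norm (S t x) \<le> B * norm x" if "0 \<le> t" "t \<le> 2 * T" for t x
    using * [rule_format, of t x] that by simp
  define D' where "D' t x = (if t \<le> r then D t x else D r (S (t - r) x))" for t x
  have deriv: "((\<lambda>s. S s x) has_vector_derivative D' t x) (at t)" if t: "0 < t" for t x
  proof (cases "t \<le> r")
    case True
    then show ?thesis using D[of t x] t by (simp add: D'_def)
  next
    case False
    have "((\<lambda>s. s - (t - r)) has_vector_derivative 1) (at t)"
      by (auto intro!: derivative_eq_intros)
    then have "((\<lambda>s. S s (S (t - r) x)) \<circ> (\<lambda>s. s - (t - r)) has_vector_derivative 1 *\<^sub>R D r (S (t - r) x)) (at t)"
      using D[of r "S (t - r) x"] r by (intro vector_diff_chain_at) auto
    from has_vector_derivative_transform_within_open[OF this, of "{t - r<..}" "\<lambda>s. S s x"]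
    have "((\<lambda>s. S s x) has_vector_derivative 1 *\<^sub>R D r (S (t - r) x)) (at t)"
      using r False Sadd[of _ "t - r" x] by (auto simp flip: Sadd)
    then show ?thesis using False by (simp add: D'_def)
  qed
  \<comment> \<open>For \<open>t \<le> r\<close> the bound \<open>M1 / t\<close> persists. For
    \<open>r < t \<le> 2 * T\<close> the constant bound
    \<open>\<bar>M1\<bar> * \<bar>B\<bar> / r\<close> is at most the second summand divided by
    \<open>t\<close>.\<close>
  define M2 where "M2 = \<bar>M1\<bar> + \<bar>M1\<bar> * \<bar>B\<bar> * (2 * T) / r"
  have bound: "norm (D' t x) \<le> M2 / t * norm x" if t: "0 < t" "t \<le> 2 * T" for t x
  proof (cases "t \<le> r")
    case True
    have "norm (D' t x) \<le> M1 / t * norm x"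
      using D[of t x] t True by (simp add: D'_def)
    also have "\<dots> \<le> M2 / t * norm x"
    proof (intro mult_right_mono divide_right_mono)
      have "0 \<le> \<bar>M1\<bar> * \<bar>B\<bar> * (2 * T) / r" using r T by simp
      then show "M1 \<le> M2" unfolding M2_def using abs_ge_self[of M1] by linarith
    qed (use t in auto)
    finally show ?thesis .
  next
    case False
    have "norm (D' t x) \<le> M1 / r * norm (S (t - r) x)"
      using D[of r "S (t - r) x"] r False by (simp add: D'_def)
    also have "\<dots> \<le> \<bar>M1\<bar> / r * (\<bar>B\<bar> * norm x)"
    proof (rule mult_mono)
      show "norm (S (t - r) x) \<le> \<bar>B\<bar> * norm x"
        using B[of "t - r" x] False t r by (smt (verit) abs_ge_self mult_right_mono norm_ge_zero)
    qed (use r in \<open>auto intro: divide_right_mono\<close>)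
    also have "\<dots> = (\<bar>M1\<bar> * \<bar>B\<bar> / r * t) / t * norm x"
      using t by simp
    also have "\<dots> \<le> M2 / t * norm x"
    proof (intro mult_right_mono divide_right_mono)
      have "\<bar>M1\<bar> * \<bar>B\<bar> / r * t \<le> \<bar>M1\<bar> * \<bar>B\<bar> / r * (2 * T)"
        using t r by (intro mult_left_mono) auto
      then show "\<bar>M1\<bar> * \<bar>B\<bar> / r * t \<le> M2" by (simp add: M2_def)
    qed (use t in auto)
    finally show ?thesis .
  qed
  have A: "S t x \<in> Dom" "A (S t x) = D' t x" if t: "0 < t" for t x
  proof -
    have "((\<lambda>s. S s x) has_vector_derivative D' t x) (at t within {t<..})"
      using deriv[OF t] by (rule has_vector_derivative_at_within)
    then have "((\<lambda>s. (1 / \<bar>s - t\<bar>) *\<^sub>R (S s x - (S t x + (s - t) *\<^sub>R D' t x))) \<longlongrightarrow> 0) (at_right t)"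
      unfolding has_vector_derivative_def has_derivative_within by simp
    then have "((\<lambda>h. (1 / \<bar>h\<bar>) *\<^sub>R (S (h + t) x - (S t x + h *\<^sub>R D' t x))) \<longlongrightarrow> 0) (at_right 0)"
      by (subst (asm) filterlim_at_right_to_0) simp
    then have "((\<lambda>h. (1 / h) *\<^sub>R (S h (S t x) - S t x) - D' t x) \<longlongrightarrow> 0) (at_right 0)"
    proof (rule Lim_transform_eventually)
      show "\<forall>\<^sub>F h in at_right 0. (1 / \<bar>h\<bar>) *\<^sub>R (S (h + t) x - (S t x + h *\<^sub>R D' t x)) =
          (1 / h) *\<^sub>R (S h (S t x) - S t x) - D' t x"
        using eventually_at_right_less[of "0::real"]
        by eventually_elim (use t in \<open>simp add: Sadd scaleR_diff_right diff_diff_add[symmetric]\<close>)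
    qed
    then have lim: "((\<lambda>h. (1 / h) *\<^sub>R (S h (S t x) - S t x)) \<longlongrightarrow> D' t x) (at_right 0)"
      by (rule LIM_zero_cancel)
    then show "S t x \<in> Dom"
      using gen unfolding is_generator_def by blast
    then have "((\<lambda>h. (1 / h) *\<^sub>R (S h (S t x) - S t x)) \<longlongrightarrow> A (S t x)) (at_right 0)"
      using gen unfolding is_generator_def by blast
    from tendsto_unique[OF _ this lim] show "A (S t x) = D' t x" by simp
  qed
  define M where "M = \<bar>B\<bar> + \<bar>M2\<bar> + 1"
  have "smoothing_semigroup S Dom A T M"
  proof (rule smoothing_semigroup.intro)
    show "norm (S t x) \<le> M * norm x" if "0 \<le> t" "t \<le> 2 * T" for t x
    proof -
      have "B * norm x \<le> M * norm x" by (intro mult_right_mono) (auto simp: M_def)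
      then show ?thesis using B[OF that] order_trans by blast
    qed
    show "norm (A (S t x)) \<le> M / t * norm x" if "0 < t" "t \<le> 2 * T" for t x
    proof -
      have "M2 / t * norm x \<le> M / t * norm x"
        using that by (intro mult_right_mono divide_right_mono) (auto simp: M_def)
      then show ?thesis using bound[OF that, of x] A(2)[OF that(1)] by simp
    qed
    show "0 < M" by (simp add: M_def add_nonneg_pos)
    show "((\<lambda>s. S s x) has_vector_derivative A (S t x)) (at t)" if "0 < t" for t x
      using deriv[OF that] A(2)[OF that] by simp
  qed (use T lin S0 Sadd cont gen A(1) in auto)
  then show ?thesis ..
qed

section \<open>Interpolation spaces\<close>

lemma banach_space_imp_subspace:
  assumes K: "K = \<real> \<or> K = UNIV" and scl: "scalar_action K scl" and X: "banach_space K scl X"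
    and emb: "embedded X whole_space"
  shows "banach_subspace X"
proof
  have K': "complex_of_real r \<in> K" for r using K by auto
  have scl': "scl (of_real r) x = r *\<^sub>R x" for r x using scl by (simp add: scalar_action_def)
  show "r *\<^sub>R x \<in> carr X" "nrm X (r *\<^sub>R x) = \<bar>r\<bar> * nrm X x" if "x \<in> carr X" for r x
    using X that K'[of r] unfolding banach_space_def by (metis scl', metis scl' norm_of_real)
  show "\<exists>c. \<forall>x\<in>carr X. norm x \<le> c * nrm X x"
    using emb by (simp add: embedded_def whole_space_def)
qed (use X in \<open>auto simp: banach_space_def\<close>)

lemma carr_whole_space [simp]: "carr whole_space = UNIV"
  and nrm_whole_space [simp]: "nrm whole_space = norm"
  by (simp_all add: whole_space_def)

lemma ntop_whole_space [simp]: "ntop whole_space = euclidean"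
  unfolding ntop_def carr_whole_space
  by (metis (no_types, lifting) UNIV_I dist_norm ext mtopology_is_euclidean ndist_def carr_whole_space nrm_whole_space)

lemma banach_space_whole:
  assumes "scalar_action K scl"
  shows "banach_space K scl whole_space"
proof -
  have "ndist whole_space = (dist :: 'a \<Rightarrow> 'a \<Rightarrow> real)"
    by (intro ext) (simp add: ndist_def dist_norm)
  then have "Metric_space.mcomplete (carr whole_space) (ndist (whole_space :: 'a nspace))"
    by (simp add: complete_UNIV)
  then show ?thesis
    using assms by (auto simp: banach_space_def scalar_action_def norm_triangle_ineq)
qed

lemma continuous_scalar_action:
  assumes K: "K = \<real> \<or> K = UNIV" and scl: "scalar_action K scl"
  shows "continuous_map (prod_topology (top_of_set K) euclidean) euclidean (\<lambda>(k, x). scl k x)"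
proof -
  have cont: "continuous_on (K \<times> UNIV) (\<lambda>(k, x). scl k x)"
    using K
  proof
    assume "K = \<real>"
    moreover have "scl k x = Re k *\<^sub>R x" if "k \<in> \<real>" for k x
      using scl that by (metis of_real_Re scalar_action_def)
    ultimately show ?thesis
      unfolding case_prod_beta
      by (subst continuous_on_cong[OF refl, where g = "\<lambda>p. Re (fst p) *\<^sub>R snd p"]) (auto intro!: continuous_intros)
  next
    assume "K = UNIV"
    then interpret complex_structure scl 1
      using scl by unfold_locales (auto simp: scalar_action_def)
    show ?thesis
      unfolding case_prod_beta by (intro continuous_on continuous_intros)
  qed
  have "prod_topology (top_of_set K) (top_of_set (UNIV :: 'a set)) = top_of_set (K \<times> UNIV)"
    using subtopology_Times[of euclidean euclidean K "UNIV :: 'a set"]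
    by (simp add: euclidean_product_topology)
  then show ?thesis
    using cont by simp
qed

text \<open>The ambient space with its norm topology is the common Hausdorff vector space.\<close>

lemma couple_of_embedded:
  assumes K: "K = \<real> \<or> K = UNIV" and scl: "scalar_action K scl"
    and X0: "banach_space K scl X0" "banach_subspace X0" and X1: "banach_space K scl X1" "banach_subspace X1"
  shows "couple K scl X0 X1"
  unfolding couple_def
proof (intro conjI X0 X1 exI[of _ euclidean])
  have "continuous_on UNIV (\<lambda>(x, y). x + y :: 'a)"
    unfolding case_prod_beta by (intro continuous_intros)
  then show "continuous_map (prod_topology euclidean euclidean) euclidean (\<lambda>(x, y). x + y :: 'a)"
    by (simp add: euclidean_product_topology)
qed (use continuous_scalar_action[OF K scl] banach_subspace.continuous_map_id_ntop X0 X1 in \<open>auto simp: Hausdorff_space_euclidean\<close>)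

lemma nrm_le_opnorm:
  assumes L: "bounded_between X Y L" and X: "\<And>x. x \<in> carr X \<Longrightarrow> 0 \<le> nrm X x" and x: "x \<in> carr X"
  shows "nrm Y (L x) \<le> opnorm X Y L * nrm X x" "0 \<le> opnorm X Y L"
proof -
  define C where "C = {c. 0 \<le> c \<and> (\<forall>x\<in>carr X. nrm Y (L x) \<le> c * nrm X x)}"
  obtain c where "\<forall>x\<in>carr X. nrm Y (L x) \<le> c * nrm X x"
    using L by (auto simp: bounded_between_def)
  then have "\<forall>x\<in>carr X. nrm Y (L x) \<le> max c 0 * nrm X x"
    using X by (meson max.cobounded1 mult_right_mono order_trans)
  then have ne: "C \<noteq> {}" by (auto simp: C_def intro!: exI[of _ "max c 0"])
  have bd: "bdd_below C" by (auto simp: C_def intro!: bdd_belowI[of _ 0])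
  show "0 \<le> opnorm X Y L"
    unfolding opnorm_def C_def[symmetric] using ne by (intro cInf_greatest) (auto simp: C_def)
  show "nrm Y (L x) \<le> opnorm X Y L * nrm X x"
  proof (cases "nrm X x = 0")
    case True
    then show ?thesis using ne x by (auto simp: C_def)
  next
    case False
    then have pos: "nrm X x > 0" using X x by (simp add: order_less_le)
    have "nrm Y (L x) / nrm X x \<le> opnorm X Y L"
      unfolding opnorm_def C_def[symmetric] using ne x pos
      by (intro cInf_greatest) (auto simp: C_def divide_le_eq)
    then show ?thesis using pos by (simp add: divide_le_eq)
  qed
qed

lemma opnorm_le:
  assumes "0 \<le> c" "\<And>x. x \<in> carr X \<Longrightarrow> nrm Y (L x) \<le> c * nrm X x"
  shows "opnorm X Y L \<le> c"
  unfolding opnorm_def by (rule cInf_lower) (use assms in \<open>auto intro!: bdd_belowI[of _ 0]\<close>)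

text \<open>Operator norms are replaced by arbitrary upper bounds \<open>m0\<close> and
  \<open>m1\<close>, which is possible because the powers are monotone. The functor's constant has
  no prescribed sign, hence \<open>\<bar>c\<bar> + 1\<close>.\<close>

lemma interpolation_bound:
  assumes F: "interpolation_functor K scl \<theta> F" and \<theta>: "0 < \<theta>" "\<theta> < 1"
    and X: "couple K scl X0 X1" and Y: "couple K scl Y0 Y1"
  obtains c where "0 < c"
    "\<And>L m0 m1 x. linear_from K scl UNIV L \<Longrightarrow> 0 \<le> m0 \<Longrightarrow> 0 \<le> m1 \<Longrightarrow>
      (\<And>x. x \<in> carr X0 \<Longrightarrow> L x \<in> carr Y0 \<and> nrm Y0 (L x) \<le> m0 * nrm X0 x) \<Longrightarrow>
      (\<And>x. x \<in> carr X1 \<Longrightarrow> L x \<in> carr Y1 \<and> nrm Y1 (L x) \<le> m1 * nrm X1 x) \<Longrightarrow>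
      x \<in> carr (F X0 X1) \<Longrightarrow>
      L x \<in> carr (F Y0 Y1) \<and> nrm (F Y0 Y1) (L x) \<le> c * m0 powr (1 - \<theta>) * m1 powr \<theta> * nrm (F X0 X1) x"
proof -
  obtain c where c: "\<forall>L. couple_morphism K scl X0 X1 Y0 Y1 L \<longrightarrow>
           bounded_between (F X0 X1) (F Y0 Y1) L \<and>
           opnorm (F X0 X1) (F Y0 Y1) L \<le> c * opnorm X0 Y0 L powr (1 - \<theta>) * opnorm X1 Y1 L powr \<theta>"
    using F X Y unfolding interpolation_functor_def by meson
  have bF: "banach_space K scl (F X0 X1)" using F X unfolding interpolation_functor_def by meson
  have bX: "banach_space K scl X0" "banach_space K scl X1" using X by (auto simp: couple_def)
  have zero: "0 \<in> carr X0" "0 \<in> carr X1" using bX by (auto simp: banach_space_def)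
  have "L x \<in> carr (F Y0 Y1) \<and> nrm (F Y0 Y1) (L x) \<le> (\<bar>c\<bar> + 1) * m0 powr (1 - \<theta>) * m1 powr \<theta> * nrm (F X0 X1) x"
    if lin: "linear_from K scl UNIV L" and m: "0 \<le> m0" "0 \<le> m1"
      and L0: "\<And>x. x \<in> carr X0 \<Longrightarrow> L x \<in> carr Y0 \<and> nrm Y0 (L x) \<le> m0 * nrm X0 x"
      and L1: "\<And>x. x \<in> carr X1 \<Longrightarrow> L x \<in> carr Y1 \<and> nrm Y1 (L x) \<le> m1 * nrm X1 x"
      and x: "x \<in> carr (F X0 X1)" for L m0 m1 x
  proof -
    have bb: "bounded_between X0 Y0 L" "bounded_between X1 Y1 L"
      using L0 L1 by (auto simp: bounded_between_def)
    have "couple_morphism K scl X0 X1 Y0 Y1 L"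
      using lin bb by (auto simp: couple_morphism_def linear_from_def)
    then have bF': "bounded_between (F X0 X1) (F Y0 Y1) L"
      and op: "opnorm (F X0 X1) (F Y0 Y1) L \<le> c * opnorm X0 Y0 L powr (1 - \<theta>) * opnorm X1 Y1 L powr \<theta>"
      using c by auto
    have pos0: "0 \<le> opnorm X0 Y0 L" using nrm_le_opnorm(2)[OF bb(1) _ zero(1)] bX by (auto simp: banach_space_def)
    have pos1: "0 \<le> opnorm X1 Y1 L" using nrm_le_opnorm(2)[OF bb(2) _ zero(2)] bX by (auto simp: banach_space_def)
    note op
    also have "c * opnorm X0 Y0 L powr (1 - \<theta>) * opnorm X1 Y1 L powr \<theta>
        \<le> (\<bar>c\<bar> + 1) * m0 powr (1 - \<theta>) * m1 powr \<theta>"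
      using \<theta> pos0 pos1 opnorm_le[OF m(1), of X0 Y0 L] opnorm_le[OF m(2), of X1 Y1 L] L0 L1
      by (intro mult_mono powr_mono2) auto
    finally have "opnorm (F X0 X1) (F Y0 Y1) L \<le> (\<bar>c\<bar> + 1) * m0 powr (1 - \<theta>) * m1 powr \<theta>" .
    moreover have nn: "0 \<le> nrm (F X0 X1) x" if "x \<in> carr (F X0 X1)" for x
      using bF that by (auto simp: banach_space_def)
    ultimately have "opnorm (F X0 X1) (F Y0 Y1) L * nrm (F X0 X1) x
        \<le> (\<bar>c\<bar> + 1) * m0 powr (1 - \<theta>) * m1 powr \<theta> * nrm (F X0 X1) x"
      using x by (intro mult_right_mono) auto
    with nrm_le_opnorm(1)[OF bF' nn x] bF' x show ?thesis
      by (auto simp: bounded_between_def)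
  qed
  then show ?thesis
    by (intro that[of "\<bar>c\<bar> + 1"]) (auto simp: add_nonneg_pos)
qed

text \<open>All that the later arguments use about an interpolation space of index
  \<open>\<alpha>\<close>. The functor no longer occurs, so that \<open>E_0\<close> and the spaces
  with \<open>0 < \<alpha> < 1\<close> are treated alike.\<close>

locale smoothing_space = smoothing_semigroup S Dom A T M + banach_subspace X
  for S :: "real \<Rightarrow> 'a::banach \<Rightarrow> 'a" and Dom A T M and X :: "'a nspace" +
  fixes \<alpha> c :: real
  assumes \<alpha>_ge0: "0 \<le> \<alpha>" and \<alpha>_less1: "\<alpha> < 1" and c_pos: "0 < c"
    and S_mem: "\<And>t x. 0 < t \<Longrightarrow> t \<le> 2 * T \<Longrightarrow> S t x \<in> carr X"
    and S_smooth: "\<And>t x. 0 < t \<Longrightarrow> t \<le> 2 * T \<Longrightarrow> nrm X (S t x) \<le> c * t powr - \<alpha> * norm x"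
    and AS_smooth: "\<And>t x. 0 < t \<Longrightarrow> t \<le> 2 * T \<Longrightarrow> x \<in> carr X \<Longrightarrow>
      norm (A (S t x)) \<le> c * t powr (\<alpha> - 1) * nrm X x"
    and S_nrm: "\<And>t x. 0 \<le> t \<Longrightarrow> t \<le> 2 * T \<Longrightarrow> x \<in> carr X \<Longrightarrow> S t x \<in> carr X \<and> nrm X (S t x) \<le> c * nrm X x"
    and Dom_mem: "\<And>x. x \<in> Dom \<Longrightarrow> x \<in> carr X"
    and nrm_le_graph: "\<And>x. x \<in> Dom \<Longrightarrow> nrm X x \<le> c * (norm x + norm (A x))"
    and Dom_dense: "\<And>x e. x \<in> carr X \<Longrightarrow> 0 < e \<Longrightarrow> \<exists>y\<in>Dom. nrm X (x - y) < e"

section \<open>Smoothing estimates in the interpolation scale\<close>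

context smoothing_semigroup
begin

text \<open>Completeness of the graph norm amounts to closedness of \<open>A\<close>.\<close>

lemma banach_subspace_graph: "banach_subspace \<lparr>carr = Dom, nrm = \<lambda>x. norm x + norm (A x)\<rparr>" (is "banach_subspace ?G")
proof -
  have "0 \<in> Dom" "A 0 = 0"
    using A_scale[OF S_mem_Dom[of 1 0], of 0] by auto
  interpret G: normed_subspace ?G
  proof
    show "nrm ?G (x + y) \<le> nrm ?G x + nrm ?G y" if "x \<in> carr ?G" "y \<in> carr ?G" for x y
      using that norm_triangle_ineq[of x y] norm_triangle_ineq[of "A x" "A y"] by (simp add: A_add)
    show "nrm ?G x = 0 \<longleftrightarrow> x = 0" if "x \<in> carr ?G" for x
      using \<open>A 0 = 0\<close> by (auto simp: add_nonneg_eq_0_iff)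
  qed (use \<open>0 \<in> Dom\<close> A_add A_scale in \<open>auto simp: algebra_simps\<close>)
  show ?thesis
  proof (rule G.banach_subspaceI[of 1])
    fix s :: "nat \<Rightarrow> 'a" assume s: "\<And>n. s n \<in> carr ?G"
      and C: "\<And>e. e > 0 \<Longrightarrow> \<exists>N. \<forall>m\<ge>N. \<forall>n\<ge>N. nrm ?G (s m - s n) < e"
    have sD: "s n \<in> Dom" for n using s by simp
    have le: "dist (s m) (s n) \<le> nrm ?G (s m - s n)" "dist (A (s m)) (A (s n)) \<le> nrm ?G (s m - s n)" for m n
      using sD by (simp_all add: dist_norm A_diff)
    have "Cauchy s" "Cauchy (\<lambda>n. A (s n))"
      unfolding Cauchy_def using C le by (meson le_less_trans)+
    then obtain l l' where l: "s \<longlonglongrightarrow> l" "(\<lambda>n. A (s n)) \<longlonglongrightarrow> l'"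
      using Cauchy_convergent convergent_def by metis
    note cl = A_closed[OF sD l]
    have "(\<lambda>n. norm (s n - l) + norm (A (s n) - l')) \<longlonglongrightarrow> 0 + 0"
      using l by (intro tendsto_add tendsto_norm_zero) (auto simp: LIM_zero_iff)
    then show "\<exists>l\<in>carr ?G. (\<lambda>n. nrm ?G (s n - l)) \<longlonglongrightarrow> 0"
      using cl sD by (intro bexI[of _ l]) (auto simp: A_diff)
  qed auto
qed

text \<open>The hypotheses identify \<open>E\<close> with the domain of \<open>A\<close> only as a
  set. Both norms are complete and finer than the ambient one, so that the comparison of norms, used
  in both directions, makes them equivalent.\<close>

lemma nrm_graph_equiv:
  assumes "banach_subspace E" "carr E = Dom"
  obtains c where "0 < c" "\<And>x. x \<in> Dom \<Longrightarrow> nrm E x \<le> c * (norm x + norm (A x))"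
    "\<And>x. x \<in> Dom \<Longrightarrow> norm x + norm (A x) \<le> c * nrm E x"
proof -
  let ?G = "\<lparr>carr = Dom, nrm = \<lambda>x. norm x + norm (A x)\<rparr>"
  interpret E: banach_subspace E by fact
  obtain c1 where c1: "\<And>x. x \<in> Dom \<Longrightarrow> nrm E x \<le> c1 * (norm x + norm (A x))"
    using nrm_comparison[OF banach_subspace_graph assms(1)] assms(2) by auto
  obtain c2 where c2: "\<And>x. x \<in> Dom \<Longrightarrow> norm x + norm (A x) \<le> c2 * nrm E x"
    using nrm_comparison[OF assms(1) banach_subspace_graph] assms(2) by auto
  show ?thesis
  proof (rule that[of "\<bar>c1\<bar> + \<bar>c2\<bar> + 1"])
    show "nrm E x \<le> (\<bar>c1\<bar> + \<bar>c2\<bar> + 1) * (norm x + norm (A x))" if "x \<in> Dom" for x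
      by (rule order_trans[OF c1[OF that]]) (auto intro!: mult_right_mono)
    show "norm x + norm (A x) \<le> (\<bar>c1\<bar> + \<bar>c2\<bar> + 1) * nrm E x" if "x \<in> Dom" for x
      by (rule order_trans[OF c2[OF that]]) (use that E.nrm_ge0 assms(2) in \<open>auto intro!: mult_right_mono\<close>)
  qed simp
qed

text \<open>Three interpolations: \<open>S t\<close> from \<open>E_0\<close> to \<open>E_0\<close>
  and to \<open>E\<close> costs 1 and \<open>1 / t\<close>, hence \<open>t powr - \<theta>\<close>
  into the intermediate space; \<open>A (S t x)\<close> from \<open>E_0\<close> and from
  \<open>E\<close> to \<open>E_0\<close> costs \<open>1 / t\<close> and 1, hence
  \<open>t powr (\<theta> - 1)\<close>; and \<open>S t\<close> is bounded on both end spaces.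
  Admissibility of the functor supplies the density of the domain.\<close>

lemma smoothing_space_interp_scale:
  assumes K: "K = \<real> \<or> K = UNIV" and scl: "scalar_action K scl"
    and comm: "\<And>t k x. 0 \<le> t \<Longrightarrow> k \<in> K \<Longrightarrow> S t (scl k x) = scl k (S t x)"
    and E: "banach_space K scl E" "carr E = Dom" "densely_embedded E whole_space"
    and F: "\<And>\<sigma>. 0 < \<sigma> \<Longrightarrow> \<sigma> < 1 \<Longrightarrow> admissible_functor K scl \<sigma> (F \<sigma>)"
    and \<theta>: "0 \<le> \<theta>" "\<theta> < 1"
  shows "\<exists>c. smoothing_space S Dom A T M (interp_scale F E \<theta>) \<theta> c"
proof (cases "\<theta> = 0")
  case True
  have dense: "\<exists>y\<in>Dom. norm (x - y) < e" if "e > 0" for x e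
  proof -
    have "x \<in> closure Dom"
      using E by (simp add: densely_embedded_def)
    then show ?thesis
      using that by (auto simp: closure_approachable dist_norm norm_minus_commute)
  qed
  interpret W: banach_subspace "whole_space :: 'a nspace"
    by (rule banach_space_imp_subspace[OF K scl banach_space_whole[OF scl]]) (auto simp: embedded_def intro!: exI[of _ 1])
  have "smoothing_space S Dom A T M whole_space 0 (M + 1)"
  proof unfold_locales
    show "nrm whole_space (S t x) \<le> (M + 1) * t powr - 0 * norm x" if "0 < t" "t \<le> 2 * T" for t x
      using S_bound[of t x] that by (simp add: distrib_right) (meson add_increasing2 norm_ge_zero)
    show "norm (A (S t x)) \<le> (M + 1) * t powr (0 - 1) * nrm whole_space x" if "0 < t" "t \<le> 2 * T" for t x
    proof -
      have "M / t * norm x \<le> (M + 1) / t * norm x"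
        using that by (intro mult_right_mono divide_right_mono) auto
      then show ?thesis using AS_bound[OF that, of x] that by (simp add: powr_neg_one)
    qed
    show "S t x \<in> carr whole_space \<and> nrm whole_space (S t x) \<le> (M + 1) * nrm whole_space x" if "0 \<le> t" "t \<le> 2 * T" for t x
      using S_bound[of t x] that by (simp add: distrib_right) (meson add_increasing2 norm_ge_zero)
    show "nrm whole_space x \<le> (M + 1) * (norm x + norm (A x))" for x
    proof -
      have "1 * norm x \<le> (M + 1) * (norm x + norm (A x))" using M_pos by (intro mult_mono) auto
      then show ?thesis by simp
    qed
  qed (use M_pos dense in auto)
  with True show ?thesis by (auto simp: interp_scale_def)
next
  case False
  with \<theta> have \<theta>: "0 < \<theta>" "\<theta> < 1" by auto
  have Fa: "admissible_functor K scl \<theta> (F \<theta>)" by (rule F[OF \<theta>])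
  then have Fi: "interpolation_functor K scl \<theta> (F \<theta>)" by (simp add: admissible_functor_def)
  let ?W = "whole_space :: 'a nspace"
  define X where "X = F \<theta> ?W E"
  \<comment> \<open>The functor need not return \<open>E_0\<close> for the couple formed by
    \<open>E_0\<close> twice. The intersection and the sum of this couple are both
    \<open>E_0\<close>, whence \<open>W'\<close> is \<open>E_0\<close> with an equivalent norm;
    \<open>k1\<close> and \<open>k2\<close> are the constants of the equivalence.\<close>
  define W' where "W' = F \<theta> ?W ?W"
  have bW: "banach_space K scl ?W" by (rule banach_space_whole[OF scl])
  have sW: "banach_subspace ?W"
    by (rule banach_space_imp_subspace[OF K scl bW]) (auto simp: embedded_def intro!: exI[of _ 1])
  have sE: "banach_subspace E"
    by (rule banach_space_imp_subspace[OF K scl E(1)]) (use E(3) in \<open>simp add: densely_embedded_def\<close>)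
  interpret E: banach_subspace E by (rule sE)
  have coup: "couple K scl ?W ?W" "couple K scl ?W E"
    by (intro couple_of_embedded[OF K scl] bW sW E sE)+
  obtain g where g: "0 < g" "\<And>x. x \<in> Dom \<Longrightarrow> nrm E x \<le> g * (norm x + norm (A x))"
    "\<And>x. x \<in> Dom \<Longrightarrow> norm x + norm (A x) \<le> g * nrm E x"
    using nrm_graph_equiv[OF sE E(2)] by blast
  have Fprop: "banach_space K scl (F \<theta> Y0 Y1)" "embedded (inter_space Y0 Y1) (F \<theta> Y0 Y1)"
    "embedded (F \<theta> Y0 Y1) (sum_space Y0 Y1)" if "couple K scl Y0 Y1" for Y0 Y1
    using Fi that unfolding interpolation_functor_def by meson+
  \<comment> \<open>The sum norm dominates the ambient norm up to a factor. This is what embeds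
    \<open>X\<close> continuously in \<open>E_0\<close> and bounds \<open>norm\<close> by the norm
    of \<open>W'\<close>.\<close>
  have norm_le_sum: "norm x \<le> max 1 k * nrm (sum_space ?W Y) x"
    if k: "\<And>y. y \<in> carr Y \<Longrightarrow> norm y \<le> k * nrm Y y" and Y: "banach_subspace Y" for Y k x
  proof -
    interpret Y: banach_subspace Y by (rule Y)
    have pos: "0 < max 1 k" by (rule less_le_trans[OF zero_less_one max.cobounded1])
    have "norm x / max 1 k \<le> Inf {norm a + nrm Y b | a b. b \<in> carr Y \<and> x = a + b}"
    proof (rule cInf_greatest)
      have "norm x + nrm Y 0 \<in> {norm a + nrm Y b | a b. b \<in> carr Y \<and> x = a + b}"
        using Y.zero_mem by force
      then show "{norm a + nrm Y b | a b. b \<in> carr Y \<and> x = a + b} \<noteq> {}" by blast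
      fix z assume "z \<in> {norm a + nrm Y b | a b. b \<in> carr Y \<and> x = a + b}"
      then obtain a b where z: "z = norm a + nrm Y b" "b \<in> carr Y" "x = a + b" by blast
      have "norm x \<le> norm a + norm b" unfolding z by (rule norm_triangle_ineq)
      also have "\<dots> \<le> max 1 k * norm a + max 1 k * nrm Y b"
      proof (rule add_mono)
        have "1 * norm a \<le> max 1 k * norm a" by (intro mult_right_mono) auto
        then show "norm a \<le> max 1 k * norm a" by simp
        show "norm b \<le> max 1 k * nrm Y b"
          by (rule order_trans[OF k[OF z(2)]]) (use Y.nrm_ge0[OF z(2)] in \<open>auto intro!: mult_right_mono\<close>)
      qed
      finally show "norm x / max 1 k \<le> z" unfolding z by (simp add: pos_divide_le_eq[OF pos] algebra_simps)
    qed
    then show ?thesis by (simp add: sum_space_def pos_divide_le_eq[OF pos] mult.commute)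
  qed
  have W'_all: "x \<in> carr W'" for x
    using Fprop(2)[OF coup(1)] by (auto simp: embedded_def inter_space_def W'_def)
  obtain k1 where "\<forall>x. nrm W' x \<le> k1 * norm x"
    using Fprop(2)[OF coup(1)] by (auto simp: embedded_def inter_space_def W'_def)
  then have k1: "nrm W' x \<le> \<bar>k1\<bar> * norm x" for x
    by (meson abs_ge_self mult_right_mono norm_ge_zero order_trans)
  obtain k2 where k2: "\<forall>x. nrm (sum_space ?W ?W) x \<le> k2 * nrm W' x"
    using Fprop(3)[OF coup(1)] W'_all by (auto simp: embedded_def W'_def)
  have W'_ge0: "0 \<le> nrm W' x" for x
    using Fprop(1)[OF coup(1)] W'_all by (auto simp: banach_space_def W'_def)
  have k2': "norm x \<le> \<bar>k2\<bar> * nrm W' x" for x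
  proof -
    have "norm x \<le> nrm (sum_space ?W ?W) x"
      using norm_le_sum[of ?W 1 x] sW by simp
    also have "\<dots> \<le> k2 * nrm W' x" using k2 by blast
    also have "\<dots> \<le> \<bar>k2\<bar> * nrm W' x" using W'_ge0 by (intro mult_right_mono) auto
    finally show ?thesis .
  qed
  obtain k3 where k3: "0 < k3" "\<And>x. x \<in> carr E \<Longrightarrow> norm x \<le> k3 * nrm E x"
    using E.embed_const by blast
  have bX: "banach_space K scl X" unfolding X_def by (rule Fprop(1)[OF coup(2)])
  have "embedded X whole_space"
  proof -
    obtain k where k: "\<forall>x\<in>carr X. nrm (sum_space ?W E) x \<le> k * nrm X x"
      using Fprop(3)[OF coup(2)] by (auto simp: embedded_def X_def)
    have "norm x \<le> (max 1 k3 * k) * nrm X x" if "x \<in> carr X" for x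
    proof -
      have "norm x \<le> max 1 k3 * nrm (sum_space ?W E) x" by (rule norm_le_sum[OF k3(2) sE])
      also have "\<dots> \<le> max 1 k3 * (k * nrm X x)" using k that by (intro mult_left_mono) auto
      finally show ?thesis by simp
    qed
    then show ?thesis by (auto simp: embedded_def)
  qed
  then have sX: "banach_subspace X" by (rule banach_space_imp_subspace[OF K scl bX])
  interpret X: banach_subspace X by (rule sX)
  have EX: "carr E \<subseteq> carr X"
    using Fprop(2)[OF coup(2)] by (auto simp: embedded_def inter_space_def X_def)
  \<comment> \<open>Inclusion of the carriers is enough: the estimate comes from the comparison of
    complete norms, with the graph norm on the domain.\<close>
  obtain k4 where k4: "\<And>x. x \<in> Dom \<Longrightarrow> nrm X x \<le> k4 * (norm x + norm (A x))"
    using nrm_comparison[OF banach_subspace_graph sX] EX E(2) by auto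
  have lin: "linear_from K scl UNIV (S t)" if "0 \<le> t" for t
    using comm that S_add_right by (auto simp: linear_from_def)
  \<comment> \<open>Morphisms of couples are linear over \<open>K\<close>, whereas so far
    \<open>A\<close> is linear over the reals only.\<close>
  have A_comm: "A (scl k x) = scl k (A x)" if "k \<in> K" "x \<in> Dom" for k x
  proof (rule Dom_commute(2)[OF that(2)])
    show "bounded_linear (scl k)"
    proof (rule bounded_linear_intro)
      fix x y r
      show "scl k (x + y) = scl k x + scl k y" "norm (scl k x) \<le> norm x * cmod k"
        using scl that(1) by (auto simp: scalar_action_def mult.commute)
      have "of_real r \<in> K" using K by auto
      then show "scl k (r *\<^sub>R x) = r *\<^sub>R scl k x"
        using scl that(1) unfolding scalar_action_def by (metis mult.commute)
    qed
  qed (use comm that in auto)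
  have linA: "linear_from K scl UNIV (\<lambda>x. A (S t x))" if "0 < t" for t
    using that comm by (auto simp: linear_from_def S_add_right A_add S_mem_Dom A_comm)
  obtain a1 where a1: "0 < a1" "\<And>L m0 m1 x. linear_from K scl UNIV L \<Longrightarrow> 0 \<le> m0 \<Longrightarrow> 0 \<le> m1 \<Longrightarrow>
      (\<And>x. x \<in> carr ?W \<Longrightarrow> L x \<in> carr ?W \<and> nrm ?W (L x) \<le> m0 * nrm ?W x) \<Longrightarrow>
      (\<And>x. x \<in> carr ?W \<Longrightarrow> L x \<in> carr E \<and> nrm E (L x) \<le> m1 * nrm ?W x) \<Longrightarrow> x \<in> carr W' \<Longrightarrow>
      L x \<in> carr X \<and> nrm X (L x) \<le> a1 * m0 powr (1 - \<theta>) * m1 powr \<theta> * nrm W' x"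
    using interpolation_bound[OF Fi \<theta> coup(1) coup(2)] unfolding X_def W'_def by blast
  obtain a2 where a2: "0 < a2" "\<And>L m0 m1 x. linear_from K scl UNIV L \<Longrightarrow> 0 \<le> m0 \<Longrightarrow> 0 \<le> m1 \<Longrightarrow>
      (\<And>x. x \<in> carr ?W \<Longrightarrow> L x \<in> carr ?W \<and> nrm ?W (L x) \<le> m0 * nrm ?W x) \<Longrightarrow>
      (\<And>x. x \<in> carr E \<Longrightarrow> L x \<in> carr ?W \<and> nrm ?W (L x) \<le> m1 * nrm E x) \<Longrightarrow> x \<in> carr X \<Longrightarrow>
      L x \<in> carr W' \<and> nrm W' (L x) \<le> a2 * m0 powr (1 - \<theta>) * m1 powr \<theta> * nrm X x"
    using interpolation_bound[OF Fi \<theta> coup(2) coup(1)] unfolding X_def W'_def by blast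
  obtain a3 where a3: "0 < a3" "\<And>L m0 m1 x. linear_from K scl UNIV L \<Longrightarrow> 0 \<le> m0 \<Longrightarrow> 0 \<le> m1 \<Longrightarrow>
      (\<And>x. x \<in> carr ?W \<Longrightarrow> L x \<in> carr ?W \<and> nrm ?W (L x) \<le> m0 * nrm ?W x) \<Longrightarrow>
      (\<And>x. x \<in> carr E \<Longrightarrow> L x \<in> carr E \<and> nrm E (L x) \<le> m1 * nrm E x) \<Longrightarrow> x \<in> carr X \<Longrightarrow>
      L x \<in> carr X \<and> nrm X (L x) \<le> a3 * m0 powr (1 - \<theta>) * m1 powr \<theta> * nrm X x"
    using interpolation_bound[OF Fi \<theta> coup(2) coup(2)] unfolding X_def W'_def by blast
  define C1 where "C1 = g * M * (2 * T + 1)"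
  have C1: "C1 > 0" using g(1) M_pos T_pos by (simp add: C1_def)
  have S_E: "S t x \<in> carr E \<and> nrm E (S t x) \<le> C1 / t * norm x" if t: "0 < t" "t \<le> 2 * T" for t x
  proof
    show "S t x \<in> carr E" using S_mem_Dom t E(2) by simp
    have "nrm E (S t x) \<le> g * (M * norm x + M / t * norm x)"
      using g(2)[OF S_mem_Dom[OF t(1), of x]] S_bound[of t x] AS_bound[of t x] t g(1)
      by (smt (verit) mult_left_mono)
    also have "M * norm x + M / t * norm x = (M * (t + 1)) / t * norm x"
      using t by (simp add: field_simps)
    also have "\<dots> \<le> (M * (2 * T + 1)) / t * norm x"
      using t M_pos by (intro mult_right_mono divide_right_mono mult_left_mono) auto
    finally show "nrm E (S t x) \<le> C1 / t * norm x"
      using g(1) by (simp add: C1_def mult.assoc)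
  qed
  define B1 where "B1 = a1 * M powr (1 - \<theta>) * C1 powr \<theta> * \<bar>k1\<bar>"
  have P1: "S t x \<in> carr X \<and> nrm X (S t x) \<le> B1 * t powr - \<theta> * norm x" if t: "0 < t" "t \<le> 2 * T" for t x
  proof -
    have *: "S t x \<in> carr X \<and> nrm X (S t x) \<le> a1 * M powr (1 - \<theta>) * (C1 / t) powr \<theta> * nrm W' x"
      using t M_pos C1 S_bound S_E[OF t] W'_all by (intro a1(2) lin) auto
    have "nrm X (S t x) \<le> a1 * M powr (1 - \<theta>) * (C1 / t) powr \<theta> * nrm W' x" using * ..
    also have "\<dots> \<le> a1 * M powr (1 - \<theta>) * (C1 / t) powr \<theta> * (\<bar>k1\<bar> * norm x)"
      using k1[of x] a1(1) by (intro mult_left_mono) auto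
    also have "\<dots> = B1 * t powr - \<theta> * norm x"
    proof -
      have "(C1 / t) powr \<theta> = C1 powr \<theta> * t powr - \<theta>"
        using t C1 by (simp add: powr_divide powr_minus_divide)
      then show ?thesis by (simp add: B1_def mult_ac)
    qed
    finally show ?thesis using * by auto
  qed
  define B2 where "B2 = \<bar>k2\<bar> * (a2 * M powr (1 - \<theta>) * (M * g) powr \<theta>)"
  have P2: "norm (A (S t x)) \<le> B2 * t powr (\<theta> - 1) * nrm X x" if t: "0 < t" "t \<le> 2 * T" and x: "x \<in> carr X" for t x
  proof -
    have "norm (A (S t y)) \<le> (M * g) * nrm E y" if y: "y \<in> carr E" for y
    proof -
      have "norm (A (S t y)) \<le> M * norm (A y)"
        using S_Dom(2)[of y t] y E(2) t S_bound by simp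
      also have "\<dots> \<le> M * (g * nrm E y)"
      proof (rule mult_left_mono)
        have "norm y + norm (A y) \<le> g * nrm E y" using g(3) y E(2) by simp
        then show "norm (A y) \<le> g * nrm E y" using norm_ge_zero[of y] by linarith
      qed (use M_pos in simp)
      finally show ?thesis by simp
    qed
    then have *: "nrm W' (A (S t x)) \<le> a2 * (M / t) powr (1 - \<theta>) * (M * g) powr \<theta> * nrm X x"
      using t M_pos g(1) AS_bound[OF t] x a2(2)[OF linA[OF t(1)], of "M / t" "M * g" x] by auto
    have "norm (A (S t x)) \<le> \<bar>k2\<bar> * nrm W' (A (S t x))" by (rule k2')
    also have "\<dots> \<le> \<bar>k2\<bar> * (a2 * (M / t) powr (1 - \<theta>) * (M * g) powr \<theta> * nrm X x)"
      by (rule mult_left_mono[OF *]) simp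
    also have "(M / t) powr (1 - \<theta>) = M powr (1 - \<theta>) * t powr (\<theta> - 1)"
    proof -
      have "t powr (\<theta> - 1) = 1 / t powr (1 - \<theta>)"
        using powr_minus_divide[of t "1 - \<theta>"] by simp
      then show ?thesis using t M_pos by (simp add: powr_divide)
    qed
    finally show ?thesis by (simp add: B2_def mult_ac)
  qed
  define B3 where "B3 = a3 * M powr (1 - \<theta>) * (g * M * g) powr \<theta>"
  have P3: "S t x \<in> carr X \<and> nrm X (S t x) \<le> B3 * nrm X x" if t: "0 \<le> t" "t \<le> 2 * T" and x: "x \<in> carr X" for t x
  proof -
    have "S t y \<in> carr E \<and> nrm E (S t y) \<le> (g * M * g) * nrm E y" if y: "y \<in> carr E" for y
    proof
      have yD: "y \<in> Dom" using y E(2) by simp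
      show "S t y \<in> carr E" using S_Dom(1)[OF yD t(1)] E(2) by simp
      have "nrm E (S t y) \<le> g * (norm (S t y) + norm (A (S t y)))" using g(2) S_Dom(1)[OF yD t(1)] by simp
      also have "\<dots> \<le> g * (M * norm y + M * norm (A y))"
        using S_Dom(2)[OF yD t(1)] S_bound[OF t] g(1) by (intro mult_left_mono add_mono) auto
      also have "\<dots> = g * M * (norm y + norm (A y))" by (simp add: algebra_simps)
      also have "\<dots> \<le> g * M * (g * nrm E y)"
        using g(1,3) yD M_pos by (intro mult_left_mono) auto
      finally show "nrm E (S t y) \<le> (g * M * g) * nrm E y" by (simp add: mult_ac)
    qed
    then show ?thesis
      unfolding B3_def using t M_pos g(1) S_bound[OF t] x by (intro a3(2) lin) auto
  qed
  have P4: "\<exists>y\<in>Dom. nrm X (x - y) < e" if x: "x \<in> carr X" and e: "0 < e" for x e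
  proof -
    have "densely_embedded E X"
      using Fa coup(2) E(3) by (auto simp: admissible_functor_def X_def)
    then have "x \<in> ntop X closure_of Dom" using x E(2) by (simp add: densely_embedded_def)
    then obtain y where "y \<in> Dom" "y \<in> X.M.mball x e"
      using e unfolding ntop_def X.M.metric_closure_of by blast
    then show ?thesis by (auto simp: ndist_def)
  qed
  define c where "c = \<bar>B1\<bar> + \<bar>B2\<bar> + \<bar>B3\<bar> + \<bar>k4\<bar> + 1"
  have c: "B1 \<le> c" "B2 \<le> c" "B3 \<le> c" "k4 \<le> c" by (auto simp: c_def)
  have "smoothing_space S Dom A T M X \<theta> c"
  proof unfold_locales
    show "nrm X (S t x) \<le> c * t powr - \<theta> * norm x" if "0 < t" "t \<le> 2 * T" for t x
      using P1[OF that, of x] c(1) by (meson mult_right_mono norm_ge_zero order_trans powr_ge_zero)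
    show "norm (A (S t x)) \<le> c * t powr (\<theta> - 1) * nrm X x" if "0 < t" "t \<le> 2 * T" "x \<in> carr X" for t x
      using P2[OF that] c(2) X.nrm_ge0[OF that(3)] by (meson mult_right_mono order_trans powr_ge_zero)
    show "S t x \<in> carr X \<and> nrm X (S t x) \<le> c * nrm X x" if "0 \<le> t" "t \<le> 2 * T" "x \<in> carr X" for t x
      using P3[OF that] c(3) X.nrm_ge0[OF that(3)] by (meson mult_right_mono order_trans)
    show "nrm X x \<le> c * (norm x + norm (A x))" if "x \<in> Dom" for x
      by (rule order_trans[OF k4[OF that] mult_right_mono[OF c(4)]]) simp
    show "0 < c" unfolding c_def by (simp add: add_nonneg_pos)
  qed (use P1 P4 \<theta> EX E(2) in auto)
  then show ?thesis
    using False by (auto simp: interp_scale_def X_def)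
qed

end

section \<open>Singular integrals\<close>

text \<open>The integrals \<open>\<Phi> c\<close> over \<open>{c..t}\<close> have increments
  dominated by those of \<open>H\<close>, the primitive of \<open>G * s powr - \<xi>\<close>, and
  therefore converge as \<open>c\<close> tends to 0. Extended by the limit, \<open>\<Phi>\<close> is
  continuous on \<open>{0..t}\<close> with derivative \<open>- \<phi>\<close> inside, and the
  fundamental theorem yields integrability up to the singular end.\<close>

lemma integrable_singular_at_0:
  fixes \<phi> :: "real \<Rightarrow> 'a::banach"
  assumes t: "0 < t" and cont: "continuous_on {0<..t} \<phi>" and \<xi>: "\<xi> < 1"
    and bound: "\<And>s. 0 < s \<Longrightarrow> s \<le> t \<Longrightarrow> norm (\<phi> s) \<le> G * s powr - \<xi>"
  shows "\<phi> integrable_on {0..t}"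
proof -
  define H where "H s = G * s powr (1 - \<xi>) / (1 - \<xi>)" for s
  define \<Phi> where "\<Phi> c = integral {c..t} \<phi>" for c
  have H_deriv: "(H has_real_derivative G * s powr - \<xi>) (at s)" if "s > 0" for s
    using DERIV_cdivide[OF DERIV_cmult[OF has_real_derivative_powr[OF that, of "1 - \<xi>"]], of G "1 - \<xi>"] \<xi>
    by (simp add: H_def[abs_def])
  have int: "\<phi> integrable_on {c..t}" if "0 < c" for c
    using that by (intro integrable_continuous_real continuous_on_subset[OF cont]) auto
  have deriv: "(\<Phi> has_vector_derivative - \<phi> s) (at s)" if s: "0 < s" "s < t" for s
  proof -
    have "continuous_on {s/2..t} \<phi>" using s by (intro continuous_on_subset[OF cont]) auto
    then have "((\<lambda>c. integral {c..t} \<phi>) has_vector_derivative - \<phi> s) (at s within {s/2..t})"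
      using s by (intro integral_has_vector_derivative') auto
    then show ?thesis
      unfolding \<Phi>_def[abs_def] using s at_within_interior[of s "{s/2..t}"] by simp
  qed
  have cont\<Phi>: "continuous_on {c..t} \<Phi>" if "0 < c" for c
    unfolding \<Phi>_def[abs_def] by (rule indefinite_integral_continuous_1'[OF int[OF that]])
  have contH: "continuous_on {c..t} H" if "0 < c" for c
    using H_deriv that by (meson DERIV_isCont atLeastAtMost_iff continuous_at_imp_continuous_on less_le_trans)
  have diff_le: "norm (\<Phi> d - \<Phi> c) \<le> H d - H c" if "0 < c" "c \<le> d" "d \<le> t" for c d
  proof (cases "c = d")
    case False
    show ?thesis
    proof (rule differentiable_bound_general[where \<phi> = H and f = \<Phi> and \<phi>' = "\<lambda>s. G * s powr - \<xi>" and f' = "\<lambda>s. - \<phi> s"])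
      show "continuous_on {c..d} \<Phi>" "continuous_on {c..d} H"
        using continuous_on_subset[OF cont\<Phi>] continuous_on_subset[OF contH] that by auto
      show "(\<Phi> has_vector_derivative - \<phi> s) (at s)" if "c < s" "s < d" for s
        using deriv[of s] that \<open>0 < c\<close> \<open>d \<le> t\<close> by auto
      show "(H has_vector_derivative G * s powr - \<xi>) (at s)" if "c < s" "s < d" for s
        using H_deriv[of s] that \<open>0 < c\<close> by (simp add: has_real_derivative_iff_has_vector_derivative)
      show "norm (- \<phi> s) \<le> G * s powr - \<xi>" if "c < s" "s < d" for s
        using bound[of s] that \<open>0 < c\<close> \<open>d \<le> t\<close> by auto
    qed (use False that in auto)
  qed simp
  have diff_le': "norm (\<Phi> d - \<Phi> c) \<le> \<bar>H d - H c\<bar>" if "0 < c" "0 < d" "c \<le> t" "d \<le> t" for c d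
    using diff_le[of c d] diff_le[of d c] that by (cases "c \<le> d") (auto simp: norm_minus_commute)
  define c where "c n = t / (real n + 1)" for n
  have c: "0 < c n" "c n \<le> t" for n using t by (auto simp: c_def field_simps)
  have H0: "(H \<longlongrightarrow> 0) (at_right 0)"
  proof -
    have "((\<lambda>s::real. s powr (1 - \<xi>)) \<longlongrightarrow> 0) (at_right 0)"
      using tendsto_powr'[OF tendsto_ident_at tendsto_const, of 0 "1 - \<xi>" "{0<..}"] \<xi>
      by (simp add: eventually_at_filter)
    then have "((\<lambda>s. G * s powr (1 - \<xi>) / (1 - \<xi>)) \<longlongrightarrow> G * 0 / (1 - \<xi>)) (at_right 0)"
      using \<xi> by (intro tendsto_intros) auto
    then show ?thesis by (simp add: H_def[abs_def])
  qed
  have c0: "filterlim c (at_right 0) sequentially"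
  proof -
    have "c \<longlonglongrightarrow> 0"
      unfolding c_def using tendsto_mult_right_zero[OF LIMSEQ_inverse_real_of_nat, of t]
      by (simp add: divide_inverse add.commute)
    moreover have "c n \<noteq> 0" for n using c(1)[of n] by simp
    ultimately show ?thesis using c by (auto simp: filterlim_at)
  qed
  have Hc: "(\<lambda>n. H (c n)) \<longlonglongrightarrow> 0" by (rule filterlim_compose[OF H0 c0])
  have "Cauchy (\<lambda>n. \<Phi> (c n))"
  proof (rule metric_CauchyI)
    fix e :: real assume "e > 0"
    have "Cauchy (\<lambda>n. H (c n))" using Hc LIMSEQ_imp_Cauchy by blast
    then obtain N where N: "\<forall>m\<ge>N. \<forall>n\<ge>N. dist (H (c m)) (H (c n)) < e"
      using \<open>e > 0\<close> by (auto simp: Cauchy_def)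
    have "dist (\<Phi> (c m)) (\<Phi> (c n)) < e" if "m \<ge> N" "n \<ge> N" for m n
      using le_less_trans[OF diff_le'[OF c(1) c(1) c(2) c(2)]] N that by (simp add: dist_norm dist_real_def)
    then show "\<exists>N. \<forall>m\<ge>N. \<forall>n\<ge>N. dist (\<Phi> (c m)) (\<Phi> (c n)) < e" by blast
  qed
  then obtain L where L: "(\<lambda>n. \<Phi> (c n)) \<longlonglongrightarrow> L"
    using Cauchy_convergent convergent_def by metis
  have L_le: "norm (\<Phi> d - L) \<le> \<bar>H d\<bar>" if d: "0 < d" "d \<le> t" for d
  proof (rule tendsto_le[OF sequentially_bot])
    show "(\<lambda>n. norm (\<Phi> d - \<Phi> (c n))) \<longlonglongrightarrow> norm (\<Phi> d - L)" by (intro tendsto_intros L)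
    have "(\<lambda>n. \<bar>H d - H (c n)\<bar>) \<longlonglongrightarrow> \<bar>H d - 0\<bar>" by (intro tendsto_intros Hc)
    then show "(\<lambda>n. \<bar>H d - H (c n)\<bar>) \<longlonglongrightarrow> \<bar>H d\<bar>" by simp
    show "\<forall>\<^sub>F n in sequentially. norm (\<Phi> d - \<Phi> (c n)) \<le> \<bar>H d - H (c n)\<bar>"
      using diff_le' c d by (intro always_eventually allI) blast
  qed
  define \<Psi> where "\<Psi> s = (if 0 < s then \<Phi> s else L)" for s
  have "continuous_on {0..t} \<Psi>"
    unfolding continuous_on_def
  proof
    fix s assume s: "s \<in> {0..t}"
    show "(\<Psi> \<longlongrightarrow> \<Psi> s) (at s within {0..t})"
    proof (cases "s = 0")
      case True
      have "((\<lambda>d. \<Phi> d - L) \<longlongrightarrow> 0) (at 0 within {0<..t})"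
      proof (rule Lim_null_comparison)
        show "\<forall>\<^sub>F d in at 0 within {0<..t}. norm (\<Phi> d - L) \<le> \<bar>H d\<bar>"
          using L_le by (auto simp: eventually_at_filter)
        show "((\<lambda>d. \<bar>H d\<bar>) \<longlongrightarrow> 0) (at 0 within {0<..t})"
          by (rule tendsto_rabs_zero[OF tendsto_within_subset[OF H0]]) auto
      qed
      then have "(\<Phi> \<longlongrightarrow> L) (at 0 within {0<..t})" by (rule LIM_zero_cancel)
      then have "(\<Psi> \<longlongrightarrow> L) (at 0 within {0<..t})"
        by (rule Lim_transform_eventually) (auto simp: eventually_at_filter \<Psi>_def)
      moreover have "at 0 within {0..t} = at 0 within {0<..t}"
      proof -
        have "{0..t} - {0} = {0<..t} - {0}" by auto
        then show ?thesis by (simp add: at_within_def)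
      qed
      ultimately show ?thesis using True by (simp add: \<Psi>_def)
    next
      case False
      then have s: "0 < s" "s \<le> t" using s by auto
      have "(\<Phi> \<longlongrightarrow> \<Phi> s) (at s within {s/2..t})"
        using cont\<Phi>[of "s/2"] s by (auto simp: continuous_on_def)
      moreover have "\<forall>\<^sub>F d in at s within {s/2..t}. \<Phi> d = \<Psi> d"
        unfolding eventually_at_filter by (intro always_eventually) (use s in \<open>auto simp: \<Psi>_def\<close>)
      ultimately have "(\<Psi> \<longlongrightarrow> \<Phi> s) (at s within {s/2..t})"
        by (rule Lim_transform_eventually)
      then have "(\<Psi> \<longlongrightarrow> \<Psi> s) (at s within {s/2..t})"
        using s by (simp add: \<Psi>_def)
      moreover have "at s within {s/2..t} = at s within {0..t}"
        using s by (intro at_within_nhd[of _ "{s/2<..}"]) auto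
      ultimately show ?thesis by simp
    qed
  qed
  moreover have "(\<Psi> has_vector_derivative - \<phi> s) (at s)" if "s \<in> {0<..<t}" for s
    by (rule has_vector_derivative_transform_within_open[OF deriv[of s], of "{0<..}"])
      (use that in \<open>auto simp: \<Psi>_def\<close>)
  ultimately have "((\<lambda>s. - \<phi> s) has_integral (\<Psi> t - \<Psi> 0)) {0..t}"
    using t by (intro fundamental_theorem_of_calculus_interior) auto
  then show ?thesis
    using integrable_neg[of "\<lambda>s. - \<phi> s"] by (auto simp: integrable_on_def)
qed

text \<open>The substitution \<open>s = t * x\<close> reduces the kernel to Euler's beta integral
  and produces the power \<open>1 - a - b\<close> of \<open>t\<close>.\<close>

lemma has_integral_beta_kernel:
  fixes a b t :: real
  assumes "a < 1" "b < 1" "0 < t"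
  shows "((\<lambda>s. (t - s) powr - a * s powr - b) has_integral Beta (1 - b) (1 - a) * t powr (1 - a - b)) {0..t}"
proof -
  have "((\<lambda>x. x powr - b * (1 - x) powr - a) has_integral Beta (1 - b) (1 - a)) (cbox 0 1)"
    using has_integral_Beta_real[of "1 - b" "1 - a"] assms by simp
  from has_integral_affinity[OF this, of "1 / t" 0]
  have "((\<lambda>s. (s / t) powr - b * (1 - s / t) powr - a) has_integral t * Beta (1 - b) (1 - a)) ((*) t ` {0..1})"
    using assms by simp
  moreover have "(*) t ` {0..1} = {0..t}" using assms by (simp add: image_mult_atLeastAtMost)
  ultimately have "((\<lambda>s. t powr (- a - b) * ((s / t) powr - b * (1 - s / t) powr - a)) has_integral
      t powr (- a - b) * (t * Beta (1 - b) (1 - a))) {0..t}"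
    by (intro has_integral_mult_right) simp
  moreover have "t powr (- a - b) * ((s / t) powr - b * (1 - s / t) powr - a) = (t - s) powr - a * s powr - b"
    if "s \<in> {0..t}" for s
  proof -
    have "1 - s / t = (t - s) / t" using assms by (simp add: field_simps)
    then have "t powr (- a - b) * ((s / t) powr - b * (1 - s / t) powr - a) =
        (t powr (- a - b) * (1 / t powr - b) * (1 / t powr - a)) * ((t - s) powr - a * s powr - b)"
      using that assms by (simp add: powr_divide)
    also have "t powr (- a - b) * (1 / t powr - b) * (1 / t powr - a) = 1"
      using assms by (simp add: powr_diff powr_minus field_simps)
    finally show ?thesis by simp
  qed
  moreover have "t powr (- a - b) * (t * Beta (1 - b) (1 - a)) = Beta (1 - b) (1 - a) * t powr (1 - a - b)"
  proof -
    have "t powr (1 + (- a - b)) = t powr 1 * t powr (- a - b)" by (rule powr_add)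
    then show ?thesis using assms by (simp add: algebra_simps)
  qed
  ultimately show ?thesis by (metis (no_types, lifting) has_integral_eq)
qed

lemma norm_integral_beta_kernel_le:
  fixes \<phi> :: "real \<Rightarrow> 'a::banach"
  assumes "\<phi> integrable_on {0..t}" "a < 1" "b < 1" "0 < t"
    and bound: "\<And>s. 0 < s \<Longrightarrow> s < t \<Longrightarrow> norm (\<phi> s) \<le> N * ((t - s) powr - a * s powr - b)"
  shows "norm (integral {0..t} \<phi>) \<le> N * Beta (1 - b) (1 - a) * t powr (1 - a - b)"
proof -
  \<comment> \<open>At \<open>0\<close> and \<open>t\<close> the kernel evaluates to 0, because
    \<open>0 powr x = 0\<close>, whereas \<open>\<phi>\<close> is arbitrary there; both values are
    reset.\<close>
  define \<psi> where "\<psi> s = (if s \<in> {0, t} then 0 else \<phi> s)" for s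
  have eq: "integral {0..t} \<phi> = integral {0..t} \<psi>" and int: "\<psi> integrable_on {0..t}"
    using integral_spike[of "{0, t}" "{0..t}" \<psi> \<phi>] integrable_spike[OF assms(1), of "{0, t}" \<psi>]
    by (auto simp: \<psi>_def)
  note B = has_integral_mult_right[OF has_integral_beta_kernel[OF assms(2-4)], of N]
  have "norm (integral {0..t} \<psi>) \<le> integral {0..t} (\<lambda>s. N * ((t - s) powr - a * s powr - b))"
    by (rule integral_norm_bound_integral[OF int]) (use B bound in \<open>auto simp: \<psi>_def integrable_on_def\<close>)
  also have "\<dots> = N * (Beta (1 - b) (1 - a) * t powr (1 - a - b))"
    by (rule integral_unique[OF B])
  finally show ?thesis by (simp add: eq mult.assoc)
qed

text \<open>The device by which a singularity in \<open>\<sigma> + (t - s)\<close> is distributed: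
  one factor in \<open>\<sigma>\<close> measures decay or convergence as \<open>\<sigma>\<close>
  tends to 0, the other in \<open>t - s\<close> enters the integral over \<open>s\<close>.\<close>

lemma powr_add_le:
  fixes x y :: real
  assumes "0 < x" "0 < y" "p \<le> 0" "q \<le> 0"
  shows "(x + y) powr (p + q) \<le> x powr p * y powr q"
  unfolding powr_add using assms by (intro mult_mono powr_mono2') auto

section \<open>Decay of the orbit as a measure of smoothness\<close>

context smoothing_semigroup
begin

text \<open>Membership in the real interpolation space of exponent \<open>\<beta>\<close> and second index \<open>\<infinity>\<close>.\<close>

definition decay :: "real \<Rightarrow> real \<Rightarrow> 'a \<Rightarrow> bool" where
  "decay \<beta> N w \<longleftrightarrow> (\<forall>\<sigma>. 0 < \<sigma> \<and> \<sigma> \<le> T \<longrightarrow> norm (A (S \<sigma> w)) \<le> N * \<sigma> powr (\<beta> - 1))"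

lemma decayD: "decay \<beta> N w \<Longrightarrow> 0 < \<sigma> \<Longrightarrow> \<sigma> \<le> T \<Longrightarrow> norm (A (S \<sigma> w)) \<le> N * \<sigma> powr (\<beta> - 1)"
  by (simp add: decay_def)

lemma decay_nonneg: "decay \<beta> N w \<Longrightarrow> 0 \<le> N"
  using decayD[of \<beta> N w T] T_pos norm_ge_zero[of "A (S T w)"]
  by (smt (verit) mult_neg_pos powr_gt_zero)

lemma decay_mono: "decay \<beta> N w \<Longrightarrow> N \<le> N' \<Longrightarrow> decay \<beta> N' w"
  unfolding decay_def by (meson mult_right_mono order_trans powr_ge_zero)

lemma decay_add: "decay \<beta> N w \<Longrightarrow> decay \<beta> N' w' \<Longrightarrow> decay \<beta> (N + N') (w + w')"
  unfolding decay_def by (auto simp: AS_add distrib_right intro!: norm_triangle_le add_mono)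

lemma decay_diff: "decay \<beta> N w \<Longrightarrow> decay \<beta> N' w' \<Longrightarrow> decay \<beta> (N + N') (w - w')"
  unfolding decay_def by (auto simp: AS_diff distrib_right intro!: norm_triangle_le_diff add_mono)

text \<open>Since \<open>\<beta> > 0\<close>, the decay bound is integrable down to 0; its integral
  is a Hoelder bound for the orbit at time 0 in the ambient norm.\<close>

lemma norm_S_sub_le:
  assumes w: "decay \<beta> N w" and \<beta>: "0 < \<beta>" and t: "0 < t" "t \<le> T"
  shows "norm (S t w - w) \<le> N / \<beta> * t powr \<beta>"
proof -
  have "norm (S t w - S 0 w) \<le> N / \<beta> * t powr \<beta> - N / \<beta> * 0 powr \<beta>"
  proof (rule norm_S_diff_le[where \<phi>' = "\<lambda>\<sigma>. N * \<sigma> powr (\<beta> - 1)"])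
    show "continuous_on {0..t} (\<lambda>\<sigma>. N / \<beta> * \<sigma> powr \<beta>)"
      using \<beta> by (intro continuous_intros continuous_on_powr') auto
    show "((\<lambda>\<sigma>. N / \<beta> * \<sigma> powr \<beta>) has_real_derivative N * \<sigma> powr (\<beta> - 1)) (at \<sigma>)" if "0 < \<sigma>" for \<sigma>
      using that \<beta> by (auto intro!: derivative_eq_intros)
    show "norm (A (S \<sigma> w)) \<le> N * \<sigma> powr (\<beta> - 1)" if "0 < \<sigma>" "\<sigma> < t" for \<sigma>
      using decayD[OF w] that t by simp
  qed (use t in auto)
  then show ?thesis using \<beta> by simp
qed

end

text \<open>The telescoping sum of \<open>S (\<tau> / 2 ^ (n + 1)) w - S (\<tau> / 2 ^ n) w\<close> converges in \<open>X\<close>, so that \<open>w\<close> is in \<open>X\<close>;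
  no integration in \<open>X\<close> is needed.\<close>

lemma (in smoothing_space) decay_imp_mem:
  assumes \<beta>: "\<alpha> < \<beta>" "\<beta> \<le> 1"
  obtains k where "0 < k" "\<And>w N. decay \<beta> N w \<Longrightarrow> w \<in> carr X"
    "\<And>w N \<tau>. decay \<beta> N w \<Longrightarrow> 0 < \<tau> \<Longrightarrow> \<tau> \<le> T \<Longrightarrow> nrm X (w - S \<tau> w) \<le> k * N * \<tau> powr (\<beta> - \<alpha>)"
proof -
  define r :: real where "r = (1/2) powr (\<beta> - \<alpha>)"
  have r: "0 \<le> r" "r < 1"
    using \<beta> powr_less_mono2[of "\<beta> - \<alpha>" "1/2" 1] by (auto simp: r_def)
  have main: "w \<in> carr X \<and> nrm X (w - S \<tau> w) \<le> 2 * c / (1 - r) * N * \<tau> powr (\<beta> - \<alpha>)"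
    if w: "decay \<beta> N w" and \<tau>: "0 < \<tau>" "\<tau> \<le> T" for w N \<tau>
  proof -
    have N: "0 \<le> N" by (rule decay_nonneg[OF w])
    define s where "s n = S (\<tau> * (1/2) ^ n) w" for n
    have pos: "0 < \<tau> * (1/2) ^ n" for n using \<tau> by simp
    have le: "\<tau> * (1/2) ^ n \<le> T" for n
    proof -
      have "\<tau> * (1/2) ^ n \<le> \<tau>" using \<tau> by (intro mult_right_le_one_le power_le_one) auto
      then show ?thesis using \<tau> by linarith
    qed
    have mem: "s n \<in> carr X" for n
      unfolding s_def using S_mem[OF pos] le[of n] T_pos by simp
    have step: "nrm X (s (Suc n) - s n) \<le> (2 * c * N * \<tau> powr (\<beta> - \<alpha>)) * r ^ n" for n
    proof -
      \<comment> \<open>Consecutive terms are \<open>S (2 * h) w\<close> and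
        \<open>S (4 * h) w\<close>. One factor \<open>S h\<close> smooths into \<open>X\<close> at
        the cost \<open>h powr - \<alpha>\<close>; the remaining difference between the times
        \<open>h\<close> and \<open>3 * h\<close> is controlled by decay and is of order
        \<open>h powr \<beta>\<close>.\<close>
      define h where "h = \<tau> * (1/2) ^ n / 4"
      have h: "0 < h" "4 * h \<le> T" using pos[of n] le[of n] by (auto simp: h_def)
      have "s (Suc n) = S h (S h w)" "s n = S h (S (3 * h) w)"
        unfolding s_def using S_add[of h h w] S_add[of h "3 * h" w] h by (simp_all add: h_def)
      then have eq: "s (Suc n) - s n = S h (S h w - S (3 * h) w)"
        using h by (simp add: S_diff)
      have "norm (S (3 * h) w - S h w) \<le> (N * h powr (\<beta> - 1)) * (3 * h) - (N * h powr (\<beta> - 1)) * h"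
      proof (rule norm_S_diff_le[where \<phi>' = "\<lambda>\<sigma>. N * h powr (\<beta> - 1)"])
        show "continuous_on {h..3 * h} (\<lambda>\<sigma>. N * h powr (\<beta> - 1) * \<sigma>)" by (intro continuous_intros)
        show "((\<lambda>\<sigma>. N * h powr (\<beta> - 1) * \<sigma>) has_real_derivative N * h powr (\<beta> - 1)) (at \<sigma>)" for \<sigma>
          by (auto intro!: derivative_eq_intros)
        show "norm (A (S \<sigma> w)) \<le> N * h powr (\<beta> - 1)" if \<sigma>: "h < \<sigma>" "\<sigma> < 3 * h" for \<sigma>
        proof -
          have "norm (A (S \<sigma> w)) \<le> N * \<sigma> powr (\<beta> - 1)" using decayD[OF w] \<sigma> h by simp
          also have "\<dots> \<le> N * h powr (\<beta> - 1)"
            using \<sigma> h \<beta> N by (intro mult_left_mono powr_mono2') auto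
          finally show ?thesis .
        qed
      qed (use h in auto)
      then have d: "norm (S h w - S (3 * h) w) \<le> 2 * N * h powr (\<beta> - 1) * h"
        by (simp add: norm_minus_commute algebra_simps)
      have "nrm X (s (Suc n) - s n) \<le> c * h powr - \<alpha> * norm (S h w - S (3 * h) w)"
        unfolding eq using S_smooth[of h] h T_pos by simp
      also have "\<dots> \<le> c * h powr - \<alpha> * (2 * N * h powr (\<beta> - 1) * h)"
        using d c_pos by (intro mult_left_mono) auto
      also have "\<dots> = 2 * c * N * h powr (\<beta> - \<alpha>)"
      proof -
        have "h powr (- \<alpha> + (\<beta> - 1) + 1) = h powr - \<alpha> * h powr (\<beta> - 1) * h powr 1"
          unfolding powr_add ..
        then show ?thesis using h by simp
      qed
      also have "\<dots> \<le> 2 * c * N * (\<tau> * (1/2) ^ n) powr (\<beta> - \<alpha>)"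
        using c_pos N \<beta> h by (intro mult_left_mono powr_mono2) (auto simp: h_def)
      also have "(\<tau> * (1/2) ^ n) powr (\<beta> - \<alpha>) = \<tau> powr (\<beta> - \<alpha>) * r ^ n"
      proof -
        have "((1/2 :: real) ^ n) powr (\<beta> - \<alpha>) = r ^ n"
          unfolding r_def by (simp add: powr_powr powr_power mult.commute flip: powr_realpow)
        then show ?thesis using \<tau> by (simp add: powr_mult)
      qed
      finally show ?thesis by (simp add: mult_ac)
    qed
    have lim: "s \<longlonglongrightarrow> w"
    proof -
      have "((\<lambda>t. S t w) \<longlongrightarrow> S 0 w) (at 0 within {0..})"
        by (rule bspec[OF S_continuous[of w, unfolded continuous_on_def]]) simp
      moreover have "filterlim (\<lambda>n. \<tau> * (1/2) ^ n) (at 0 within {0..}) sequentially"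
      proof -
        have "(\<lambda>n. \<tau> * (1/2) ^ n) \<longlonglongrightarrow> 0"
          using tendsto_mult_right_zero[OF LIMSEQ_realpow_zero[of "1/2"], of \<tau>] by simp
        then show ?thesis using \<tau> by (auto simp: filterlim_at)
      qed
      ultimately show ?thesis
        unfolding s_def using filterlim_compose by fastforce
    qed
    note L = geometric_limit[OF mem step r lim]
    then show ?thesis
      using L(2) by (simp add: s_def field_simps)
  qed
  show ?thesis
  proof (rule that[of "2 * c / (1 - r)"])
    show "w \<in> carr X" if "decay \<beta> N w" for w N using main[OF that T_pos] by simp
  qed (use main c_pos r in auto)
qed

lemma (in smoothing_space) nrm_le_decay:
  assumes \<beta>: "\<alpha> < \<beta>" "\<beta> \<le> 1"
  obtains k where "0 < k" "\<And>w N. decay \<beta> N w \<Longrightarrow> w \<in> carr X"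
    "\<And>w N \<tau>. decay \<beta> N w \<Longrightarrow> 0 < \<tau> \<Longrightarrow> \<tau> \<le> T \<Longrightarrow>
      nrm X w \<le> k * (\<tau> powr - \<alpha> * norm w + N * \<tau> powr (\<beta> - \<alpha>))"
proof -
  obtain k where k: "0 < k" "\<And>w N. decay \<beta> N w \<Longrightarrow> w \<in> carr X"
    "\<And>w N \<tau>. decay \<beta> N w \<Longrightarrow> 0 < \<tau> \<Longrightarrow> \<tau> \<le> T \<Longrightarrow> nrm X (w - S \<tau> w) \<le> k * N * \<tau> powr (\<beta> - \<alpha>)"
    using decay_imp_mem[OF \<beta>] by blast
  have "nrm X w \<le> (c + k) * (\<tau> powr - \<alpha> * norm w + N * \<tau> powr (\<beta> - \<alpha>))"
    if w: "decay \<beta> N w" and \<tau>: "0 < \<tau>" "\<tau> \<le> T" for w N \<tau>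
  proof -
    have \<tau>2: "\<tau> \<le> 2 * T" using \<tau> T_pos by simp
    have "nrm X w \<le> nrm X (S \<tau> w) + nrm X (w - S \<tau> w)"
      by (rule nrm_le_add_diff[OF k(2)[OF w] S_mem[OF \<tau>(1) \<tau>2]])
    also have "\<dots> \<le> c * (\<tau> powr - \<alpha> * norm w) + k * (N * \<tau> powr (\<beta> - \<alpha>))"
      using S_smooth[OF \<tau>(1) \<tau>2, of w] k(3)[OF w \<tau>] by (simp add: mult.assoc)
    also have "\<dots> \<le> (c + k) * (\<tau> powr - \<alpha> * norm w + N * \<tau> powr (\<beta> - \<alpha>))"
      using k(1) c_pos decay_nonneg[OF w] by (simp add: algebra_simps)
    finally show ?thesis .
  qed
  with k(1,2) c_pos show ?thesis by (intro that[of "c + k"]) auto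
qed

section \<open>The variation of constants formula\<close>

lemma exp_minus_le_powr:
  fixes x \<epsilon> :: real
  assumes "0 < x" "0 < \<epsilon>" "\<epsilon> < 1"
  shows "exp (- x) \<le> x powr - \<epsilon>"
proof -
  have "x powr \<epsilon> \<le> exp x"
  proof (cases "x \<le> 1")
    case True
    then have "x powr \<epsilon> \<le> 1" using assms by (intro powr_le1) auto
    also have "\<dots> \<le> exp x" using assms by simp
    finally show ?thesis .
  next
    case False
    then have "x powr \<epsilon> \<le> x powr 1" using assms by (intro powr_mono) auto
    also have "x powr 1 = x" using assms by simp
    also have "x \<le> exp x" using exp_ge_add_one_self[of x] by linarith
    finally show ?thesis .
  qed
  then show ?thesis
    using assms by (simp add: exp_minus powr_minus le_imp_inverse_le)
qed

lemma Beta_real_pos: "0 < x \<Longrightarrow> 0 < y \<Longrightarrow> 0 < Beta x (y :: real)"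
  by (simp add: Beta_def Gamma_real_pos)

text \<open>A bound on \<open>{\<epsilon>..T}\<close> for either sign of \<open>p\<close>; exponents
  such as \<open>1 - \<beta> - \<xi>\<close> may be negative.\<close>

lemma powr_le_add_powr:
  fixes t \<epsilon> T p :: real
  assumes "0 < \<epsilon>" "\<epsilon> \<le> t" "t \<le> T"
  shows "t powr p \<le> \<epsilon> powr p + T powr p"
proof (cases "0 \<le> p")
  case True
  then have "t powr p \<le> T powr p" using assms by (intro powr_mono2) auto
  then show ?thesis by (simp add: add_increasing)
next
  case False
  then have "t powr p \<le> \<epsilon> powr p" using assms by (intro powr_mono2') auto
  then show ?thesis by (simp add: add_increasing2)
qed

context smoothing_semigroup
begin

text \<open>With \<open>\<xi>\<close> the index of the space on which \<open>f\<close> acts, the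
  rate \<open>s powr - \<xi>\<close> is the bound for \<open>S s u0\<close> in that space when
  \<open>u0\<close> is merely in \<open>E_0\<close>, and linear growth transfers it to
  \<open>f\<close>. Nothing is demanded at \<open>s = 0\<close>.\<close>

definition forcing :: "real \<Rightarrow> real \<Rightarrow> (real \<Rightarrow> 'a) \<Rightarrow> bool" where
  "forcing \<xi> G g \<longleftrightarrow> continuous_on {0<..T} g \<and> (\<forall>s\<in>{0<..T}. norm (g s) \<le> G * s powr - \<xi>)"

definition conv :: "(real \<Rightarrow> 'a) \<Rightarrow> real \<Rightarrow> 'a" where
  "conv g t = integral {0..t} (\<lambda>s. S (t - s) (g s))"

definition mild :: "'a \<Rightarrow> (real \<Rightarrow> 'a) \<Rightarrow> real \<Rightarrow> 'a" where
  "mild x g t = S t x + conv g t"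

lemma forcing_bound: "forcing \<xi> G g \<Longrightarrow> 0 < s \<Longrightarrow> s \<le> T \<Longrightarrow> norm (g s) \<le> G * s powr - \<xi>"
  by (simp add: forcing_def)

lemma forcing_continuous: "forcing \<xi> G g \<Longrightarrow> t \<le> T \<Longrightarrow> continuous_on {0<..t} g"
  unfolding forcing_def by (auto intro: continuous_on_subset)

lemma forcing_nonneg: "forcing \<xi> G g \<Longrightarrow> 0 \<le> G"
  using forcing_bound[of \<xi> G g T] T_pos norm_ge_zero[of "g T"]
  by (smt (verit) mult_neg_pos powr_gt_zero)

lemma forcing_S_bound:
  assumes "forcing \<xi> G g" "0 < s" "s \<le> T" "0 \<le> p" "p \<le> 2 * T"
  shows "norm (S p (g s)) \<le> M * (G * s powr - \<xi>)"
  using S_bound[OF assms(4,5), of "g s"] forcing_bound[OF assms(1-3)] M_pos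
  by (meson less_imp_le mult_left_mono order_trans)

lemma forcing_AS_bound:
  assumes "forcing \<xi> G g" "0 < s" "s \<le> T" "0 < \<tau>" "\<tau> \<le> 2 * T"
  shows "norm (A (S \<tau> (g s))) \<le> M * G * \<tau> powr (0 - 1) * s powr - \<xi>"
proof -
  have "norm (A (S \<tau> (g s))) \<le> M / \<tau> * norm (g s)" by (rule AS_bound[OF assms(4,5)])
  also have "\<dots> \<le> M / \<tau> * (G * s powr - \<xi>)"
    using forcing_bound[OF assms(1-3)] M_pos assms by (intro mult_left_mono) auto
  finally show ?thesis using assms by simp
qed

lemma conv_integrable:
  assumes g: "forcing \<xi> G g" and \<xi>: "\<xi> < 1" and t: "0 \<le> t" "t \<le> T" and p: "0 \<le> p" "p \<le> T"
  shows "(\<lambda>s. S (p + (t - s)) (g s)) integrable_on {0..t}"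
proof (cases "t = 0")
  case False
  then have t0: "0 < t" using t by simp
  show ?thesis
  proof (rule integrable_singular_at_0[OF t0 _ \<xi>])
    have "continuous_on {0<..t} g"
      using g t by (auto simp: forcing_def intro: continuous_on_subset)
    then show "continuous_on {0<..t} (\<lambda>s. S (p + (t - s)) (g s))"
      using t p by (intro S_continuous_pair continuous_intros) auto
    show "norm (S (p + (t - s)) (g s)) \<le> (M * G) * s powr - \<xi>" if "0 < s" "s \<le> t" for s
      using forcing_S_bound[OF g, of s "p + (t - s)"] that t p by (simp add: mult.assoc)
  qed
qed (use integrable_on_refl[of _ "0 :: real"] in simp)

lemma conv_linear:
  assumes g: "forcing \<xi> G g" and \<xi>: "\<xi> < 1" and t: "0 \<le> t" "t \<le> T" and L: "bounded_linear L"
  shows "L (conv g t) = integral {0..t} (\<lambda>s. L (S (t - s) (g s)))"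
    and "(\<lambda>s. L (S (t - s) (g s))) integrable_on {0..t}"
proof -
  have int: "(\<lambda>s. S (t - s) (g s)) integrable_on {0..t}"
    using conv_integrable[OF g \<xi> t, of 0] T_pos by simp
  show "L (conv g t) = integral {0..t} (\<lambda>s. L (S (t - s) (g s)))"
    using integral_linear[OF int L] by (simp add: conv_def o_def)
  show "(\<lambda>s. L (S (t - s) (g s))) integrable_on {0..t}"
    using integrable_linear[OF int L] by (simp add: o_def)
qed

text \<open>The bounded operator given by \<open>A\<close> after \<open>S \<sigma>\<close> passes
  under the integral and merges with \<open>S (t - s)\<close>, so that a bound at the time
  \<open>\<sigma> + (t - s)\<close> is all that must be supplied.\<close>

lemma decay_conv_kernel:
  assumes g: "forcing \<xi> G g" and \<xi>: "\<xi> < 1" and t: "0 < t" "t \<le> T" and a: "a < 1"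
    and bound: "\<And>s \<sigma>. 0 < s \<Longrightarrow> s < t \<Longrightarrow> 0 < \<sigma> \<Longrightarrow> \<sigma> \<le> T \<Longrightarrow>
      norm (A (S (\<sigma> + (t - s)) (g s))) \<le> N * \<sigma> powr (\<beta> - 1) * ((t - s) powr - a * s powr - \<xi>)"
  shows "decay \<beta> (N * Beta (1 - \<xi>) (1 - a) * t powr (1 - a - \<xi>)) (conv g t)"
  unfolding decay_def
proof (intro allI impI)
  fix \<sigma> assume "0 < \<sigma> \<and> \<sigma> \<le> T"
  then have \<sigma>: "0 < \<sigma>" "\<sigma> \<le> T" by auto
  note L = conv_linear[OF g \<xi> less_imp_le[OF t(1)] t(2) AS_linear[OF \<sigma>(1)]]
  have "norm (A (S \<sigma> (conv g t))) \<le> (N * \<sigma> powr (\<beta> - 1)) * Beta (1 - \<xi>) (1 - a) * t powr (1 - a - \<xi>)"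
    unfolding L(1)
  proof (rule norm_integral_beta_kernel_le[OF L(2) a \<xi> t(1)])
    fix s assume s: "0 < s" "s < t"
    have "S \<sigma> (S (t - s) (g s)) = S (\<sigma> + (t - s)) (g s)"
      using S_add[of \<sigma> "t - s" "g s"] \<sigma> s by simp
    then show "norm (A (S \<sigma> (S (t - s) (g s)))) \<le> N * \<sigma> powr (\<beta> - 1) * ((t - s) powr - a * s powr - \<xi>)"
      using bound[OF s \<sigma>] by simp
  qed
  then show "norm (A (S \<sigma> (conv g t))) \<le> N * Beta (1 - \<xi>) (1 - a) * t powr (1 - a - \<xi>) * \<sigma> powr (\<beta> - 1)"
    by (simp add: mult_ac)
qed

text \<open>The exponent \<open>\<gamma> - 1\<close> is split into \<open>\<beta> - 1\<close> for
  \<open>\<sigma>\<close> and \<open>\<gamma> - \<beta>\<close> for \<open>t - s\<close>; the latter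
  is integrable because \<open>\<beta> - \<gamma> < 1\<close>. The case \<open>\<gamma> = 0\<close>
  is that of a forcing known only in \<open>E_0\<close>.\<close>

lemma decay_conv:
  assumes g: "forcing \<xi> G g" and \<xi>: "\<xi> < 1" and t: "0 < t" "t \<le> T"
    and \<gamma>: "\<gamma> \<le> \<beta>" "\<beta> - \<gamma> < 1" "\<beta> \<le> 1"
    and bound: "\<And>s \<tau>. 0 < s \<Longrightarrow> s \<le> T \<Longrightarrow> 0 < \<tau> \<Longrightarrow> \<tau> \<le> 2 * T \<Longrightarrow>
      norm (A (S \<tau> (g s))) \<le> N * \<tau> powr (\<gamma> - 1) * s powr - \<xi>"
  shows "decay \<beta> (N * Beta (1 - \<xi>) (1 - (\<beta> - \<gamma>)) * t powr (1 - (\<beta> - \<gamma>) - \<xi>)) (conv g t)"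
proof (rule decay_conv_kernel[OF g \<xi> t \<gamma>(2)])
  fix s \<sigma> assume s: "0 < s" "s < t" and \<sigma>: "0 < \<sigma>" "\<sigma> \<le> T"
  have "0 \<le> N"
    using bound[of T T] T_pos norm_ge_zero[of "A (S T (g T))"]
    by (smt (verit) mult_neg_pos powr_gt_zero)
  have "norm (A (S (\<sigma> + (t - s)) (g s))) \<le> N * (\<sigma> + (t - s)) powr (\<gamma> - 1) * s powr - \<xi>"
    using bound[of s "\<sigma> + (t - s)"] s \<sigma> t by simp
  also have "(\<sigma> + (t - s)) powr (\<gamma> - 1) = (\<sigma> + (t - s)) powr ((\<beta> - 1) + - (\<beta> - \<gamma>))"
    by simp
  also have "N * \<dots> * s powr - \<xi> \<le> N * (\<sigma> powr (\<beta> - 1) * (t - s) powr - (\<beta> - \<gamma>)) * s powr - \<xi>"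
    using s \<sigma> \<gamma> \<open>0 \<le> N\<close> by (intro mult_left_mono mult_right_mono powr_add_le) auto
  finally show "norm (A (S (\<sigma> + (t - s)) (g s))) \<le> N * \<sigma> powr (\<beta> - 1) * ((t - s) powr - (\<beta> - \<gamma>) * s powr - \<xi>)"
    by (simp add: mult_ac)
qed

lemma conv_cong:
  assumes "\<And>s. 0 < s \<Longrightarrow> s \<le> t \<Longrightarrow> g s = g' s"
  shows "conv g t = conv g' t"
  unfolding conv_def by (rule integral_spike[of "{0}"]) (use assms in auto)

lemma norm_conv_le:
  assumes g: "forcing \<xi> G g" and \<xi>: "\<xi> < 1" and t: "0 < t" "t \<le> T"
  shows "norm (conv g t) \<le> M * G * Beta (1 - \<xi>) 1 * t powr (1 - \<xi>)"
proof -
  have "norm (conv g t) \<le> M * G * Beta (1 - \<xi>) (1 - 0) * t powr (1 - 0 - \<xi>)"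
    unfolding conv_def
  proof (rule norm_integral_beta_kernel_le[OF _ _ \<xi> t(1)])
    show "(\<lambda>s. S (t - s) (g s)) integrable_on {0..t}"
      using conv_integrable[OF g \<xi> _ t(2), of 0] t T_pos by simp
    show "norm (S (t - s) (g s)) \<le> M * G * ((t - s) powr - 0 * s powr - \<xi>)" if "0 < s" "s < t" for s
      using forcing_S_bound[OF g, of s "t - s"] that t by (simp add: mult.assoc)
  qed simp
  then show ?thesis by simp
qed

lemma decay_S:
  assumes \<beta>: "0 \<le> \<beta>" "\<beta> \<le> 1" and t: "0 < t" "t \<le> T"
  shows "decay \<beta> (M * norm x * t powr - \<beta>) (S t x)"
  unfolding decay_def
proof (intro allI impI)
  fix \<sigma> assume "0 < \<sigma> \<and> \<sigma> \<le> T"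
  then have \<sigma>: "0 < \<sigma>" "\<sigma> \<le> T" by auto
  have "norm (A (S \<sigma> (S t x))) \<le> M * (\<sigma> + t) powr (- 1) * norm x"
    using AS_bound[of "\<sigma> + t" x] S_add[of \<sigma> t x] \<sigma> t by simp
  also have "(\<sigma> + t) powr (- 1) = (\<sigma> + t) powr ((\<beta> - 1) + - \<beta>)" by simp
  also have "M * \<dots> * norm x \<le> M * (\<sigma> powr (\<beta> - 1) * t powr - \<beta>) * norm x"
    using \<sigma> t \<beta> M_pos by (intro mult_left_mono mult_right_mono powr_add_le) auto
  finally show "norm (A (S \<sigma> (S t x))) \<le> M * norm x * t powr - \<beta> * \<sigma> powr (\<beta> - 1)"
    by (simp add: mult_ac)
qed

lemma conv_step:
  assumes g: "forcing \<xi> G g" and \<xi>: "\<xi> < 1" and t: "0 \<le> t1" "t1 \<le> t2" "t2 \<le> T"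
  shows "conv g t2 = S (t2 - t1) (conv g t1) + integral {t1..t2} (\<lambda>s. S (t2 - s) (g s))"
proof -
  have "(\<lambda>s. S (t2 - s) (g s)) integrable_on {0..t2}"
    using conv_integrable[OF g \<xi> _ t(3), of 0] t T_pos by simp
  from Henstock_Kurzweil_Integration.integral_combine[OF t(1,2) this]
  have "conv g t2 = integral {0..t1} (\<lambda>s. S (t2 - s) (g s)) + integral {t1..t2} (\<lambda>s. S (t2 - s) (g s))"
    by (simp add: conv_def)
  also have "integral {0..t1} (\<lambda>s. S (t2 - s) (g s)) = integral {0..t1} (\<lambda>s. S (t2 - t1) (S (t1 - s) (g s)))"
  proof (rule integral_cong)
    fix s assume "s \<in> {0..t1}"
    then show "S (t2 - s) (g s) = S (t2 - t1) (S (t1 - s) (g s))"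
      using S_add[of "t2 - t1" "t1 - s" "g s"] t by simp
  qed
  also have "\<dots> = S (t2 - t1) (conv g t1)"
    using conv_linear(1)[OF g \<xi> t(1) _ S_linear, of "t2 - t1"] t by simp
  finally show ?thesis .
qed

lemma mild_step:
  assumes g: "forcing \<xi> G g" and \<xi>: "\<xi> < 1" and t: "0 \<le> t1" "t1 \<le> t2" "t2 \<le> T"
  shows "mild x g t2 = S (t2 - t1) (mild x g t1) + integral {t1..t2} (\<lambda>s. S (t2 - s) (g s))"
  using conv_step[OF assms] S_add[of "t2 - t1" t1 x] t by (simp add: mild_def S_add_right)

lemma step_integral_continuous:
  assumes g: "forcing \<xi> G g" and t: "0 < t1" "t1 \<le> t2" "t2 \<le> T"
  shows "continuous_on {t1..t2} (\<lambda>s. S (t2 - s) (g s))"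
proof -
  have "continuous_on {t1..t2} g"
    using g t by (auto simp: forcing_def intro: continuous_on_subset)
  then show ?thesis using t by (intro S_continuous_pair continuous_intros) auto
qed

lemma norm_step_integral_le:
  assumes g: "forcing \<xi> G g" and \<xi>: "0 \<le> \<xi>" and t: "0 < t1" "t1 \<le> t2" "t2 \<le> T"
  shows "norm (integral {t1..t2} (\<lambda>s. S (t2 - s) (g s))) \<le> M * G * t1 powr - \<xi> * (t2 - t1)"
proof (rule integral_bound[OF t(2) step_integral_continuous[OF g t]])
  fix s assume s: "s \<in> {t1..t2}"
  have "norm (S (t2 - s) (g s)) \<le> M * (G * s powr - \<xi>)"
    using forcing_S_bound[OF g, of s "t2 - s"] s t by simp
  also have "\<dots> \<le> M * (G * t1 powr - \<xi>)"
    using s t \<xi> M_pos forcing_nonneg[OF g] by (intro mult_left_mono powr_mono2') auto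
  finally show "norm (S (t2 - s) (g s)) \<le> M * G * t1 powr - \<xi>" by (simp add: mult.assoc)
qed

text \<open>The constant depends on the forcing through \<open>G\<close> and \<open>\<xi>\<close>
  only. It is this uniformity that serves a whole sequence of approximate solutions away from
  \<open>t = 0\<close>.\<close>

lemma decay_mild:
  assumes \<xi>: "\<xi> < 1" and \<beta>: "0 \<le> \<beta>" "\<beta> < 1" and \<epsilon>: "0 < \<epsilon>"
  obtains N where "\<And>g t. forcing \<xi> G g \<Longrightarrow> \<epsilon> \<le> t \<Longrightarrow> t \<le> T \<Longrightarrow> decay \<beta> N (mild x g t)"
proof -
  define B where "B = Beta (1 - \<xi>) (1 - \<beta>)"
  define p where "p = 1 - \<beta> - \<xi>"
  have "B > 0" unfolding B_def using \<xi> \<beta> by (intro Beta_real_pos) auto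
  have "decay \<beta> (M * norm x * \<epsilon> powr - \<beta> + M * G * B * (\<epsilon> powr p + T powr p)) (mild x g t)"
    if g: "forcing \<xi> G g" and t: "\<epsilon> \<le> t" "t \<le> T" for g t
    unfolding mild_def
  proof (rule decay_add)
    have "M * norm x * t powr - \<beta> \<le> M * norm x * \<epsilon> powr - \<beta>"
      using t \<epsilon> \<beta> M_pos by (intro mult_left_mono powr_mono2') auto
    then show "decay \<beta> (M * norm x * \<epsilon> powr - \<beta>) (S t x)"
      using decay_mono decay_S[of \<beta> t x] t \<epsilon> \<beta> by auto
    have "decay \<beta> (M * G * B * t powr p) (conv g t)"
      using decay_conv[OF g \<xi>, of t 0 \<beta> "M * G"] forcing_AS_bound[OF g] t \<epsilon> \<beta>
      by (simp add: B_def p_def)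
    moreover have "M * G * B * t powr p \<le> M * G * B * (\<epsilon> powr p + T powr p)"
      using powr_le_add_powr[OF \<epsilon> t] M_pos forcing_nonneg[OF g] \<open>B > 0\<close> by (intro mult_left_mono) auto
    ultimately show "decay \<beta> (M * G * B * (\<epsilon> powr p + T powr p)) (conv g t)"
      using decay_mono by blast
  qed
  then show ?thesis by (rule that)
qed

text \<open>Restarted at \<open>t1\<close>, the increment consists of \<open>S h - id\<close>
  applied to a vector with decay, of order \<open>h powr \<beta>\<close>, and of an integral over a
  time span \<open>h\<close>, of order \<open>h \<le> T powr (1 - \<beta>) * h powr \<beta>\<close>.
  The constant \<open>H\<close> is uniform in the forcing.\<close>

lemma mild_hoelder:
  assumes \<xi>: "0 \<le> \<xi>" "\<xi> < 1" and \<beta>: "0 < \<beta>" "\<beta> < 1" and \<epsilon>: "0 < \<epsilon>"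
  obtains H where "\<And>g t1 t2. forcing \<xi> G g \<Longrightarrow> \<epsilon> \<le> t1 \<Longrightarrow> t1 \<le> t2 \<Longrightarrow> t2 \<le> T \<Longrightarrow>
    norm (mild x g t2 - mild x g t1) \<le> H * (t2 - t1) powr \<beta>"
proof -
  obtain N where N: "\<And>g t. forcing \<xi> G g \<Longrightarrow> \<epsilon> \<le> t \<Longrightarrow> t \<le> T \<Longrightarrow> decay \<beta> N (mild x g t)"
    using decay_mild[OF \<xi>(2) less_imp_le[OF \<beta>(1)] \<beta>(2) \<epsilon>] by blast
  define H where "H = N / \<beta> + M * G * \<epsilon> powr - \<xi> * T powr (1 - \<beta>)"
  have "norm (mild x g t2 - mild x g t1) \<le> H * (t2 - t1) powr \<beta>"
    if g: "forcing \<xi> G g" and t: "\<epsilon> \<le> t1" "t1 \<le> t2" "t2 \<le> T" for g t1 t2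
  proof (cases "t1 = t2")
    case False
    define h where "h = t2 - t1"
    have h: "0 < h" "h \<le> T" using False t \<epsilon> by (auto simp: h_def)
    have G: "0 \<le> G" by (rule forcing_nonneg[OF g])
    have t1: "0 < t1" using t \<epsilon> by simp
    have "norm (S h (mild x g t1) - mild x g t1) \<le> N / \<beta> * h powr \<beta>"
      by (rule norm_S_sub_le[OF N[OF g t(1)] \<beta>(1) h]) (use t in simp)
    moreover have "norm (integral {t1..t2} (\<lambda>s. S (t2 - s) (g s))) \<le> M * G * \<epsilon> powr - \<xi> * T powr (1 - \<beta>) * h powr \<beta>"
    proof -
      have "norm (integral {t1..t2} (\<lambda>s. S (t2 - s) (g s))) \<le> M * G * t1 powr - \<xi> * h"
        unfolding h_def by (rule norm_step_integral_le[OF g \<xi>(1) t1 t(2,3)])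
      also have "\<dots> \<le> M * G * \<epsilon> powr - \<xi> * (T powr (1 - \<beta>) * h powr \<beta>)"
      proof (rule mult_mono)
        show "M * G * t1 powr - \<xi> \<le> M * G * \<epsilon> powr - \<xi>"
          using M_pos G t \<epsilon> \<xi> by (intro mult_left_mono powr_mono2') auto
        have "h powr 1 = h powr (1 - \<beta>) * h powr \<beta>" by (simp flip: powr_add)
        also have "\<dots> \<le> T powr (1 - \<beta>) * h powr \<beta>"
          using h \<beta> by (intro mult_right_mono powr_mono2) auto
        finally show "h \<le> T powr (1 - \<beta>) * h powr \<beta>" using h by simp
      qed (use M_pos G h in auto)
      finally show ?thesis by (simp add: mult_ac)
    qed
    moreover have "mild x g t2 - mild x g t1 =
        (S h (mild x g t1) - mild x g t1) + integral {t1..t2} (\<lambda>s. S (t2 - s) (g s))"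
      using mild_step[OF g \<xi>(2) less_imp_le[OF t1] t(2,3), of x] by (simp add: h_def)
    ultimately show ?thesis
      using norm_triangle_ineq[of "S h (mild x g t1) - mild x g t1" "integral {t1..t2} (\<lambda>s. S (t2 - s) (g s))"]
      by (simp add: H_def h_def algebra_simps)
  qed simp
  then show ?thesis by (rule that)
qed

text \<open>From \<open>exp (- x) \<le> x powr - \<epsilon>\<close> at
  \<open>x = \<mu> * (t - s)\<close>: part of the exponential weight is traded for the small factor
  \<open>\<mu> powr - \<epsilon>\<close>, at the price of a singularity
  \<open>(t - s) powr - \<epsilon>\<close>.\<close>

lemma weighted_kernel_le:
  fixes G \<mu> \<epsilon> s t :: real
  assumes "0 \<le> G" "0 < \<mu>" "0 < \<epsilon>" "\<epsilon> < 1" "0 < s" "s < t"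
  shows "G * s powr - \<xi> * exp (\<mu> * s) \<le> (G * \<mu> powr - \<epsilon> * exp (\<mu> * t)) * ((t - s) powr - \<epsilon> * s powr - \<xi>)"
proof -
  have "exp (- (\<mu> * (t - s))) \<le> (\<mu> * (t - s)) powr - \<epsilon>"
    using assms by (intro exp_minus_le_powr) auto
  then have "exp (\<mu> * t) * exp (- (\<mu> * (t - s))) \<le> exp (\<mu> * t) * (\<mu> powr - \<epsilon> * (t - s) powr - \<epsilon>)"
    using assms by (intro mult_left_mono) (auto simp: powr_mult)
  then have "exp (\<mu> * s) \<le> exp (\<mu> * t) * (\<mu> powr - \<epsilon> * (t - s) powr - \<epsilon>)"
    by (simp add: algebra_simps flip: exp_add)
  then have "G * s powr - \<xi> * exp (\<mu> * s) \<le> G * s powr - \<xi> * (exp (\<mu> * t) * (\<mu> powr - \<epsilon> * (t - s) powr - \<epsilon>))"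
    using assms by (intro mult_left_mono) auto
  then show ?thesis by (simp add: mult_ac)
qed

end

section \<open>Mild solutions in the norms of the interpolation spaces\<close>

context smoothing_space
begin

lemma decay_mem:
  assumes "\<alpha> < \<beta>" "\<beta> \<le> 1" "decay \<beta> N w"
  shows "w \<in> carr X"
  using decay_imp_mem[OF assms(1,2)] assms(3) by metis

text \<open>Taking the free parameter equal to the increment \<open>h\<close> balances the two
  terms: both \<open>h powr - \<alpha> * h powr \<beta>\<close> and the decay term are of order
  \<open>h powr (\<beta> - \<alpha>)\<close>.\<close>

lemma hoelder_upgrade:
  assumes \<beta>: "\<alpha> < \<beta>" "\<beta> \<le> 1"
  obtains k where "0 < k" "\<And>w1 w2 N H h. decay \<beta> N w1 \<Longrightarrow> decay \<beta> N w2 \<Longrightarrow> 0 < h \<Longrightarrow> h \<le> T \<Longrightarrow>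
    norm (w2 - w1) \<le> H * h powr \<beta> \<Longrightarrow> nrm X (w2 - w1) \<le> k * (H + 2 * N) * h powr (\<beta> - \<alpha>)"
proof -
  obtain k where k: "0 < k" "\<And>w N. decay \<beta> N w \<Longrightarrow> w \<in> carr X" "\<And>w N \<tau>. decay \<beta> N w \<Longrightarrow> 0 < \<tau> \<Longrightarrow> \<tau> \<le> T \<Longrightarrow>
      nrm X w \<le> k * (\<tau> powr - \<alpha> * norm w + N * \<tau> powr (\<beta> - \<alpha>))"
    by (rule nrm_le_decay[OF \<beta>]) (rule that)
  have "nrm X (w2 - w1) \<le> k * (H + 2 * N) * h powr (\<beta> - \<alpha>)"
    if d: "decay \<beta> N w1" "decay \<beta> N w2" and h: "0 < h" "h \<le> T" and n: "norm (w2 - w1) \<le> H * h powr \<beta>"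
    for w1 w2 N H h
  proof -
    have "nrm X (w2 - w1) \<le> k * (h powr - \<alpha> * norm (w2 - w1) + (N + N) * h powr (\<beta> - \<alpha>))"
      by (rule k(3)[OF decay_diff[OF d(2,1)] h])
    also have "\<dots> \<le> k * (h powr - \<alpha> * (H * h powr \<beta>) + (N + N) * h powr (\<beta> - \<alpha>))"
      using n k(1) by (intro mult_left_mono add_right_mono) auto
    also have "\<dots> = k * (H + 2 * N) * h powr (\<beta> - \<alpha>)"
      by (simp add: powr_diff powr_minus divide_inverse algebra_simps)
    finally show ?thesis .
  qed
  with k(1) show ?thesis by (rule that)
qed

lemma mild_nrm_hoelder:
  assumes \<xi>: "0 \<le> \<xi>" "\<xi> < 1" and \<beta>: "\<alpha> < \<beta>" "\<beta> < 1" and \<epsilon>: "0 < \<epsilon>"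
  obtains H where "\<And>g t1 t2. forcing \<xi> G g \<Longrightarrow> \<epsilon> \<le> t1 \<Longrightarrow> t1 \<le> t2 \<Longrightarrow> t2 \<le> T \<Longrightarrow>
    nrm X (mild x g t2 - mild x g t1) \<le> H * (t2 - t1) powr (\<beta> - \<alpha>)"
proof -
  have \<beta>0: "0 < \<beta>" using \<beta> \<alpha>_ge0 by simp
  obtain N where N: "\<And>g t. forcing \<xi> G g \<Longrightarrow> \<epsilon> \<le> t \<Longrightarrow> t \<le> T \<Longrightarrow> decay \<beta> N (mild x g t)"
    using decay_mild[OF \<xi>(2) less_imp_le[OF \<beta>0] \<beta>(2) \<epsilon>] by blast
  obtain H where H: "\<And>g t1 t2. forcing \<xi> G g \<Longrightarrow> \<epsilon> \<le> t1 \<Longrightarrow> t1 \<le> t2 \<Longrightarrow> t2 \<le> T \<Longrightarrow>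
    norm (mild x g t2 - mild x g t1) \<le> H * (t2 - t1) powr \<beta>"
    using mild_hoelder[OF \<xi> \<beta>0 \<beta>(2) \<epsilon>] by blast
  obtain k where k: "0 < k" "\<And>w1 w2 N H h. decay \<beta> N w1 \<Longrightarrow> decay \<beta> N w2 \<Longrightarrow> 0 < h \<Longrightarrow> h \<le> T \<Longrightarrow>
    norm (w2 - w1) \<le> H * h powr \<beta> \<Longrightarrow> nrm X (w2 - w1) \<le> k * (H + 2 * N) * h powr (\<beta> - \<alpha>)"
    by (rule hoelder_upgrade[OF \<beta>(1) less_imp_le[OF \<beta>(2)]]) (rule that)
  have "nrm X (mild x g t2 - mild x g t1) \<le> k * (H + 2 * N) * (t2 - t1) powr (\<beta> - \<alpha>)"
    if g: "forcing \<xi> G g" and t: "\<epsilon> \<le> t1" "t1 \<le> t2" "t2 \<le> T" for g t1 t2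
  proof (cases "t1 = t2")
    case False
    then show ?thesis
      using t \<epsilon> H[OF g t] by (intro k(2) N[OF g]) auto
  qed simp
  then show ?thesis by (rule that)
qed

lemma mild_mem:
  assumes \<xi>: "\<xi> < 1" and g: "forcing \<xi> G g" and t: "0 < t" "t \<le> T"
  shows "mild x g t \<in> carr X"
proof -
  define \<beta> where "\<beta> = (\<alpha> + 1) / 2"
  have \<beta>: "0 \<le> \<beta>" "\<alpha> < \<beta>" "\<beta> < 1" using \<alpha>_ge0 \<alpha>_less1 by (auto simp: \<beta>_def)
  obtain N where N: "\<And>g s. forcing \<xi> G g \<Longrightarrow> t \<le> s \<Longrightarrow> s \<le> T \<Longrightarrow> decay \<beta> N (mild x g s)"
    using decay_mild[OF \<xi> \<beta>(1,3) t(1)] by blast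
  show ?thesis
    by (rule decay_mem[OF \<beta>(2) less_imp_le[OF \<beta>(3)] N[OF g order_refl t(2)]])
qed

lemma continuous_map_of_hoelder:
  assumes mem: "\<And>t. 0 < t \<Longrightarrow> t \<le> T \<Longrightarrow> u t \<in> carr X" and \<delta>: "0 < \<delta>"
    and hoelder: "\<And>\<epsilon>. 0 < \<epsilon> \<Longrightarrow>
      \<exists>H. \<forall>t1 t2. \<epsilon> \<le> t1 \<longrightarrow> t1 < t2 \<longrightarrow> t2 \<le> T \<longrightarrow> nrm X (u t2 - u t1) \<le> H * (t2 - t1) powr \<delta>"
  shows "continuous_map (top_of_set {0<..T}) (ntop X) u"
  unfolding continuous_map_ntop_iff
proof (intro ballI conjI)
  fix t assume "t \<in> {0<..T}"
  then have t: "0 < t" "t \<le> T" by auto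
  then show "u t \<in> carr X" by (rule mem)
  have t2: "0 < t / 2" using t by simp
  obtain H where H: "\<And>t1 t2. t / 2 \<le> t1 \<Longrightarrow> t1 < t2 \<Longrightarrow> t2 \<le> T \<Longrightarrow> nrm X (u t2 - u t1) \<le> H * (t2 - t1) powr \<delta>"
    using hoelder[OF t2] by blast
  have bound: "nrm X (u s - u t) \<le> H * \<bar>s - t\<bar> powr \<delta>" if s: "t / 2 < s" "s \<le> T" "s \<noteq> t" for s
  proof (cases "s < t")
    case True
    have "nrm X (u s - u t) = nrm X (u t - u s)"
      using s t2 t by (intro nrm_diff_commute mem) auto
    then show ?thesis using H[of s t] True s t by (simp add: abs_minus_commute)
  qed (use H[of t s] s t in auto)
  show "((\<lambda>s. nrm X (u s - u t)) \<longlongrightarrow> 0) (at t within {0<..T})"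
  proof (rule Lim_null_comparison)
    show "\<forall>\<^sub>F s in at t within {0<..T}. norm (nrm X (u s - u t)) \<le> H * \<bar>s - t\<bar> powr \<delta>"
      unfolding eventually_at
    proof (intro exI[of _ "t / 2"] conjI ballI impI t2)
      fix s assume s: "s \<in> {0<..T}" "s \<noteq> t \<and> dist s t < t / 2"
      then have "t / 2 < s" "s \<le> T" by (auto simp: dist_real_def abs_if split: if_splits)
      moreover have "0 \<le> nrm X (u s - u t)"
        using s t by (intro nrm_ge0 diff_mem mem) auto
      ultimately show "norm (nrm X (u s - u t)) \<le> H * \<bar>s - t\<bar> powr \<delta>"
        using bound s by simp
    qed
    have "((\<lambda>s. \<bar>s - t\<bar>) \<longlongrightarrow> 0) (at t within {0<..T})"
      using tendsto_rabs_zero[OF LIM_zero[OF tendsto_ident_at[of t "{0<..T}"]]] by simp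
    then have "((\<lambda>s. \<bar>s - t\<bar> powr \<delta>) \<longlongrightarrow> 0 powr \<delta>) (at t within {0<..T})"
      using \<delta> by (intro tendsto_powr') auto
    then show "((\<lambda>s. H * \<bar>s - t\<bar> powr \<delta>) \<longlongrightarrow> 0) (at t within {0<..T})"
      using tendsto_mult_right_zero by simp
  qed
qed

lemma mild_continuous:
  assumes \<xi>: "0 \<le> \<xi>" "\<xi> < 1" and g: "forcing \<xi> G g"
  shows "continuous_map (top_of_set {0<..T}) (ntop X) (mild x g)"
proof (rule continuous_map_of_hoelder)
  define \<beta> where "\<beta> = (\<alpha> + 1) / 2"
  have \<beta>: "\<alpha> < \<beta>" "\<beta> < 1" using \<alpha>_less1 by (auto simp: \<beta>_def)
  show "0 < \<beta> - \<alpha>" using \<beta> by simp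
  show "\<exists>H. \<forall>t1 t2. \<epsilon> \<le> t1 \<longrightarrow> t1 < t2 \<longrightarrow> t2 \<le> T \<longrightarrow>
      nrm X (mild x g t2 - mild x g t1) \<le> H * (t2 - t1) powr (\<beta> - \<alpha>)" if \<epsilon>: "0 < \<epsilon>" for \<epsilon>
  proof (rule mild_nrm_hoelder[OF \<xi> \<beta> \<epsilon>])
    fix H assume "\<And>g t1 t2. forcing \<xi> G g \<Longrightarrow> \<epsilon> \<le> t1 \<Longrightarrow> t1 \<le> t2 \<Longrightarrow> t2 \<le> T \<Longrightarrow>
      nrm X (mild x g t2 - mild x g t1) \<le> H * (t2 - t1) powr (\<beta> - \<alpha>)"
    from this[OF g] show ?thesis by (intro exI[of _ H]) auto
  qed
qed (rule mild_mem[OF \<xi>(2) g])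

text \<open>The factor \<open>\<mu> powr - \<epsilon>\<close> makes the map \<open>g \<mapsto> conv g\<close> small in norms weighted with \<open>exp (\<mu> * t)\<close>; this
  replaces a singular Gronwall inequality.\<close>

lemma conv_weighted_bound:
  assumes \<xi>: "\<xi> < 1"
  obtains C where "0 < C" "\<And>g G G' \<mu> t. forcing \<xi> G' g \<Longrightarrow> 0 \<le> G \<Longrightarrow> 0 < \<mu> \<Longrightarrow>
      \<forall>s\<in>{0<..T}. norm (g s) \<le> G * s powr - \<xi> * exp (\<mu> * s) \<Longrightarrow> 0 < t \<Longrightarrow> t \<le> T \<Longrightarrow>
      conv g t \<in> carr X \<and> nrm X (conv g t) \<le> C * G * \<mu> powr - ((1 - \<alpha>) / 3) * exp (\<mu> * t) * t powr - \<xi>"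
proof -
  \<comment> \<open>Here \<open>\<beta> = \<alpha> + \<epsilon>\<close>, and
    \<open>\<beta> + \<epsilon> = (2 + \<alpha>) / 3\<close> stays below 1. One third of the gap
    above \<open>\<alpha>\<close> pays for membership in \<open>X\<close>, one third for the factor
    \<open>\<mu> powr - \<epsilon>\<close>, and one third keeps the kernel integrable.\<close>
  define \<epsilon> where "\<epsilon> = (1 - \<alpha>) / 3"
  define \<beta> where "\<beta> = (1 + 2 * \<alpha>) / 3"
  have e: "0 < \<epsilon>" "\<epsilon> < 1" "\<alpha> < \<beta>" "\<beta> \<le> 1" "0 \<le> \<beta>" "\<beta> + \<epsilon> < 1"
    using \<alpha>_ge0 \<alpha>_less1 unfolding \<epsilon>_def \<beta>_def by (auto simp: field_simps)
  obtain k where k: "0 < k" "\<And>w N. decay \<beta> N w \<Longrightarrow> w \<in> carr X" "\<And>w N \<tau>. decay \<beta> N w \<Longrightarrow> 0 < \<tau> \<Longrightarrow> \<tau> \<le> T \<Longrightarrow>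
      nrm X w \<le> k * (\<tau> powr - \<alpha> * norm w + N * \<tau> powr (\<beta> - \<alpha>))"
    by (rule nrm_le_decay[OF e(3,4)]) (rule that)
  define B1 where "B1 = Beta (1 - \<xi>) (1 - \<epsilon>)"
  define B2 where "B2 = Beta (1 - \<xi>) (1 - (\<beta> + \<epsilon>))"
  have B: "0 < B1" "0 < B2" unfolding B1_def B2_def using \<xi> e by (auto intro!: Beta_real_pos)
  define C where "C = k * (T powr - \<alpha> * (M * B1 * T powr (1 - \<epsilon>)) + (M * B2 * T powr (1 - (\<beta> + \<epsilon>))) * T powr (\<beta> - \<alpha>))"
  have C: "0 < C"
    unfolding C_def using k(1) B M_pos T_pos by (intro mult_pos_pos add_pos_pos) auto
  have "conv g t \<in> carr X \<and> nrm X (conv g t) \<le> C * G * \<mu> powr - \<epsilon> * exp (\<mu> * t) * t powr - \<xi>"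
    if g: "forcing \<xi> G' g" and G: "0 \<le> G" and \<mu>: "0 < \<mu>"
      and bound: "\<forall>s\<in>{0<..T}. norm (g s) \<le> G * s powr - \<xi> * exp (\<mu> * s)"
      and t: "0 < t" "t \<le> T" for g G G' \<mu> t
  proof
    define W where "W = G * \<mu> powr - \<epsilon> * exp (\<mu> * t)"
    have W: "0 \<le> W" using G by (simp add: W_def)
    have gW: "norm (g s) \<le> W * ((t - s) powr - \<epsilon> * s powr - \<xi>)" if "0 < s" "s < t" for s
      using bspec[OF bound, of s] weighted_kernel_le[OF G \<mu> e(1,2) that, of \<xi>] that t by (simp add: W_def)
    have n: "norm (conv g t) \<le> M * W * B1 * t powr (1 - \<epsilon> - \<xi>)"
      unfolding conv_def B1_def
    proof (rule norm_integral_beta_kernel_le[OF _ e(2) \<xi> t(1)])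
      show "(\<lambda>s. S (t - s) (g s)) integrable_on {0..t}"
        using conv_integrable[OF g \<xi> _ t(2), of 0] t T_pos by simp
      show "norm (S (t - s) (g s)) \<le> M * W * ((t - s) powr - \<epsilon> * s powr - \<xi>)" if s: "0 < s" "s < t" for s
      proof -
        have "norm (S (t - s) (g s)) \<le> M * norm (g s)" using S_bound[of "t - s"] s t by simp
        also have "\<dots> \<le> M * (W * ((t - s) powr - \<epsilon> * s powr - \<xi>))"
          using gW[OF s] M_pos by (intro mult_left_mono) auto
        finally show ?thesis by (simp add: mult.assoc)
      qed
    qed
    have d: "decay \<beta> (M * W * B2 * t powr (1 - (\<beta> + \<epsilon>) - \<xi>)) (conv g t)"
      unfolding B2_def
    proof (rule decay_conv_kernel[OF g \<xi> t e(6)])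
      fix s \<sigma> assume s: "0 < s" "s < t" and \<sigma>: "0 < \<sigma>" "\<sigma> \<le> T"
      have "norm (A (S (\<sigma> + (t - s)) (g s))) \<le> M * (\<sigma> + (t - s)) powr (- 1) * norm (g s)"
        using AS_bound[of "\<sigma> + (t - s)" "g s"] s \<sigma> t by simp
      also have "\<dots> \<le> M * (\<sigma> powr (\<beta> - 1) * (t - s) powr - \<beta>) * (W * ((t - s) powr - \<epsilon> * s powr - \<xi>))"
      proof (intro mult_mono gW s)
        have "(\<sigma> + (t - s)) powr ((\<beta> - 1) + - \<beta>) \<le> \<sigma> powr (\<beta> - 1) * (t - s) powr - \<beta>"
          using s \<sigma> e by (intro powr_add_le) auto
        then show "(\<sigma> + (t - s)) powr (- 1) \<le> \<sigma> powr (\<beta> - 1) * (t - s) powr - \<beta>" by simp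
      qed (use M_pos in auto)
      also have "\<dots> = M * W * \<sigma> powr (\<beta> - 1) * (((t - s) powr - \<beta> * (t - s) powr - \<epsilon>) * s powr - \<xi>)"
        by (simp only: mult_ac)
      also have "(t - s) powr - \<beta> * (t - s) powr - \<epsilon> = (t - s) powr - (\<beta> + \<epsilon>)"
        by (simp flip: powr_add)
      finally show "norm (A (S (\<sigma> + (t - s)) (g s))) \<le> M * W * \<sigma> powr (\<beta> - 1) * ((t - s) powr - (\<beta> + \<epsilon>) * s powr - \<xi>)" .
    qed
    show "conv g t \<in> carr X" by (rule k(2)[OF d])
    \<comment> \<open>Surplus positive powers of \<open>t\<close> are absorbed into powers of
      \<open>T\<close>, so that the singular weight \<open>t powr - \<xi>\<close> of the forcing is
      reproduced by the bound.\<close>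
    have split: "t powr (p - \<xi>) \<le> T powr p * t powr - \<xi>" if "0 \<le> p" for p
    proof -
      have "t powr (p + - \<xi>) = t powr p * t powr - \<xi>" by (rule powr_add)
      also have "\<dots> \<le> T powr p * t powr - \<xi>"
        using that t by (intro mult_right_mono powr_mono2) auto
      finally show ?thesis by simp
    qed
    have "nrm X (conv g t) \<le> k * (T powr - \<alpha> * norm (conv g t) + (M * W * B2 * t powr (1 - (\<beta> + \<epsilon>) - \<xi>)) * T powr (\<beta> - \<alpha>))"
      using k(3)[OF d T_pos order_refl] .
    also have "\<dots> \<le> k * (T powr - \<alpha> * (M * W * B1 * (T powr (1 - \<epsilon>) * t powr - \<xi>)) +
        (M * W * B2 * (T powr (1 - (\<beta> + \<epsilon>)) * t powr - \<xi>)) * T powr (\<beta> - \<alpha>))"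
    proof (intro mult_left_mono mult_right_mono add_mono)
      show "norm (conv g t) \<le> M * W * B1 * (T powr (1 - \<epsilon>) * t powr - \<xi>)"
        by (rule order_trans[OF n]) (use split[of "1 - \<epsilon>"] e M_pos W B in \<open>auto intro!: mult_left_mono\<close>)
      show "t powr (1 - (\<beta> + \<epsilon>) - \<xi>) \<le> T powr (1 - (\<beta> + \<epsilon>)) * t powr - \<xi>"
        by (rule split) (use e in simp)
    qed (use M_pos W B k(1) in auto)
    also have "\<dots> = C * W * t powr - \<xi>" by (simp add: C_def algebra_simps)
    finally show "nrm X (conv g t) \<le> C * G * \<mu> powr - \<epsilon> * exp (\<mu> * t) * t powr - \<xi>"
      by (simp add: W_def mult_ac)
  qed
  with C show ?thesis unfolding \<epsilon>_def by (rule that)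
qed

end

section \<open>Existence of mild solutions\<close>

lemma diagonal_convergent:
  fixes x :: "nat \<Rightarrow> nat \<Rightarrow> 'a::topological_space"
  assumes "\<And>i (r :: nat \<Rightarrow> nat). strict_mono r \<Longrightarrow> \<exists>r'. strict_mono r' \<and> convergent (\<lambda>n. x i (r (r' n)))"
  shows "\<exists>r. strict_mono r \<and> (\<forall>i. convergent (\<lambda>n. x i (r n)))"
proof -
  interpret subseqs "\<lambda>i s. convergent (\<lambda>n. x i (s n))"
    by unfold_locales (unfold o_def, rule assms)
  have "convergent (\<lambda>n. x i (diagseq n))" for i
  proof -
    have "convergent (\<lambda>n. x i ((diagseq \<circ> ((+) (Suc i))) n))"
    proof (rule diagseq_holds)
      fix r s n assume "strict_mono (r :: nat \<Rightarrow> nat)" "convergent (\<lambda>na. x n (s na))"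
      then show "convergent (\<lambda>na. x n ((s \<circ> r) na))"
        using convergent_subseq_convergent[of "\<lambda>na. x n (s na)" r] by (simp add: o_def)
    qed
    then have "convergent (\<lambda>n. x i (diagseq (n + Suc i)))"
      by (simp add: add.commute)
    then show ?thesis
      using convergent_ignore_initial_segment[of "\<lambda>n. x i (diagseq n)" "Suc i"] by simp
  qed
  then show ?thesis using subseq_diagseq by blast
qed

text \<open>Existence rests on joint continuity, linear growth and compactness. Here
  \<open>\<alpha>\<close> stands for the index of the space in which \<open>f\<close> takes its
  argument, and \<open>f\<close> is regarded as a map into \<open>E_0\<close>;
  \<open>graph_compact\<close> is the sequential form of the compact embedding of the
  domain.\<close>

locale semilinear_problem = smoothing_space +
  fixes f :: "real \<Rightarrow> 'a \<Rightarrow> 'a" and C :: real and u0 :: 'a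
  assumes \<alpha>_pos: "0 < \<alpha>" and C_pos: "0 < C"
    and f_continuous: "continuous_map (prod_topology (top_of_set {0<..T}) (ntop X)) euclidean (\<lambda>(t, u). f t u)"
    and f_growth: "\<And>t u. 0 < t \<Longrightarrow> t \<le> T \<Longrightarrow> u \<in> carr X \<Longrightarrow> norm (f t u) \<le> C * (1 + nrm X u)"
    and graph_compact: "\<And>(s :: nat \<Rightarrow> 'a) R. (\<And>n. s n \<in> Dom) \<Longrightarrow> (\<And>n. norm (s n) + norm (A (s n)) \<le> R) \<Longrightarrow>
      \<exists>r. strict_mono r \<and> convergent (\<lambda>n. s (r n))"
begin

lemma superposition_continuous:
  assumes U: "continuous_map (top_of_set I) (ntop X) U" and p: "continuous_on I p" "p ` I \<subseteq> {0<..T}"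
  shows "continuous_on I (\<lambda>s :: real. f (p s) (U s))"
proof -
  have "continuous_map (top_of_set I) (prod_topology (top_of_set {0<..T}) (ntop X)) (\<lambda>s. (p s, U s))"
    using p U by (intro continuous_map_pairedI) (auto simp: continuous_map_in_subtopology)
  from continuous_map_compose[OF this f_continuous] show ?thesis
    by (simp add: o_def)
qed

lemma superposition_tendsto:
  assumes U: "\<And>n. U n \<in> carr X" "u \<in> carr X" "((\<lambda>n. nrm X (U n - u)) \<longlongrightarrow> 0) G" and s: "0 < s" "s \<le> T"
  shows "((\<lambda>n. f s (U n)) \<longlongrightarrow> f s u) G"
proof -
  have "continuous_map (ntop X) (prod_topology (top_of_set {0<..T}) (ntop X)) (\<lambda>v. (s, v))"
    using s by (intro continuous_map_pairedI) auto
  from continuous_map_compose[OF this f_continuous] have "continuous_map (ntop X) euclidean (f s)"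
    by (simp add: o_def)
  moreover have "limitin (ntop X) U u G" using limitin_ntop[where s = U, OF U(1)] U by simp
  ultimately show ?thesis
    using continuous_map_limit by (fastforce simp: o_def)
qed

text \<open>The argument of \<open>f\<close> is delayed by \<open>h\<close>, and the forcing is switched on continuously on \<open>{2 * h..3 * h}\<close>,
  where the delayed time is comparable to \<open>s\<close>.\<close>

definition delayed :: "real \<Rightarrow> (real \<Rightarrow> 'a) \<Rightarrow> real \<Rightarrow> 'a" where
  "delayed h U s = max 0 (min 1 ((s - 2 * h) / h)) *\<^sub>R f s (U (max h (s - h)))"

text \<open>A weighted ball that the delayed equations leave invariant. Its weight joins the
  singularity of \<open>S t u0\<close> at 0 with the exponential factor that makes the convolution
  small.\<close>

definition admissible :: "real \<Rightarrow> real \<Rightarrow> (real \<Rightarrow> 'a) \<Rightarrow> bool" where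
  "admissible \<mu> M1 U \<longleftrightarrow> continuous_map (top_of_set {0<..T}) (ntop X) U \<and>
     (\<forall>t\<in>{0<..T}. nrm X (U t) \<le> M1 * t powr - \<alpha> * exp (\<mu> * t))"

lemma admissible_mem: "admissible \<mu> M1 U \<Longrightarrow> 0 < t \<Longrightarrow> t \<le> T \<Longrightarrow> U t \<in> carr X"
  by (auto simp: admissible_def continuous_map_ntop_iff)

text \<open>The forcing vanishes up to \<open>2 * h\<close>, and afterwards
  \<open>s - h \<ge> s / 2\<close>; the delayed singularity is therefore at most
  \<open>2 powr \<alpha> \<le> 2\<close> times \<open>s powr - \<alpha>\<close>, uniformly in
  \<open>h\<close>. The constant 1 from linear growth is absorbed by
  \<open>T powr \<alpha> * s powr - \<alpha>\<close>.\<close>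

lemma delayed_bound:
  assumes U: "admissible \<mu> M1 U" and \<mu>: "0 \<le> \<mu>" and M1: "0 \<le> M1" and h: "0 < h" "h \<le> T" and s: "0 < s" "s \<le> T"
  shows "norm (delayed h U s) \<le> C * (T powr \<alpha> + 2 * M1) * s powr - \<alpha> * exp (\<mu> * s)"
proof (cases "s \<le> 2 * h")
  case True
  then have "delayed h U s = 0" using h by (simp add: delayed_def divide_le_0_iff)
  then show ?thesis using C_pos M1 T_pos by simp
next
  case False
  then have sh: "max h (s - h) = s - h" "0 < s - h" "s / 2 \<le> s - h" using h by auto
  have "norm (delayed h U s) \<le> 1 * norm (f s (U (s - h)))"
    unfolding delayed_def norm_scaleR sh(1) by (rule mult_right_mono) auto
  also have "\<dots> \<le> C * (1 + nrm X (U (s - h)))"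
    using f_growth[OF s admissible_mem[OF U sh(2)]] s h by simp
  also have "\<dots> \<le> C * (T powr \<alpha> * (s powr - \<alpha> * exp (\<mu> * s)) + 2 * M1 * (s powr - \<alpha> * exp (\<mu> * s)))"
  proof (intro mult_left_mono add_mono)
    have "1 \<le> T powr \<alpha> * s powr - \<alpha>"
      using powr_mono2[of \<alpha> s T] s \<alpha>_pos by (simp add: powr_minus divide_simps)
    also have "\<dots> \<le> T powr \<alpha> * s powr - \<alpha> * exp (\<mu> * s)"
      using mult_left_mono[of 1 "exp (\<mu> * s)" "T powr \<alpha> * s powr - \<alpha>"] \<mu> s by simp
    finally show "1 \<le> T powr \<alpha> * (s powr - \<alpha> * exp (\<mu> * s))" by (simp add: mult.assoc)
    have "nrm X (U (s - h)) \<le> M1 * (s - h) powr - \<alpha> * exp (\<mu> * (s - h))"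
      using U s sh h by (simp add: admissible_def)
    also have "\<dots> \<le> M1 * (2 * s powr - \<alpha>) * exp (\<mu> * s)"
    proof (intro mult_mono)
      have "(s - h) powr - \<alpha> \<le> (s / 2) powr - \<alpha>"
        using sh s \<alpha>_pos by (intro powr_mono2') auto
      also have "\<dots> = 2 powr \<alpha> * s powr - \<alpha>"
        using s by (simp add: powr_divide powr_minus divide_simps)
      also have "\<dots> \<le> 2 * s powr - \<alpha>"
        using powr_mono[of \<alpha> 1 2] \<alpha>_less1 by (intro mult_right_mono) auto
      finally show "(s - h) powr - \<alpha> \<le> 2 * s powr - \<alpha>" .
    qed (use M1 \<mu> h in \<open>auto intro: mult_left_mono\<close>)
    finally show "nrm X (U (s - h)) \<le> 2 * M1 * (s powr - \<alpha> * exp (\<mu> * s))"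
      by (simp add: mult_ac)
  qed (use C_pos in auto)
  finally show ?thesis by (simp add: algebra_simps)
qed

lemma delayed_forcing:
  assumes U: "admissible \<mu> M1 U" and \<mu>: "0 \<le> \<mu>" and M1: "0 \<le> M1" and h: "0 < h" "h \<le> T"
  shows "forcing \<alpha> (C * (T powr \<alpha> + 2 * M1) * exp (\<mu> * T)) (delayed h U)"
  unfolding forcing_def
proof
  have p: "continuous_on {0<..T} (\<lambda>s. max h (s - h))" "(\<lambda>s. max h (s - h)) ` {0<..T} \<subseteq> {0<..T}"
    using h by (auto intro!: continuous_intros)
  have "continuous_map (top_of_set {0<..T}) (top_of_set {0<..T}) (\<lambda>s. max h (s - h))"
    using p by (auto simp: continuous_map_in_subtopology)
  moreover have "continuous_map (top_of_set {0<..T}) (ntop X) U" using U by (simp add: admissible_def)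
  ultimately have "continuous_map (top_of_set {0<..T}) (ntop X) (U \<circ> (\<lambda>s. max h (s - h)))"
    by (rule continuous_map_compose)
  then have "continuous_on {0<..T} (\<lambda>s. f s (U (max h (s - h))))"
    using superposition_continuous[of "{0<..T}" "U \<circ> (\<lambda>s. max h (s - h))" "\<lambda>s. s"] by (simp add: continuous_on_id)
  moreover have "continuous_on {0<..T} (\<lambda>s. max 0 (min 1 ((s - 2 * h) / h)))"
    using h by (intro continuous_intros) auto
  ultimately show "continuous_on {0<..T} (delayed h U)"
    unfolding delayed_def[abs_def] by (intro continuous_on_scaleR)
  show "\<forall>s\<in>{0<..T}. norm (delayed h U s) \<le> C * (T powr \<alpha> + 2 * M1) * exp (\<mu> * T) * s powr - \<alpha>"
  proof
    fix s assume s: "s \<in> {0<..T}"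
    have "norm (delayed h U s) \<le> C * (T powr \<alpha> + 2 * M1) * s powr - \<alpha> * exp (\<mu> * s)"
      using delayed_bound[OF assms] s by simp
    also have "\<dots> \<le> C * (T powr \<alpha> + 2 * M1) * s powr - \<alpha> * exp (\<mu> * T)"
      using s \<mu> C_pos M1 T_pos by (intro mult_left_mono) (auto intro: mult_left_mono)
    finally show "norm (delayed h U s) \<le> C * (T powr \<alpha> + 2 * M1) * exp (\<mu> * T) * s powr - \<alpha>"
      by (simp add: mult_ac)
  qed
qed

lemma forcing_zero: "forcing \<alpha> 0 (\<lambda>_. 0)"
  by (simp add: forcing_def)

text \<open>The constant \<open>\<mu>\<close> is taken so large that \<open>M1\<close> returns
  through the convolution with a factor at most 1/2; the other half of \<open>M1\<close> is then
  defined to cover the initial value and the constant part of the growth bound. Neither constant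
  depends on \<open>h\<close>.\<close>

lemma admissible_constants:
  obtains \<mu> M1 where "0 \<le> \<mu>" "0 \<le> M1" "admissible \<mu> M1 (mild u0 (\<lambda>_. 0))"
    "\<And>h U. 0 < h \<Longrightarrow> h \<le> T \<Longrightarrow> admissible \<mu> M1 U \<Longrightarrow> admissible \<mu> M1 (mild u0 (delayed h U))"
proof -
  define \<epsilon> where "\<epsilon> = (1 - \<alpha>) / 3"
  have \<epsilon>: "0 < \<epsilon>" using \<alpha>_less1 by (simp add: \<epsilon>_def)
  obtain C2 where C2: "0 < C2" and conv: "\<And>g G G' \<mu> t. forcing \<alpha> G' g \<Longrightarrow> 0 \<le> G \<Longrightarrow> 0 < \<mu> \<Longrightarrow>
      \<forall>s\<in>{0<..T}. norm (g s) \<le> G * s powr - \<alpha> * exp (\<mu> * s) \<Longrightarrow> 0 < t \<Longrightarrow> t \<le> T \<Longrightarrow>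
      conv g t \<in> carr X \<and> nrm X (conv g t) \<le> C2 * G * \<mu> powr - \<epsilon> * exp (\<mu> * t) * t powr - \<alpha>"
    by (rule conv_weighted_bound[OF \<alpha>_less1, folded \<epsilon>_def]) (rule that)
  \<comment> \<open>Chosen so that \<open>C2 * C * (2 * M1) * \<mu> powr - \<epsilon>\<close> equals
    \<open>b * \<mu> powr - \<epsilon>\<close> times \<open>M1 / 2\<close>.\<close>
  define b where "b = 4 * C2 * C"
  have b: "0 < b" using C2 C_pos by (simp add: b_def)
  define \<mu> where "\<mu> = max 1 (b powr (1 / \<epsilon>))"
  have \<mu>: "1 \<le> \<mu>" by (simp add: \<mu>_def)
  have small1: "\<mu> powr - \<epsilon> \<le> 1" using \<mu> \<epsilon> powr_mono[of "- \<epsilon>" 0 \<mu>] by simp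
  have small: "b * \<mu> powr - \<epsilon> \<le> 1"
  proof -
    have "b = (b powr (1 / \<epsilon>)) powr \<epsilon>" using b \<epsilon> by (simp add: powr_powr)
    also have "\<dots> \<le> \<mu> powr \<epsilon>" using \<epsilon> by (intro powr_mono2) (auto simp: \<mu>_def)
    finally show ?thesis using \<mu> by (simp add: powr_minus divide_simps)
  qed
  define M1 where "M1 = 2 * (c * norm u0 + C2 * C * T powr \<alpha>)"
  have M1_half: "M1 / 2 = c * norm u0 + C2 * C * T powr \<alpha>" by (simp add: M1_def)
  have M1: "0 \<le> M1" using c_pos C2 C_pos by (simp add: M1_def)
  have adm: "admissible \<mu> M1 (mild u0 g)"
    if g: "forcing \<alpha> G' g" and bound: "\<And>s. 0 < s \<Longrightarrow> s \<le> T \<Longrightarrow> norm (g s) \<le> C * (T powr \<alpha> + 2 * M1) * s powr - \<alpha> * exp (\<mu> * s)"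
    for g G'
    unfolding admissible_def
  proof (intro conjI ballI)
    show "continuous_map (top_of_set {0<..T}) (ntop X) (mild u0 g)"
      using \<alpha>_pos by (intro mild_continuous[OF _ \<alpha>_less1 g]) simp
    fix t assume "t \<in> {0<..T}"
    then have t: "0 < t" "t \<le> T" by auto
    have t': "t \<le> 2 * T" using t T_pos by simp
    have cv: "conv g t \<in> carr X \<and> nrm X (conv g t) \<le> C2 * (C * (T powr \<alpha> + 2 * M1)) * \<mu> powr - \<epsilon> * exp (\<mu> * t) * t powr - \<alpha>"
      using \<mu> C_pos M1 bound by (intro conv[OF g _ _ _ t]) auto
    have "nrm X (mild u0 g t) \<le> nrm X (S t u0) + nrm X (conv g t)"
      unfolding mild_def using cv S_mem[OF t(1) t'] by (intro nrm_triangle) auto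
    also have "\<dots> \<le> (c * norm u0) * (t powr - \<alpha> * exp (\<mu> * t))
        + (C2 * (C * (T powr \<alpha> + 2 * M1)) * \<mu> powr - \<epsilon>) * (t powr - \<alpha> * exp (\<mu> * t))"
    proof (rule add_mono)
      have "nrm X (S t u0) \<le> (c * t powr - \<alpha> * norm u0) * 1" using S_smooth[OF t(1) t', of u0] by simp
      also have "\<dots> \<le> (c * t powr - \<alpha> * norm u0) * exp (\<mu> * t)"
        using c_pos \<mu> t by (intro mult_left_mono) auto
      finally show "nrm X (S t u0) \<le> (c * norm u0) * (t powr - \<alpha> * exp (\<mu> * t))" by (simp add: mult_ac)
      show "nrm X (conv g t) \<le> (C2 * (C * (T powr \<alpha> + 2 * M1)) * \<mu> powr - \<epsilon>) * (t powr - \<alpha> * exp (\<mu> * t))"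
        using cv by (simp add: mult_ac)
    qed
    also have "\<dots> = (c * norm u0 + C2 * (C * (T powr \<alpha> + 2 * M1)) * \<mu> powr - \<epsilon>) * (t powr - \<alpha> * exp (\<mu> * t))"
      by (simp add: distrib_right)
    also have "\<dots> \<le> M1 * (t powr - \<alpha> * exp (\<mu> * t))"
    proof (rule mult_right_mono)
      have "C2 * (C * (T powr \<alpha> + 2 * M1)) * \<mu> powr - \<epsilon> = C2 * C * T powr \<alpha> * \<mu> powr - \<epsilon> + (b * \<mu> powr - \<epsilon>) * (M1 / 2)"
        by (simp add: b_def algebra_simps)
      also have "\<dots> \<le> C2 * C * T powr \<alpha> * 1 + 1 * (M1 / 2)"
        using small small1 C2 C_pos M1 by (intro add_mono mult_left_mono mult_right_mono) auto
      finally show "c * norm u0 + C2 * (C * (T powr \<alpha> + 2 * M1)) * \<mu> powr - \<epsilon> \<le> M1"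
        using M1_half by linarith
    qed simp
    finally show "nrm X (mild u0 g t) \<le> M1 * t powr - \<alpha> * exp (\<mu> * t)" by (simp add: mult.assoc)
  qed
  show ?thesis
  proof (rule that[of \<mu> M1])
    show "admissible \<mu> M1 (mild u0 (\<lambda>_. 0))"
      using C_pos M1 T_pos by (intro adm[OF forcing_zero]) auto
    show "admissible \<mu> M1 (mild u0 (delayed h U))" if h: "0 < h" "h \<le> T" and U: "admissible \<mu> M1 U" for h U
    proof -
      have \<mu>0: "0 \<le> \<mu>" using \<mu> by simp
      show ?thesis
        by (rule adm[OF delayed_forcing[OF U \<mu>0 M1 h] delayed_bound[OF U \<mu>0 M1 h]])
    qed
  qed (use \<mu> M1 in auto)
qed

text \<open>The method of steps. At time \<open>s\<close> the delayed forcing sees \<open>U\<close>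
  no later than \<open>s - h\<close> whenever it is nonzero, so each iteration settles one more
  interval of length \<open>h\<close>; a fixed point is reached without any contraction.\<close>

lemma delayed_solution:
  assumes adm0: "admissible \<mu> M1 (mild u0 (\<lambda>_. 0))"
    and adm: "\<And>U. admissible \<mu> M1 U \<Longrightarrow> admissible \<mu> M1 (mild u0 (delayed h U))"
    and h: "0 < h"
  shows "\<exists>w. admissible \<mu> M1 w \<and> (\<forall>t\<in>{0..T}. w t = mild u0 (delayed h w) t)"
proof -
  define U where "U k = ((\<lambda>U. mild u0 (delayed h U)) ^^ k) (mild u0 (\<lambda>_. 0))" for k
  have U0: "U 0 = mild u0 (\<lambda>_. 0)" and US: "U (Suc k) = mild u0 (delayed h (U k))" for k
    by (simp_all add: U_def)
  have U: "admissible \<mu> M1 (U k)" for k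
    by (induction k) (auto simp: U0 US adm0 adm)
  \<comment> \<open>the delay makes the iteration stationary after finitely many steps\<close>
  have stat: "U (Suc k) t = U k t" if "t \<le> real (Suc k) * h" for k t
    using that
  proof (induction k arbitrary: t)
    case 0
    have "delayed h (mild u0 (\<lambda>_. 0)) s = 0" if "s \<le> t" for s
    proof -
      have "(s - 2 * h) / h \<le> 0" using that 0 h by (simp add: divide_le_0_iff)
      then show ?thesis by (simp add: delayed_def)
    qed
    then have "conv (delayed h (mild u0 (\<lambda>_. 0))) t = conv (\<lambda>_. 0) t" by (intro conv_cong) auto
    then show ?case by (simp add: U0 US mild_def)
  next
    case (Suc k)
    have "delayed h (U (Suc k)) s = delayed h (U k) s" if s: "s \<le> t" for s
    proof (cases "s \<le> 2 * h")
      case True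
      then have "(s - 2 * h) / h \<le> 0" using h by (simp add: divide_le_0_iff)
      then show ?thesis by (simp add: delayed_def)
    next
      case False
      then have "max h (s - h) = s - h" by simp
      moreover have "s - h \<le> real (Suc k) * h" using s Suc.prems by (simp add: algebra_simps)
      ultimately show ?thesis using Suc.IH[of "s - h"] by (simp add: delayed_def)
    qed
    then have "conv (delayed h (U (Suc k))) t = conv (delayed h (U k)) t" by (intro conv_cong) auto
    then show ?case by (simp add: US[of "Suc k"] US[of k] mild_def)
  qed
  obtain k where k: "T / h \<le> real k" using real_arch_simple by blast
  have "U k t = mild u0 (delayed h (U k)) t" if "t \<in> {0..T}" for t
  proof -
    have "t \<le> real k * h" using that k h by (simp add: divide_le_eq)
    also have "\<dots> \<le> real (Suc k) * h" using h by simp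
    finally show ?thesis using stat[of t k] by (simp add: US)
  qed
  with U show ?thesis by blast
qed

lemma mild_bounded:
  assumes g: "forcing \<alpha> G g" and t: "0 \<le> t" "t \<le> T"
  shows "norm (mild u0 g t) \<le> M * norm u0 + M * G * Beta (1 - \<alpha>) 1 * T powr (1 - \<alpha>)"
proof -
  have B: "0 < Beta (1 - \<alpha>) 1" using \<alpha>_less1 by (intro Beta_real_pos) auto
  have "norm (conv g t) \<le> M * G * Beta (1 - \<alpha>) 1 * T powr (1 - \<alpha>)"
  proof (cases "t = 0")
    case True
    then show ?thesis using M_pos forcing_nonneg[OF g] B by (simp add: conv_def)
  next
    case False
    then have "norm (conv g t) \<le> M * G * Beta (1 - \<alpha>) 1 * t powr (1 - \<alpha>)"
      using t by (intro norm_conv_le[OF g \<alpha>_less1]) auto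
    also have "\<dots> \<le> M * G * Beta (1 - \<alpha>) 1 * T powr (1 - \<alpha>)"
      using t M_pos forcing_nonneg[OF g] B \<alpha>_less1 by (intro mult_left_mono powr_mono2) auto
    finally show ?thesis .
  qed
  moreover have "norm (S t u0) \<le> M * norm u0" using S_bound[of t u0] t T_pos by simp
  ultimately show ?thesis unfolding mild_def by (intro norm_triangle_le) simp
qed

text \<open>Compactness is used only for the vectors \<open>S (\<tau> j) (w n q)\<close> with \<open>q\<close> rational; uniform decay and
  equicontinuity give the rest.\<close>

lemma mild_convergent_subsequence:
  fixes g :: "nat \<Rightarrow> real \<Rightarrow> 'a"
  assumes g: "\<And>n. forcing \<alpha> G (g n)"
  obtains r where "strict_mono r" "\<And>t. 0 < t \<Longrightarrow> t \<le> T \<Longrightarrow> convergent (\<lambda>n. mild u0 (g (r n)) t)"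
proof -
  define w where "w n t = mild u0 (g n) t" for n t
  define R where "R = M * norm u0 + M * G * Beta (1 - \<alpha>) 1 * T powr (1 - \<alpha>)"
  have R: "norm (w n t) \<le> R" if "0 \<le> t" "t \<le> T" for n t
    unfolding w_def R_def by (rule mild_bounded[OF g that])
  define \<tau> where "\<tau> j = T / (real j + 1)" for j
  have \<tau>: "0 < \<tau> j" "\<tau> j \<le> T" for j using T_pos by (auto simp: \<tau>_def field_simps)
  \<comment> \<open>All pairs \<open>(j, q)\<close> are enumerated in one sequence for the diagonal
    argument; pairs with \<open>q\<close> outside the time interval receive the constant
    \<open>S (\<tau> j) 0\<close>, which converges trivially.\<close>
  define x :: "nat \<Rightarrow> nat \<Rightarrow> 'a" where "x i n = (let (j, q) = (from_nat i :: nat \<times> rat) in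
      if 0 < q \<and> of_rat q \<le> T then S (\<tau> j) (w n (of_rat q)) else S (\<tau> j) 0)" for i n
  have "\<exists>r'. strict_mono r' \<and> convergent (\<lambda>n. x i (r (r' n)))" for i and r :: "nat \<Rightarrow> nat"
  proof -
    obtain j q where jq: "(from_nat i :: nat \<times> rat) = (j, q)" by fastforce
    obtain y where y: "\<And>n. x i n = S (\<tau> j) (y n)" "\<And>n. norm (y n) \<le> \<bar>R\<bar>"
    proof
      define y where "y n = (if 0 < q \<and> of_rat q \<le> T then w n (of_rat q) else 0)" for n
      show "x i n = S (\<tau> j) (y n)" for n by (simp add: x_def jq y_def)
      show "norm (y n) \<le> \<bar>R\<bar>" for n
        using R[of "of_rat q" n] by (auto simp: y_def zero_less_of_rat_iff intro: order_trans)
    qed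
    have t2: "\<tau> j \<le> 2 * T" using \<tau>(2)[of j] T_pos by simp
    have "norm (x i n) + norm (A (x i n)) \<le> M * \<bar>R\<bar> + M / \<tau> j * \<bar>R\<bar>" for n
      unfolding y(1)
    proof (rule add_mono)
      show "norm (S (\<tau> j) (y n)) \<le> M * \<bar>R\<bar>"
        using S_bound[OF less_imp_le[OF \<tau>(1)] t2, of "y n"] y(2)[of n] M_pos
        by (meson less_imp_le mult_left_mono order_trans)
      have "norm (A (S (\<tau> j) (y n))) \<le> M / \<tau> j * norm (y n)" by (rule AS_bound[OF \<tau>(1) t2])
      also have "\<dots> \<le> M / \<tau> j * \<bar>R\<bar>"
        using y(2)[of n] M_pos \<tau>(1)[of j] by (intro mult_left_mono) auto
      finally show "norm (A (S (\<tau> j) (y n))) \<le> M / \<tau> j * \<bar>R\<bar>" .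
    qed
    moreover have "x i n \<in> Dom" for n unfolding y(1) by (rule S_mem_Dom[OF \<tau>(1)])
    ultimately show ?thesis
      using graph_compact[of "\<lambda>n. x i (r n)" "M * \<bar>R\<bar> + M / \<tau> j * \<bar>R\<bar>"] by blast
  qed
  then obtain r where r: "strict_mono r" and conv: "\<And>i. convergent (\<lambda>n. x i (r n))"
    using diagonal_convergent[of x] by blast
  have rational: "convergent (\<lambda>n. S (\<tau> j) (w (r n) (of_rat q)))" if q: "0 < q" "of_rat q \<le> T" for j q
    using conv[of "to_nat (j, q)"] q by (simp add: x_def)
  define \<beta> where "\<beta> = (\<alpha> + 1) / 2"
  have \<beta>: "0 < \<beta>" "\<beta> < 1" using \<alpha>_ge0 \<alpha>_less1 by (auto simp: \<beta>_def)
  have "convergent (\<lambda>n. mild u0 (g (r n)) t)" if t: "0 < t" "t \<le> T" for t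
  proof -
    have t2: "0 < t / 2" using t by simp
    obtain N where N: "\<And>g s. forcing \<alpha> G g \<Longrightarrow> t / 2 \<le> s \<Longrightarrow> s \<le> T \<Longrightarrow> decay \<beta> N (mild u0 g s)"
      using decay_mild[OF \<alpha>_less1 less_imp_le[OF \<beta>(1)] \<beta>(2) t2] by blast
    obtain H where H: "\<And>g t1 s. forcing \<alpha> G g \<Longrightarrow> t / 2 \<le> t1 \<Longrightarrow> t1 \<le> s \<Longrightarrow> s \<le> T \<Longrightarrow>
        norm (mild u0 g s - mild u0 g t1) \<le> H * (s - t1) powr \<beta>"
      using mild_hoelder[OF \<alpha>_ge0 \<alpha>_less1 \<beta> t2] by blast
    \<comment> \<open>Five errors of size \<open>e / 5\<close>: the shift from \<open>t\<close> to a
      rational \<open>q\<close> and the regularisation by \<open>S (\<tau> j)\<close>, each for two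
      indices, and the difference of the regularised vectors. Since \<open>H\<close> and
      \<open>N\<close> are uniform in the forcing, \<open>q\<close> and \<open>j\<close> can be
      fixed before the indices.\<close>
    have "Cauchy (\<lambda>n. w (r n) t)"
    proof (rule metric_CauchyI)
      fix e :: real assume e: "0 < e"
      have null: "((\<lambda>h. c * h powr \<beta>) \<longlongrightarrow> 0) (at_right 0)" for c :: real
      proof -
        have "((\<lambda>h::real. h powr \<beta>) \<longlongrightarrow> 0 powr \<beta>) (at_right 0)"
          using \<beta> by (intro tendsto_powr') (auto simp: eventually_at_filter)
        then show ?thesis by (auto intro: tendsto_mult_right_zero)
      qed
      have "\<forall>\<^sub>F h in at_right 0. \<bar>H\<bar> * h powr \<beta> < e / 5"
        using order_tendstoD(2)[OF null, of "e / 5" "\<bar>H\<bar>"] e by simp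
      then obtain d where d: "0 < d" "\<And>h. 0 < h \<Longrightarrow> h < d \<Longrightarrow> \<bar>H\<bar> * h powr \<beta> < e / 5"
        unfolding eventually_at_right_field by auto
      have "max (t / 2) (t - d) < t" using t d by auto
      then obtain q where q: "max (t / 2) (t - d) < of_rat q" "of_rat q < t"
        using of_rat_dense by blast
      have q0: "0 < q" using q t by (metis less_trans max_less_iff_conj t2 zero_less_of_rat_iff)
      have Hq: "norm (w n t - w n (of_rat q)) < e / 5" for n
      proof -
        have "norm (w n t - w n (of_rat q)) \<le> H * (t - of_rat q) powr \<beta>"
          unfolding w_def using q t by (intro H[OF g]) auto
        also have "\<dots> \<le> \<bar>H\<bar> * (t - of_rat q) powr \<beta>" by (intro mult_right_mono) auto
        also have "\<dots> < e / 5" using q by (intro d(2)) auto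
        finally show ?thesis .
      qed
      have "filterlim \<tau> (at_right 0) sequentially"
      proof -
        have "\<tau> \<longlonglongrightarrow> 0"
          unfolding \<tau>_def using tendsto_mult_right_zero[OF LIMSEQ_inverse_real_of_nat, of T]
          by (simp add: divide_inverse add.commute)
        moreover have "\<tau> n \<noteq> 0" for n using \<tau>(1)[of n] by simp
        ultimately show ?thesis using \<tau> by (auto simp: filterlim_at)
      qed
      from filterlim_compose[OF null this] have "(\<lambda>j. \<bar>N\<bar> / \<beta> * \<tau> j powr \<beta>) \<longlonglongrightarrow> 0" .
      then have "\<forall>\<^sub>F j in sequentially. \<bar>N\<bar> / \<beta> * \<tau> j powr \<beta> < e / 5"
        using order_tendstoD(2) e by (metis divide_pos_pos zero_less_numeral)
      then obtain j where j: "\<bar>N\<bar> / \<beta> * \<tau> j powr \<beta> < e / 5"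
        using eventually_happens'[OF sequentially_bot] by blast
      have Nq: "norm (S (\<tau> j) (w n (of_rat q)) - w n (of_rat q)) < e / 5" for n
      proof -
        have "norm (S (\<tau> j) (w n (of_rat q)) - w n (of_rat q)) \<le> N / \<beta> * \<tau> j powr \<beta>"
          unfolding w_def using q t by (intro norm_S_sub_le[OF N[OF g] \<beta>(1)] \<tau>) auto
        also have "\<dots> \<le> \<bar>N\<bar> / \<beta> * \<tau> j powr \<beta>"
          using \<beta> by (intro mult_right_mono divide_right_mono) auto
        finally show ?thesis using j by (rule le_less_trans)
      qed
      have "Cauchy (\<lambda>n. S (\<tau> j) (w (r n) (of_rat q)))"
        using rational[OF q0, of j] q t by (intro convergent_Cauchy) auto
      then obtain n0 where n0: "\<And>m n. n0 \<le> m \<Longrightarrow> n0 \<le> n \<Longrightarrow>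
          dist (S (\<tau> j) (w (r m) (of_rat q))) (S (\<tau> j) (w (r n) (of_rat q))) < e / 5"
        using e metric_CauchyD[of _ "e / 5"] by (metis divide_pos_pos zero_less_numeral)
      have "dist (w (r m) t) (w (r n) t) < e" if mn: "n0 \<le> m" "n0 \<le> n" for m n
      proof -
        have "w (r m) t - w (r n) t = (w (r m) t - w (r m) (of_rat q)) - (w (r n) t - w (r n) (of_rat q))
            - (S (\<tau> j) (w (r m) (of_rat q)) - w (r m) (of_rat q)) + (S (\<tau> j) (w (r n) (of_rat q)) - w (r n) (of_rat q))
            + (S (\<tau> j) (w (r m) (of_rat q)) - S (\<tau> j) (w (r n) (of_rat q)))"
          by simp
        also have "norm \<dots> \<le> norm (w (r m) t - w (r m) (of_rat q)) + norm (w (r n) t - w (r n) (of_rat q))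
            + norm (S (\<tau> j) (w (r m) (of_rat q)) - w (r m) (of_rat q)) + norm (S (\<tau> j) (w (r n) (of_rat q)) - w (r n) (of_rat q))
            + norm (S (\<tau> j) (w (r m) (of_rat q)) - S (\<tau> j) (w (r n) (of_rat q)))"
          by (intro norm_triangle_mono norm_triangle_le_diff add_mono order_refl)
        also have "\<dots> < e / 5 + e / 5 + e / 5 + e / 5 + e / 5"
          using n0[OF mn] by (intro add_strict_mono Hq Nq) (simp add: dist_norm)
        finally show ?thesis by (simp add: dist_norm)
      qed
      then show "\<exists>n0. \<forall>m\<ge>n0. \<forall>n\<ge>n0. dist (w (r m) t) (w (r n) t) < e" by blast
    qed
    then show ?thesis by (simp add: w_def Cauchy_convergent_iff)
  qed
  with r show ?thesis by (rule that)
qed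

section \<open>Passage to the limit in the delayed equations\<close>

lemma decay_limit:
  assumes w: "\<And>n. decay \<beta> N (w n)" and lim: "w \<longlonglongrightarrow> l"
  shows "decay \<beta> N l"
  unfolding decay_def
proof (intro allI impI)
  fix \<sigma> assume \<sigma>: "0 < \<sigma> \<and> \<sigma> \<le> T"
  have "(\<lambda>n. norm (A (S \<sigma> (w n)))) \<longlonglongrightarrow> norm (A (S \<sigma> l))"
    using \<sigma> by (intro tendsto_norm bounded_linear.tendsto[OF AS_linear lim]) auto
  then show "norm (A (S \<sigma> l)) \<le> N * \<sigma> powr (\<beta> - 1)"
    by (rule LIMSEQ_le_const2) (use decayD[OF w] \<sigma> in blast)
qed

text \<open>Uniform decay makes the second term of the interpolation inequality small for small
  \<open>\<tau>\<close>; with \<open>\<tau>\<close> fixed, ambient convergence disposes of the first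
  term.\<close>

lemma nrm_tendsto_of_decay:
  assumes \<beta>: "\<alpha> < \<beta>" "\<beta> \<le> 1" and w: "\<And>n. decay \<beta> N (w n)" and lim: "w \<longlonglongrightarrow> l"
  shows "(\<lambda>n. nrm X (w n - l)) \<longlonglongrightarrow> 0"
proof -
  obtain k where k: "0 < k" "\<And>w N. decay \<beta> N w \<Longrightarrow> w \<in> carr X" "\<And>w N \<tau>. decay \<beta> N w \<Longrightarrow> 0 < \<tau> \<Longrightarrow> \<tau> \<le> T \<Longrightarrow>
      nrm X w \<le> k * (\<tau> powr - \<alpha> * norm w + N * \<tau> powr (\<beta> - \<alpha>))"
    by (rule nrm_le_decay[OF \<beta>]) (rule that)
  have d: "decay \<beta> (N + N) (w n - l)" for n
    by (rule decay_diff[OF w decay_limit[OF w lim]])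
  have ge0: "0 \<le> nrm X (w n - l)" for n by (rule nrm_ge0[OF k(2)[OF d]])
  show ?thesis
  proof (rule LIMSEQ_I)
    fix e :: real assume e: "0 < e"
    have "((\<lambda>\<tau>::real. \<tau> powr (\<beta> - \<alpha>)) \<longlongrightarrow> 0 powr (\<beta> - \<alpha>)) (at_right 0)"
      using \<beta> by (intro tendsto_powr') (auto simp: eventually_at_filter)
    then have "((\<lambda>\<tau>. (k * (N + N)) * \<tau> powr (\<beta> - \<alpha>)) \<longlongrightarrow> 0) (at_right 0)"
      by (auto intro: tendsto_mult_right_zero)
    then have "\<forall>\<^sub>F \<tau> in at_right 0. (k * (N + N)) * \<tau> powr (\<beta> - \<alpha>) < e / 2"
      using order_tendstoD(2) e half_gt_zero by blast
    then obtain d' where d': "0 < d'" "\<And>\<tau>. 0 < \<tau> \<Longrightarrow> \<tau> < d' \<Longrightarrow> (k * (N + N)) * \<tau> powr (\<beta> - \<alpha>) < e / 2"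
      unfolding eventually_at_right_field by auto
    define \<tau> where "\<tau> = min (d' / 2) T"
    have \<tau>: "0 < \<tau>" "\<tau> < d'" "\<tau> \<le> T" using d'(1) T_pos by (auto simp: \<tau>_def)
    have "(\<lambda>n. (k * \<tau> powr - \<alpha>) * norm (w n - l)) \<longlonglongrightarrow> 0"
      by (intro tendsto_mult_right_zero tendsto_norm_zero LIM_zero lim)
    then have "\<forall>\<^sub>F n in sequentially. (k * \<tau> powr - \<alpha>) * norm (w n - l) < e / 2"
      using order_tendstoD(2) e half_gt_zero by blast
    then obtain n0 where n0: "\<And>n. n0 \<le> n \<Longrightarrow> (k * \<tau> powr - \<alpha>) * norm (w n - l) < e / 2"
      unfolding eventually_sequentially by blast
    have "nrm X (w n - l) < e" if "n0 \<le> n" for n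
    proof -
      have "nrm X (w n - l) \<le> (k * \<tau> powr - \<alpha>) * norm (w n - l) + (k * (N + N)) * \<tau> powr (\<beta> - \<alpha>)"
        using k(3)[OF d \<tau>(1,3), of n] by (simp add: algebra_simps)
      then show ?thesis using n0[OF that] d'(2)[OF \<tau>(1,2)] by linarith
    qed
    then show "\<exists>n0. \<forall>n\<ge>n0. norm (nrm X (w n - l) - 0) < e" using ge0 by auto
  qed
qed

text \<open>Dominated convergence is applied to the scalar functions
  \<open>M * norm (g n s - g' s)\<close>, with the integrable majorant
  \<open>2 * M * G * s powr - \<alpha>\<close>; these bound the difference of the vector-valued
  integrands.\<close>

lemma conv_tendsto:
  assumes g: "\<And>n. forcing \<alpha> G (g n)" "forcing \<alpha> G g'" and t: "0 < t" "t \<le> T"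
    and lim: "\<And>s. 0 < s \<Longrightarrow> s \<le> T \<Longrightarrow> (\<lambda>n. g n s) \<longlonglongrightarrow> g' s"
  shows "(\<lambda>n. conv (g n) t) \<longlonglongrightarrow> conv g' t"
proof -
  \<comment> \<open>The value at 0 is reset because forcings are uncontrolled there.\<close>
  define k where "k n s = (if s = 0 then 0 else M * norm (g n s - g' s))" for n s
  have int: "(\<lambda>s. S (t - s) (h s)) integrable_on {0..t}" if "forcing \<alpha> G h" for h
    using conv_integrable[OF that \<alpha>_less1 _ t(2), of 0] t T_pos by simp
  have diff_bound: "norm (g n s - g' s) \<le> 2 * G * s powr - \<alpha>" if "0 < s" "s \<le> t" for n s
    using forcing_bound[OF g(1), of s n] forcing_bound[OF g(2), of s] that t
      norm_triangle_ineq4[of "g n s" "g' s"] by simp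
  have k_bound: "norm (k n s) \<le> (2 * M * G) * s powr - \<alpha>" if "s \<in> {0..t}" for n s
    using diff_bound[of s n] that M_pos by (auto simp: k_def)
  have k_int: "k n integrable_on {0..t}" for n
  proof (rule integrable_singular_at_0[OF t(1) _ \<alpha>_less1])
    have "continuous_on {0<..t} (\<lambda>s. M * norm (g n s - g' s))"
      by (intro continuous_intros forcing_continuous[OF g(1) t(2)] forcing_continuous[OF g(2) t(2)])
    then show "continuous_on {0<..t} (k n)"
      by (rule continuous_on_eq) (auto simp: k_def)
    show "norm (k n s) \<le> (2 * M * G) * s powr - \<alpha>" if "0 < s" "s \<le> t" for s
      using k_bound[of s n] that by simp
  qed
  have h_int: "(\<lambda>s. (2 * M * G) * s powr - \<alpha>) integrable_on {0..t}"
  proof (rule integrable_singular_at_0[OF t(1) _ \<alpha>_less1])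
    show "continuous_on {0<..t} (\<lambda>s. (2 * M * G) * s powr - \<alpha>)" by (intro continuous_intros) auto
    show "norm (2 * M * G * s powr - \<alpha>) \<le> (2 * M * G) * s powr - \<alpha>" for s
      using M_pos forcing_nonneg[OF g(2)] by simp
  qed
  have "(\<lambda>n. integral {0..t} (k n)) \<longlonglongrightarrow> integral {0..t} (\<lambda>_. 0)"
  proof (rule dominated_convergence(2)[OF k_int h_int k_bound])
    fix s assume s: "s \<in> {0..t}"
    show "(\<lambda>n. k n s) \<longlonglongrightarrow> 0"
    proof (cases "s = 0")
      case False
      then have "(\<lambda>n. M * norm (g n s - g' s)) \<longlonglongrightarrow> 0"
        using s t by (intro tendsto_mult_right_zero tendsto_norm_zero LIM_zero lim) auto
      then show ?thesis using False by (simp add: k_def)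
    qed (simp add: k_def)
  qed
  then have lim0: "(\<lambda>n. integral {0..t} (k n)) \<longlonglongrightarrow> 0" by simp
  have bound: "norm (conv (g n) t - conv g' t) \<le> integral {0..t} (k n)" for n
  proof -
    define \<phi> where "\<phi> s = (if s = 0 then 0 else S (t - s) (g n s) - S (t - s) (g' s))" for s
    have d: "(\<lambda>s. S (t - s) (g n s) - S (t - s) (g' s)) integrable_on {0..t}"
      by (rule integrable_diff[OF int[OF g(1)] int[OF g(2)]])
    have "\<phi> integrable_on {0..t}"
      by (rule integrable_spike[OF d, of "{0}"]) (auto simp: \<phi>_def)
    have "conv (g n) t - conv g' t = integral {0..t} (\<lambda>s. S (t - s) (g n s) - S (t - s) (g' s))"
      unfolding conv_def by (rule integral_diff[OF int[OF g(1)] int[OF g(2)], symmetric])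
    also have "\<dots> = integral {0..t} \<phi>"
      by (rule integral_spike[of "{0}"]) (auto simp: \<phi>_def)
    also have "norm \<dots> \<le> integral {0..t} (k n)"
    proof (rule integral_norm_bound_integral[OF \<open>\<phi> integrable_on {0..t}\<close> k_int])
      fix s assume s: "s \<in> {0..t}"
      have "norm (S (t - s) (g n s) - S (t - s) (g' s)) \<le> M * norm (g n s - g' s)"
        using S_bound[of "t - s" "g n s - g' s"] s t T_pos by (simp add: S_diff)
      then show "norm (\<phi> s) \<le> k n s" by (simp add: \<phi>_def k_def)
    qed
    finally show ?thesis .
  qed
  have "(\<lambda>n. conv (g n) t - conv g' t) \<longlonglongrightarrow> 0"
    by (rule Lim_null_comparison[OF always_eventually[OF allI[OF bound]] lim0])
  then show ?thesis by (rule LIM_zero_cancel)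
qed

theorem mild_solution_exists:
  "\<exists>u G M2. continuous_map (top_of_set {0<..T}) (ntop X) u \<and> forcing \<alpha> G (\<lambda>s. f s (u s)) \<and>
     (\<forall>t\<in>{0<..T}. nrm X (u t) \<le> M2 * t powr - \<alpha>) \<and> (\<forall>t\<in>{0<..T}. u t = mild u0 (\<lambda>s. f s (u s)) t)"
proof -
  obtain \<mu> M1 where \<mu>: "0 \<le> \<mu>" and M1: "0 \<le> M1" and adm0: "admissible \<mu> M1 (mild u0 (\<lambda>_. 0))"
    and adm: "\<And>h U. 0 < h \<Longrightarrow> h \<le> T \<Longrightarrow> admissible \<mu> M1 U \<Longrightarrow> admissible \<mu> M1 (mild u0 (delayed h U))"
    by (rule admissible_constants) (rule that)
  define h where "h n = T / (real n + 1)" for n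
  have h: "0 < h n" "h n \<le> T" for n using T_pos by (auto simp: h_def field_simps)
  have h0: "h \<longlonglongrightarrow> 0"
    unfolding h_def using tendsto_mult_right_zero[OF LIMSEQ_inverse_real_of_nat, of T]
    by (simp add: divide_inverse add.commute)
  have "\<forall>n. \<exists>w. admissible \<mu> M1 w \<and> (\<forall>t\<in>{0..T}. w t = mild u0 (delayed (h n) w) t)"
    using delayed_solution[OF adm0 adm[OF h] h(1)] by blast
  then obtain w where w_adm: "\<And>n. admissible \<mu> M1 (w n)"
    and w_eq: "\<And>n t. t \<in> {0..T} \<Longrightarrow> w n t = mild u0 (delayed (h n) (w n)) t"
    by metis
  define g where "g n = delayed (h n) (w n)" for n
  define G where "G = C * (T powr \<alpha> + 2 * M1) * exp (\<mu> * T)"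
  have g: "forcing \<alpha> G (g n)" for n
    unfolding g_def G_def by (rule delayed_forcing[OF w_adm \<mu> M1 h])
  obtain r where r: "strict_mono r" and conv_r: "\<And>t. 0 < t \<Longrightarrow> t \<le> T \<Longrightarrow> convergent (\<lambda>n. mild u0 (g (r n)) t)"
    using mild_convergent_subsequence[of G g] g by blast
  define u where "u t = lim (\<lambda>n. mild u0 (g (r n)) t)" for t
  have lim_u: "(\<lambda>n. mild u0 (g (r n)) t) \<longlonglongrightarrow> u t" if "0 < t" "t \<le> T" for t
    unfolding u_def using conv_r[OF that] by (simp add: convergent_LIMSEQ_iff)
  define \<beta> where "\<beta> = (\<alpha> + 1) / 2"
  have \<beta>: "\<alpha> < \<beta>" "\<beta> < 1" "0 < \<beta>" "\<beta> \<le> 1" using \<alpha>_ge0 \<alpha>_less1 by (auto simp: \<beta>_def)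
  have decay_ex: "\<exists>N. \<forall>t. \<epsilon> \<le> t \<longrightarrow> t \<le> T \<longrightarrow> decay \<beta> N (u t) \<and> (\<forall>n. decay \<beta> N (mild u0 (g n) t))" if \<epsilon>: "0 < \<epsilon>" for \<epsilon>
  proof -
    obtain N where N: "\<And>g t. forcing \<alpha> G g \<Longrightarrow> \<epsilon> \<le> t \<Longrightarrow> t \<le> T \<Longrightarrow> decay \<beta> N (mild u0 g t)"
      using decay_mild[OF \<alpha>_less1 less_imp_le[OF \<beta>(3)] \<beta>(2) \<epsilon>] by blast
    have "decay \<beta> N (u t)" if t: "\<epsilon> \<le> t" "t \<le> T" for t
      using t \<epsilon> by (intro decay_limit[OF _ lim_u] N[OF g]) auto
    with N[OF g] show ?thesis by blast
  qed
  have u_mem: "u t \<in> carr X" if t: "0 < t" "t \<le> T" for t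
  proof -
    obtain N where "decay \<beta> N (u t)" using decay_ex[OF t(1)] t(2) by blast
    then show ?thesis by (rule decay_mem[OF \<beta>(1,4)])
  qed
  have nrm_lim: "(\<lambda>n. nrm X (mild u0 (g (r n)) t - u t)) \<longlonglongrightarrow> 0" if t: "0 < t" "t \<le> T" for t
  proof -
    obtain N where "\<And>n. decay \<beta> N (mild u0 (g n) t)" using decay_ex[OF t(1)] t(2) by blast
    then show ?thesis by (intro nrm_tendsto_of_decay[OF \<beta>(1,4) _ lim_u[OF t]])
  qed
  have g_mem: "mild u0 (g n) t \<in> carr X" if "0 < t" "t \<le> T" for n t
    by (rule mild_mem[OF \<alpha>_less1 g that])
  \<comment> \<open>The decay and Hoelder constants of the approximations are uniform, so both
    bounds pass to the limit in the ambient norm and are upgraded to \<open>X\<close> only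
    afterwards.\<close>
  have u_cont: "continuous_map (top_of_set {0<..T}) (ntop X) u"
  proof (rule continuous_map_of_hoelder[OF u_mem])
    show "0 < \<beta> - \<alpha>" using \<beta> by simp
    fix \<epsilon> :: real assume \<epsilon>: "0 < \<epsilon>"
    obtain N where N: "\<And>t. \<epsilon> \<le> t \<Longrightarrow> t \<le> T \<Longrightarrow> decay \<beta> N (u t)" using decay_ex[OF \<epsilon>] by blast
    obtain H where H: "\<And>g t1 t2. forcing \<alpha> G g \<Longrightarrow> \<epsilon> \<le> t1 \<Longrightarrow> t1 \<le> t2 \<Longrightarrow> t2 \<le> T \<Longrightarrow>
        norm (mild u0 g t2 - mild u0 g t1) \<le> H * (t2 - t1) powr \<beta>"
      using mild_hoelder[OF \<alpha>_ge0 \<alpha>_less1 \<beta>(3,2) \<epsilon>] by blast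
    obtain k where k: "0 < k" "\<And>w1 w2 N H h. decay \<beta> N w1 \<Longrightarrow> decay \<beta> N w2 \<Longrightarrow> 0 < h \<Longrightarrow> h \<le> T \<Longrightarrow>
        norm (w2 - w1) \<le> H * h powr \<beta> \<Longrightarrow> nrm X (w2 - w1) \<le> k * (H + 2 * N) * h powr (\<beta> - \<alpha>)"
      by (rule hoelder_upgrade[OF \<beta>(1,4)]) (rule that)
    have "nrm X (u t2 - u t1) \<le> k * (H + 2 * N) * (t2 - t1) powr (\<beta> - \<alpha>)"
      if t: "\<epsilon> \<le> t1" "t1 < t2" "t2 \<le> T" for t1 t2
    proof (rule k(2)[OF N N])
      have "(\<lambda>n. norm (mild u0 (g (r n)) t2 - mild u0 (g (r n)) t1)) \<longlonglongrightarrow> norm (u t2 - u t1)"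
        using t \<epsilon> by (intro tendsto_norm tendsto_diff lim_u) auto
      then show "norm (u t2 - u t1) \<le> H * (t2 - t1) powr \<beta>"
        by (rule LIMSEQ_le_const2) (use H[OF g t(1) less_imp_le[OF t(2)] t(3)] in blast)
    qed (use t \<epsilon> in auto)
    then show "\<exists>H. \<forall>t1 t2. \<epsilon> \<le> t1 \<longrightarrow> t1 < t2 \<longrightarrow> t2 \<le> T \<longrightarrow> nrm X (u t2 - u t1) \<le> H * (t2 - t1) powr (\<beta> - \<alpha>)"
      by blast
  qed
  have u_bound: "nrm X (u t) \<le> M1 * exp (\<mu> * T) * t powr - \<alpha>" if t: "0 < t" "t \<le> T" for t
  proof (rule nrm_limit_le[OF g_mem[OF t] u_mem[OF t] nrm_lim[OF t]])
    fix n
    have "nrm X (mild u0 (g (r n)) t) = nrm X (w (r n) t)" using w_eq[of t "r n"] t by (simp add: g_def)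
    also have "\<dots> \<le> M1 * t powr - \<alpha> * exp (\<mu> * t)"
      using w_adm[of "r n"] t by (simp add: admissible_def)
    also have "\<dots> \<le> M1 * t powr - \<alpha> * exp (\<mu> * T)"
      using t \<mu> M1 by (intro mult_left_mono) (auto intro: mult_left_mono)
    finally show "nrm X (mild u0 (g (r n)) t) \<le> M1 * exp (\<mu> * T) * t powr - \<alpha>" by (simp add: mult_ac)
  qed
  \<comment> \<open>The delayed argument \<open>w (s - h)\<close> differs from the value at
    \<open>s\<close> by at most \<open>H * h powr (\<beta> - \<alpha>)\<close> in \<open>X\<close>,
    uniformly in the index, while the value at \<open>s\<close> tends to \<open>u s\<close> in
    \<open>X\<close>; continuity of \<open>f s\<close> does the rest.\<close>
  have g_lim: "(\<lambda>n. g (r n) s) \<longlonglongrightarrow> f s (u s)" if s: "0 < s" "s \<le> T" for s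
  proof -
    define p where "p n = max (h (r n)) (s - h (r n))" for n
    have p: "0 < p n" "p n \<le> T" for n using h[of "r n"] s by (auto simp: p_def)
    have hr: "(\<lambda>n. h (r n)) \<longlonglongrightarrow> 0" using LIMSEQ_subseq_LIMSEQ[OF h0 r] by (simp add: o_def)
    have small: "\<forall>\<^sub>F n in sequentially. h (r n) < s / 4"
      using order_tendstoD(2)[OF hr, of "s / 4"] s by simp
    have s2: "0 < s / 2" using s by simp
    obtain H where H: "\<And>g t1 t2. forcing \<alpha> G g \<Longrightarrow> s / 2 \<le> t1 \<Longrightarrow> t1 \<le> t2 \<Longrightarrow> t2 \<le> T \<Longrightarrow>
        nrm X (mild u0 g t2 - mild u0 g t1) \<le> H * (t2 - t1) powr (\<beta> - \<alpha>)"
      using mild_nrm_hoelder[OF \<alpha>_ge0 \<alpha>_less1 \<beta>(1,2) s2] by blast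
    have "(\<lambda>n. nrm X (w (r n) (p n) - u s)) \<longlonglongrightarrow> 0"
    proof (rule Lim_null_comparison)
      have "(\<lambda>n. h (r n) powr (\<beta> - \<alpha>)) \<longlonglongrightarrow> 0 powr (\<beta> - \<alpha>)"
        using \<beta> h by (intro tendsto_powr' hr tendsto_const) (auto intro!: always_eventually less_imp_le)
      then have "(\<lambda>n. H * h (r n) powr (\<beta> - \<alpha>)) \<longlonglongrightarrow> 0" by (auto intro: tendsto_mult_right_zero)
      from tendsto_add[OF this nrm_lim[OF s]]
      show "(\<lambda>n. H * h (r n) powr (\<beta> - \<alpha>) + nrm X (mild u0 (g (r n)) s - u s)) \<longlonglongrightarrow> 0" by simp
      show "\<forall>\<^sub>F n in sequentially. norm (nrm X (w (r n) (p n) - u s)) \<le>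
          H * h (r n) powr (\<beta> - \<alpha>) + nrm X (mild u0 (g (r n)) s - u s)"
        using small
      proof eventually_elim
        case (elim n)
        have pn: "p n = s - h (r n)" using elim h[of "r n"] unfolding p_def by (intro max_absorb2) linarith
        have eq: "w (r n) (p n) = mild u0 (g (r n)) (p n)" using w_eq[of "p n" "r n"] p[of n] by (simp add: g_def)
        have "nrm X (mild u0 (g (r n)) (p n) - u s) \<le> nrm X (mild u0 (g (r n)) (p n) - mild u0 (g (r n)) s) + nrm X (mild u0 (g (r n)) s - u s)"
          by (intro nrm_diff_triangle g_mem u_mem p s)
        also have "nrm X (mild u0 (g (r n)) (p n) - mild u0 (g (r n)) s) = nrm X (mild u0 (g (r n)) s - mild u0 (g (r n)) (p n))"
          by (intro nrm_diff_commute g_mem p s)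
        also have "\<dots> \<le> H * (s - p n) powr (\<beta> - \<alpha>)"
          using elim s h[of "r n"] by (intro H[OF g]) (auto simp: pn)
        finally show ?case
          using nrm_ge0[OF diff_mem[OF g_mem[OF p, of "r n" n] u_mem[OF s]]] by (simp add: eq) (simp add: pn)
      qed
    qed
    then have "(\<lambda>n. f s (w (r n) (p n))) \<longlonglongrightarrow> f s (u s)"
      by (intro superposition_tendsto admissible_mem[OF w_adm] p u_mem s)
    then show ?thesis
    proof (rule Lim_transform_eventually)
      show "\<forall>\<^sub>F n in sequentially. f s (w (r n) (p n)) = g (r n) s"
        using small
      proof eventually_elim
        case (elim n)
        \<comment> \<open>For \<open>h (r n) < s / 4\<close> the time \<open>s\<close> lies beyond
          \<open>3 * h (r n)\<close>, where the switch-on factor equals 1.\<close>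
        have "1 \<le> (s - 2 * h (r n)) / h (r n)" using elim h[of "r n"] by (simp add: le_divide_eq)
        then show ?case by (simp add: g_def delayed_def p_def)
      qed
    qed
  qed
  have fu: "forcing \<alpha> G (\<lambda>s. f s (u s))"
    unfolding forcing_def
  proof (intro conjI ballI)
    show "continuous_on {0<..T} (\<lambda>s. f s (u s))"
      by (rule superposition_continuous[OF u_cont]) auto
    fix s assume s: "s \<in> {0<..T}"
    have "(\<lambda>n. norm (g (r n) s)) \<longlonglongrightarrow> norm (f s (u s))"
      using s by (intro tendsto_norm g_lim) auto
    then show "norm (f s (u s)) \<le> G * s powr - \<alpha>"
      by (rule LIMSEQ_le_const2) (use forcing_bound[OF g] s in auto)
  qed
  have "u t = mild u0 (\<lambda>s. f s (u s)) t" if t: "0 < t" "t \<le> T" for t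
  proof (rule LIMSEQ_unique[OF lim_u[OF t]])
    have "(\<lambda>n. conv (g (r n)) t) \<longlonglongrightarrow> conv (\<lambda>s. f s (u s)) t"
      by (rule conv_tendsto[OF g fu t g_lim])
    then show "(\<lambda>n. mild u0 (g (r n)) t) \<longlonglongrightarrow> mild u0 (\<lambda>s. f s (u s)) t"
      unfolding mild_def by (intro tendsto_add tendsto_const)
  qed
  with u_cont fu u_bound show ?thesis
    by (intro exI[of _ u] exI[of _ G] exI[of _ "M1 * exp (\<mu> * T)"]) auto
qed

end

section \<open>Regularity of mild solutions\<close>

context smoothing_semigroup
begin

lemma S_tendsto_0: "((\<lambda>t. S t x) \<longlongrightarrow> x) (at_right 0)"
proof -
  have "((\<lambda>t. S t x) \<longlongrightarrow> S 0 x) (at 0 within {0..})"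
    by (rule bspec[OF S_continuous[of x, unfolded continuous_on_def]]) simp
  then have "((\<lambda>t. S t x) \<longlongrightarrow> x) (at 0 within {0..})" by simp
  then show ?thesis by (rule tendsto_within_subset) auto
qed

text \<open>This is the square of \<open>A\<close> applied to \<open>S t x\<close>, written so that
  each \<open>A\<close> meets an already smoothed vector; it is a bounded operator for
  \<open>t > 0\<close>.\<close>

definition AAS :: "real \<Rightarrow> 'a \<Rightarrow> 'a" where
  "AAS t x = A (S (t / 2) (A (S (t / 2) x)))"

lemma AAS_linear: "0 < t \<Longrightarrow> bounded_linear (AAS t)"
  unfolding AAS_def[abs_def]
  using bounded_linear_compose[OF AS_linear AS_linear] by simp

lemma norm_AAS_le:
  assumes "0 < t" "t \<le> 4 * T"
  shows "norm (AAS t x) \<le> 2 * M / t * norm (A (S (t / 2) x))"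
  using AS_bound[of "t / 2" "A (S (t / 2) x)"] assms by (simp add: AAS_def mult_ac)

lemma AAS_shift:
  assumes "0 < t" "0 \<le> s"
  shows "AAS t (S s x) = AAS (t + s) x"
proof -
  have 1: "AAS t (S s x) = A (S (t / 2) (A (S (t / 2 + s) x)))"
    using S_add[of "t / 2" s x] assms by (simp add: AAS_def)
  have "A (S (t / 2 + s) x) = S (s / 2) (A (S (t / 2 + s / 2) x))"
    using AS_split[of "s / 2" "t / 2 + s / 2" x] assms by (simp add: algebra_simps)
  moreover have "S (t / 2) (S (s / 2) y) = S ((t + s) / 2) y" for y
    using S_add[of "t / 2" "s / 2" y] assms by (simp add: add_divide_distrib)
  ultimately show "AAS t (S s x) = AAS (t + s) x"
    unfolding 1 by (simp add: AAS_def add_divide_distrib)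
qed

lemma AS_deriv:
  assumes t: "0 < t"
  shows "((\<lambda>s. A (S s x)) has_vector_derivative AAS t x) (at t)"
proof -
  define y where "y = A (S (t / 2) x)"
  have "((\<lambda>s. s - t / 2) has_vector_derivative 1) (at t)"
    by (auto intro!: derivative_eq_intros)
  moreover have "((\<lambda>s. S s y) has_vector_derivative A (S (t / 2) y)) (at (t - t / 2))"
    using S_deriv[of "t / 2" y] t by simp
  ultimately have "((\<lambda>s. S s y) \<circ> (\<lambda>s. s - t / 2) has_vector_derivative 1 *\<^sub>R A (S (t / 2) y)) (at t)"
    by (rule vector_diff_chain_at)
  then have 1: "((\<lambda>s. S (s - t / 2) y) has_vector_derivative AAS t x) (at t)"
    by (simp add: o_def AAS_def y_def)
  show ?thesis
  proof (rule has_vector_derivative_transform_within_open[OF 1, of "{t / 2<..}"])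
    fix s assume "s \<in> {t / 2<..}"
    then show "S (s - t / 2) y = A (S s x)"
      using AS_split[of "s - t / 2" "t / 2" x] t by (simp add: y_def)
  qed (use t in auto)
qed

text \<open>Hence \<open>A (S \<eta> w)\<close> converges as \<open>\<eta> \<rightarrow> 0\<close>, and \<open>w\<close> is in the domain of \<open>A\<close>.\<close>

lemma AS_diff_le:
  assumes \<kappa>: "0 < \<kappa>" and K: "0 \<le> K" and bound: "\<And>\<sigma>. 0 < \<sigma> \<Longrightarrow> \<sigma> \<le> T \<Longrightarrow> norm (AAS \<sigma> w) \<le> K * \<sigma> powr (\<kappa> - 1)"
    and \<eta>: "0 < \<eta>1" "\<eta>1 \<le> \<eta>2" "\<eta>2 \<le> T"
  shows "norm (A (S \<eta>2 w) - A (S \<eta>1 w)) \<le> K / \<kappa> * \<eta>2 powr \<kappa>"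
proof (cases "\<eta>1 = \<eta>2")
  case True
  then show ?thesis using K \<kappa> by simp
next
  case False
  have "norm (A (S \<eta>2 w) - A (S \<eta>1 w)) \<le> K / \<kappa> * \<eta>2 powr \<kappa> - K / \<kappa> * \<eta>1 powr \<kappa>"
  proof (rule differentiable_bound_general[where \<phi> = "\<lambda>\<sigma>. K / \<kappa> * \<sigma> powr \<kappa>" and f = "\<lambda>\<sigma>. A (S \<sigma> w)"
        and \<phi>' = "\<lambda>\<sigma>. K * \<sigma> powr (\<kappa> - 1)" and f' = "\<lambda>\<sigma>. AAS \<sigma> w"])
    show "\<eta>1 < \<eta>2" using False \<eta> by simp
    show "continuous_on {\<eta>1..\<eta>2} (\<lambda>\<sigma>. A (S \<sigma> w))"
      by (rule continuous_on_subset[OF AS_continuous]) (use \<eta> in auto)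
    show "continuous_on {\<eta>1..\<eta>2} (\<lambda>\<sigma>. K / \<kappa> * \<sigma> powr \<kappa>)"
      using \<eta> \<kappa> by (intro continuous_intros) auto
    fix \<sigma> assume \<sigma>: "\<eta>1 < \<sigma>" "\<sigma> < \<eta>2"
    show "((\<lambda>\<sigma>. K / \<kappa> * \<sigma> powr \<kappa>) has_vector_derivative K * \<sigma> powr (\<kappa> - 1)) (at \<sigma>)"
      unfolding has_real_derivative_iff_has_vector_derivative[symmetric]
      using \<sigma> \<eta> \<kappa> by (auto intro!: derivative_eq_intros)
    show "((\<lambda>\<sigma>. A (S \<sigma> w)) has_vector_derivative AAS \<sigma> w) (at \<sigma>)"
      using \<sigma> \<eta> by (intro AS_deriv) simp
    show "norm (AAS \<sigma> w) \<le> K * \<sigma> powr (\<kappa> - 1)" using bound \<sigma> \<eta> by simp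
  qed
  also have "\<dots> \<le> K / \<kappa> * \<eta>2 powr \<kappa>" using K \<kappa> by simp
  finally show ?thesis .
qed

text \<open>A constant forcing is integrated exactly. The result stays bounded as
  \<open>\<eta>\<close> tends to 0, whereas a norm estimate of the integrand by
  \<open>1 / (\<eta> + t - s)\<close> would lose a logarithm.\<close>

lemma AS_conv_const:
  assumes t: "0 \<le> t" and \<eta>: "0 < \<eta>"
  shows "((\<lambda>s. A (S (\<eta> + (t - s)) x)) has_integral (S (\<eta> + t) x - S \<eta> x)) {0..t}"
proof -
  have "((\<lambda>s. A (S (\<eta> + (t - s)) x)) has_integral (- S (\<eta> + (t - t)) x - (- S (\<eta> + (t - 0)) x))) {0..t}"
  proof (rule fundamental_theorem_of_calculus[OF t])
    fix s assume s: "s \<in> {0..t}"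
    have "((\<lambda>s. \<eta> + (t - s)) has_vector_derivative - 1) (at s)"
      by (auto intro!: derivative_eq_intros)
    moreover have "((\<lambda>r. S r x) has_vector_derivative A (S (\<eta> + (t - s)) x)) (at (\<eta> + (t - s)))"
      using s \<eta> by (intro S_deriv) auto
    ultimately have "((\<lambda>r. S r x) \<circ> (\<lambda>s. \<eta> + (t - s)) has_vector_derivative (- 1) *\<^sub>R A (S (\<eta> + (t - s)) x)) (at s)"
      by (rule vector_diff_chain_at)
    from has_vector_derivative_minus[OF this]
    show "((\<lambda>s. - S (\<eta> + (t - s)) x) has_vector_derivative A (S (\<eta> + (t - s)) x)) (at s within {0..t})"
      by (simp add: o_def has_vector_derivative_at_within)
  qed
  then show ?thesis by simp
qed

lemma forcing_diff_const:
  assumes g: "forcing \<xi> G g" and \<xi>: "0 \<le> \<xi>"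
  shows "forcing \<xi> (G + norm x * T powr \<xi>) (\<lambda>s. g s - x)"
  unfolding forcing_def
proof (intro conjI ballI)
  show "continuous_on {0<..T} (\<lambda>s. g s - x)"
    by (intro continuous_intros forcing_continuous[OF g order_refl])
  fix s assume s: "s \<in> {0<..T}"
  have "1 \<le> T powr \<xi> * s powr - \<xi>"
    using powr_mono2[of \<xi> s T] s \<xi> by (simp add: powr_minus divide_simps)
  then have "norm x * 1 \<le> norm x * (T powr \<xi> * s powr - \<xi>)" by (intro mult_left_mono) auto
  then show "norm (g s - x) \<le> (G + norm x * T powr \<xi>) * s powr - \<xi>"
    using forcing_bound[OF g, of s] s norm_triangle_ineq4[of "g s" x] by (simp add: algebra_simps)
qed

text \<open>For \<open>\<eta> > 0\<close> the forcing may be split as \<open>(g s - x) + x\<close>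
  under the integral. The vector \<open>x\<close> is free and may later vary with \<open>t\<close>;
  it is meant to make \<open>g s - x\<close> harmless near \<open>s = t\<close>.\<close>

lemma AS_mild:
  assumes g: "forcing \<xi> G g" and \<xi>: "0 \<le> \<xi>" "\<xi> < 1" and t: "0 < t" "t \<le> T" and \<eta>: "0 < \<eta>"
  shows "A (S \<eta> (mild u0 g t)) =
    A (S (\<eta> + t) u0) + A (S \<eta> (conv (\<lambda>s. g s - x) t)) + (S (\<eta> + t) x - S \<eta> x)"
proof -
  note t0 = less_imp_le[OF t(1)]
  note L = conv_linear[OF g \<xi>(2) t0 t(2) AS_linear[OF \<eta>]]
  note L' = conv_linear[OF forcing_diff_const[OF g \<xi>(1)] \<xi>(2) t0 t(2) AS_linear[OF \<eta>], of x]
  have eq: "A (S \<eta> (S (t - s) x)) = A (S (\<eta> + (t - s)) x)" if "s \<in> {0..t}" for s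
    using S_add[of \<eta> "t - s" x] \<eta> that by simp
  have C: "((\<lambda>s. A (S \<eta> (S (t - s) x))) has_integral (S (\<eta> + t) x - S \<eta> x)) {0..t}"
    by (rule has_integral_eq[OF _ AS_conv_const[OF t0 \<eta>]]) (simp add: eq)
  have "A (S \<eta> (conv g t)) = integral {0..t} (\<lambda>s. A (S \<eta> (S (t - s) (g s - x))) + A (S \<eta> (S (t - s) x)))"
    unfolding L(1)
  proof (rule integral_cong)
    fix s assume s: "s \<in> {0..t}"
    then show "A (S \<eta> (S (t - s) (g s))) = A (S \<eta> (S (t - s) (g s - x))) + A (S \<eta> (S (t - s) x))"
      using s by (simp add: S_diff[of "t - s"] AS_diff[OF \<eta>])
  qed
  also have "\<dots> = A (S \<eta> (conv (\<lambda>s. g s - x) t)) + (S (\<eta> + t) x - S \<eta> x)"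
    unfolding L'(1) integral_unique[OF C, symmetric]
    by (rule integral_add[OF L'(2)]) (use C in blast)
  finally show ?thesis
    using \<eta> t S_add[of \<eta> t u0] by (simp add: mild_def AS_add add.assoc)
qed

text \<open>The constant \<open>c t\<close> subtracted from the forcing is \<open>g t\<close> if \<open>g\<close> is Hoelder continuous, and \<open>0\<close> if \<open>g\<close> takes values in an
  interpolation space.\<close>

definition regular_forcing :: "real \<Rightarrow> (real \<Rightarrow> 'a) \<Rightarrow> (real \<Rightarrow> 'a) \<Rightarrow> bool" where
  "regular_forcing \<xi> g c \<longleftrightarrow> continuous_on {0<..T} c \<and>
     (\<forall>\<epsilon>>0. \<exists>K \<kappa> \<nu>. 0 < \<kappa> \<and> 0 < \<nu> \<and> 0 \<le> K \<and> (\<forall>t s \<eta>. \<epsilon> \<le> t \<and> t \<le> T \<and> 0 < s \<and> s < t \<and> 0 < \<eta> \<and> \<eta> \<le> T \<longrightarrow>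
        norm (AAS (\<eta> + (t - s)) (g s - c t)) \<le> K * \<eta> powr (\<kappa> - 1) * ((t - s) powr (\<nu> - 1) * s powr - \<xi>)))"

lemma mild_in_Dom:
  assumes g: "forcing \<xi> G g" and \<xi>: "0 \<le> \<xi>" "\<xi> < 1" and reg: "regular_forcing \<xi> g c"
  shows "\<And>t. 0 < t \<Longrightarrow> t \<le> T \<Longrightarrow> mild u0 g t \<in> Dom"
    and "continuous_on {0<..T} (\<lambda>t. A (mild u0 g t))"
proof -
  \<comment> \<open>The constant subtracted from the forcing depends on the final time
    \<open>t\<close>, so \<open>z\<close> is not a convolution with one fixed forcing.\<close>
  define z where "z t = conv (\<lambda>s. g s - c t) t" for t
  define \<eta> where "\<eta> n = T / (real n + 1)" for n
  have \<eta>: "0 < \<eta> n" "\<eta> n \<le> T" for n using T_pos by (auto simp: \<eta>_def field_simps)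
  have \<eta>_lim: "filterlim \<eta> (at_right 0) sequentially"
  proof -
    have "\<eta> \<longlonglongrightarrow> 0"
      unfolding \<eta>_def using tendsto_mult_right_zero[OF LIMSEQ_inverse_real_of_nat, of T]
      by (simp add: divide_inverse add.commute)
    moreover have "\<eta> n \<noteq> 0" for n using \<eta>(1)[of n] by simp
    ultimately show ?thesis using \<eta> by (auto simp: filterlim_at)
  qed
  have rate: "\<exists>D \<kappa>. 0 < \<kappa> \<and> 0 \<le> D \<and> (\<forall>t \<eta>1 \<eta>2. \<epsilon> \<le> t \<and> t \<le> T \<and> 0 < \<eta>1 \<and> \<eta>1 \<le> \<eta>2 \<and> \<eta>2 \<le> T \<longrightarrow>
      norm (A (S \<eta>2 (z t)) - A (S \<eta>1 (z t))) \<le> D * \<eta>2 powr \<kappa>)" if \<epsilon>: "0 < \<epsilon>" for \<epsilon>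
  proof -
    obtain K \<kappa> \<nu> where \<kappa>: "0 < \<kappa>" and \<nu>: "0 < \<nu>" and K: "0 \<le> K"
      and bd: "\<And>t s \<eta>. \<epsilon> \<le> t \<Longrightarrow> t \<le> T \<Longrightarrow> 0 < s \<Longrightarrow> s < t \<Longrightarrow> 0 < \<eta> \<Longrightarrow> \<eta> \<le> T \<Longrightarrow>
        norm (AAS (\<eta> + (t - s)) (g s - c t)) \<le> K * \<eta> powr (\<kappa> - 1) * ((t - s) powr (\<nu> - 1) * s powr - \<xi>)"
      using reg \<epsilon> unfolding regular_forcing_def by metis
    define p where "p = \<nu> - \<xi>"
    define B where "B = Beta (1 - \<xi>) \<nu> * (\<epsilon> powr p + T powr p)"
    have Bpos: "0 < Beta (1 - \<xi>) \<nu>" using \<xi> \<nu> by (intro Beta_real_pos) auto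
    have B: "0 \<le> B" using Bpos by (simp add: B_def)
    have z_bd: "norm (AAS \<sigma> (z t)) \<le> (K * B) * \<sigma> powr (\<kappa> - 1)"
      if t: "\<epsilon> \<le> t" "t \<le> T" and \<sigma>: "0 < \<sigma>" "\<sigma> \<le> T" for t \<sigma>
    proof -
      have t0: "0 < t" using t \<epsilon> by simp
      note L = conv_linear[OF forcing_diff_const[OF g \<xi>(1)] \<xi>(2) less_imp_le[OF t0] t(2) AAS_linear[OF \<sigma>(1)], of "c t"]
      have "norm (AAS \<sigma> (z t)) \<le> (K * \<sigma> powr (\<kappa> - 1)) * Beta (1 - \<xi>) (1 - (1 - \<nu>)) * t powr (1 - (1 - \<nu>) - \<xi>)"
        unfolding z_def L(1)
      proof (rule norm_integral_beta_kernel_le[OF L(2) _ \<xi>(2) t0])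
        show "1 - \<nu> < 1" using \<nu> by simp
        fix s assume s: "0 < s" "s < t"
        show "norm (AAS \<sigma> (S (t - s) (g s - c t))) \<le> K * \<sigma> powr (\<kappa> - 1) * ((t - s) powr - (1 - \<nu>) * s powr - \<xi>)"
          using bd[OF t s \<sigma>] AAS_shift[of \<sigma> "t - s"] s \<sigma> by simp
      qed
      also have "\<dots> = (K * \<sigma> powr (\<kappa> - 1)) * (Beta (1 - \<xi>) \<nu> * t powr p)" by (simp add: p_def)
      also have "\<dots> \<le> (K * \<sigma> powr (\<kappa> - 1)) * B"
        unfolding B_def using powr_le_add_powr[OF \<epsilon> t, of p] K Bpos by (intro mult_left_mono) auto
      finally show ?thesis by (simp add: mult_ac)
    qed
    have "norm (A (S \<eta>2 (z t)) - A (S \<eta>1 (z t))) \<le> K * B / \<kappa> * \<eta>2 powr \<kappa>"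
      if "\<epsilon> \<le> t" "t \<le> T" "0 < \<eta>1" "\<eta>1 \<le> \<eta>2" "\<eta>2 \<le> T" for t \<eta>1 \<eta>2
      using z_bd[OF that(1,2)] K B by (intro AS_diff_le \<kappa> that) auto
    then show ?thesis
      using \<kappa> K B by (intro exI[of _ "K * B / \<kappa>"] exI[of _ \<kappa>]) auto
  qed
  have null: "(\<lambda>n. D * \<eta> n powr \<kappa>) \<longlonglongrightarrow> 0" if "0 < \<kappa>" for D \<kappa> :: real
  proof -
    have "((\<lambda>h::real. h powr \<kappa>) \<longlongrightarrow> 0 powr \<kappa>) (at_right 0)"
      using that by (intro tendsto_powr') (auto simp: eventually_at_filter)
    then have "((\<lambda>h. D * h powr \<kappa>) \<longlongrightarrow> 0) (at_right 0)" by (auto intro: tendsto_mult_right_zero)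
    from filterlim_compose[OF this \<eta>_lim] show ?thesis .
  qed
  have \<eta>_mono: "\<eta> n \<le> \<eta> m" if "m \<le> n" for m n
    using that T_pos unfolding \<eta>_def by (intro divide_left_mono) auto
  have conv_ex: "convergent (\<lambda>n. A (S (\<eta> n) (z t)))" if t: "0 < t" "t \<le> T" for t
  proof -
    obtain D \<kappa> where D: "0 < \<kappa>" "0 \<le> D" "\<And>\<eta>1 \<eta>2. 0 < \<eta>1 \<Longrightarrow> \<eta>1 \<le> \<eta>2 \<Longrightarrow> \<eta>2 \<le> T \<Longrightarrow>
        norm (A (S \<eta>2 (z t)) - A (S \<eta>1 (z t))) \<le> D * \<eta>2 powr \<kappa>"
      using rate[OF t(1)] t(2) by blast
    have "Cauchy (\<lambda>n. A (S (\<eta> n) (z t)))"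
      unfolding Cauchy_altdef
    proof (intro allI impI)
      fix e :: real assume "0 < e"
      then have "\<forall>\<^sub>F n in sequentially. D * \<eta> n powr \<kappa> < e"
        by (rule order_tendstoD(2)[OF null[OF D(1)]])
      then obtain n0 where n0: "\<And>n. n0 \<le> n \<Longrightarrow> D * \<eta> n powr \<kappa> < e" by (auto simp: eventually_sequentially)
      have "dist (A (S (\<eta> m) (z t))) (A (S (\<eta> n) (z t))) < e" if "n0 \<le> m" "m < n" for m n
        using le_less_trans[OF D(3)[OF \<eta>(1) \<eta>_mono \<eta>(2)] n0] that by (simp add: dist_norm)
      then show "\<exists>n0. \<forall>m\<ge>n0. \<forall>n>m. dist (A (S (\<eta> m) (z t))) (A (S (\<eta> n) (z t))) < e" by blast
    qed
    then show ?thesis by (rule Cauchy_convergent)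
  qed
  define y where "y t = lim (\<lambda>n. A (S (\<eta> n) (z t)))" for t
  have y: "(\<lambda>n. A (S (\<eta> n) (z t))) \<longlonglongrightarrow> y t" if "0 < t" "t \<le> T" for t
    unfolding y_def using conv_ex[OF that] by (simp add: convergent_LIMSEQ_iff)
  have lim_S: "(\<lambda>n. S (\<eta> n) x) \<longlonglongrightarrow> x" for x
    by (rule filterlim_compose[OF S_tendsto_0 \<eta>_lim])
  \<comment> \<open>In the decomposition of \<open>A (S (\<eta> n) (mild u0 g t))\<close> all terms
    have limits. As \<open>S (\<eta> n) (mild u0 g t)\<close> itself tends to
    \<open>mild u0 g t\<close>, closedness of \<open>A\<close> yields both claims.\<close>
  have D: "mild u0 g t \<in> Dom" "A (mild u0 g t) = A (S t u0) + y t + (S t (c t) - c t)" if t: "0 < t" "t \<le> T" for t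
  proof -
    have "(\<lambda>n. S (\<eta> n) (A (S t u0)) + A (S (\<eta> n) (z t)) + (S (\<eta> n) (S t (c t)) - S (\<eta> n) (c t)))
        \<longlonglongrightarrow> A (S t u0) + y t + (S t (c t) - c t)"
      by (intro tendsto_intros lim_S y t)
    moreover have "S (\<eta> n) (A (S t u0)) + A (S (\<eta> n) (z t)) + (S (\<eta> n) (S t (c t)) - S (\<eta> n) (c t)) =
        A (S (\<eta> n) (mild u0 g t))" for n
      using AS_mild[OF g \<xi> t \<eta>(1)[of n], where ?u0.0 = u0 and x = "c t"] AS_split[of "\<eta> n" t u0] S_add[of "\<eta> n" t "c t"] \<eta>(1)[of n] t
      by (simp add: z_def)
    ultimately have "(\<lambda>n. A (S (\<eta> n) (mild u0 g t))) \<longlonglongrightarrow> A (S t u0) + y t + (S t (c t) - c t)" by simp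
    from A_closed[OF S_mem_Dom[OF \<eta>(1)] lim_S this]
    show "mild u0 g t \<in> Dom" "A (mild u0 g t) = A (S t u0) + y t + (S t (c t) - c t)" .
  qed
  show "\<And>t. 0 < t \<Longrightarrow> t \<le> T \<Longrightarrow> mild u0 g t \<in> Dom" by (rule D(1))
  have c_cont: "continuous_on {0<..T} c" using reg by (simp add: regular_forcing_def)
  have mild_cont: "continuous_on {\<epsilon>..T} (mild u0 g)" if \<epsilon>: "0 < \<epsilon>" for \<epsilon>
  proof (rule mild_hoelder[OF \<xi> _ _ \<epsilon>, of "1/2"])
    fix H assume H: "\<And>g t1 t2. forcing \<xi> G g \<Longrightarrow> \<epsilon> \<le> t1 \<Longrightarrow> t1 \<le> t2 \<Longrightarrow> t2 \<le> T \<Longrightarrow>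
      norm (mild u0 g t2 - mild u0 g t1) \<le> H * (t2 - t1) powr (1/2)"
    show ?thesis
      unfolding continuous_on_def
    proof
      fix t assume t: "t \<in> {\<epsilon>..T}"
      have "((\<lambda>s. \<bar>s - t\<bar>) \<longlongrightarrow> 0) (at t within {\<epsilon>..T})"
        using tendsto_rabs_zero[OF LIM_zero[OF tendsto_ident_at[of t "{\<epsilon>..T}"]]] by simp
      then have "((\<lambda>s. \<bar>s - t\<bar> powr (1/2)) \<longlongrightarrow> 0 powr (1/2)) (at t within {\<epsilon>..T})"
        by (intro tendsto_powr') auto
      then have lim0: "((\<lambda>s. H * \<bar>s - t\<bar> powr (1/2)) \<longlongrightarrow> 0) (at t within {\<epsilon>..T})"
        by (auto intro: tendsto_mult_right_zero)
      have bd: "norm (mild u0 g s - mild u0 g t) \<le> H * \<bar>s - t\<bar> powr (1/2)" if s: "s \<in> {\<epsilon>..T}" for s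
      proof (cases "s \<le> t")
        case True
        then show ?thesis using H[OF g, of s t] s t by (simp add: norm_minus_commute abs_minus_commute)
      qed (use H[OF g, of t s] s t in auto)
      have "\<forall>\<^sub>F s in at t within {\<epsilon>..T}. norm (mild u0 g s - mild u0 g t) \<le> H * \<bar>s - t\<bar> powr (1/2)"
        unfolding eventually_at_filter by (intro always_eventually allI impI bd)
      then have "((\<lambda>s. mild u0 g s - mild u0 g t) \<longlongrightarrow> 0) (at t within {\<epsilon>..T})"
        by (rule Lim_null_comparison[OF _ lim0])
      then show "(mild u0 g \<longlongrightarrow> mild u0 g t) (at t within {\<epsilon>..T})" by (rule LIM_zero_cancel)
    qed
  qed auto
  have y_cont: "continuous_on {\<epsilon>..T} y" if \<epsilon>: "0 < \<epsilon>" for \<epsilon>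
  proof (rule uniform_limit_theorem[where F = sequentially])
    have sub: "{\<epsilon>..T} \<subseteq> {0<..T}" using \<epsilon> by auto
    \<comment> \<open>As the forcing of \<open>z t\<close> changes with \<open>t\<close>, continuity
      is read off from the decomposition backwards: every other term in it is continuous in
      \<open>t\<close>.\<close>
    have "continuous_on {\<epsilon>..T} (\<lambda>t. A (S (\<eta> n) (z t)))" for n
    proof (rule continuous_on_eq)
      show "continuous_on {\<epsilon>..T} (\<lambda>t. A (S (\<eta> n) (mild u0 g t)) - A (S (\<eta> n + t) u0) - (S (\<eta> n + t) (c t) - S (\<eta> n) (c t)))"
      proof (intro continuous_on_diff)
        show "continuous_on {\<epsilon>..T} (\<lambda>t. A (S (\<eta> n) (mild u0 g t)))"
          by (rule continuous_on_compose2[OF linear_continuous_on[OF AS_linear[OF \<eta>(1)]] mild_cont[OF \<epsilon>]]) auto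
        show "continuous_on {\<epsilon>..T} (\<lambda>t. A (S (\<eta> n + t) u0))"
          by (rule continuous_on_compose2[OF AS_continuous]) (use \<eta>[of n] \<epsilon> in \<open>auto intro!: continuous_intros\<close>)
        show "continuous_on {\<epsilon>..T} (\<lambda>t. S (\<eta> n + t) (c t))"
          using \<eta>[of n] \<epsilon> T_pos by (intro S_continuous_pair continuous_intros continuous_on_subset[OF c_cont sub]) auto
        show "continuous_on {\<epsilon>..T} (\<lambda>t. S (\<eta> n) (c t))"
          using \<eta>[of n] T_pos by (intro S_continuous_pair continuous_intros continuous_on_subset[OF c_cont sub]) auto
      qed
      fix t assume "t \<in> {\<epsilon>..T}"
      then show "A (S (\<eta> n) (mild u0 g t)) - A (S (\<eta> n + t) u0) - (S (\<eta> n + t) (c t) - S (\<eta> n) (c t)) = A (S (\<eta> n) (z t))"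
        using AS_mild[OF g \<xi> _ _ \<eta>(1)[of n], where t = t and ?u0.0 = u0 and x = "c t"] \<epsilon> by (simp add: z_def)
    qed
    then show "\<forall>\<^sub>F n in sequentially. continuous_on {\<epsilon>..T} (\<lambda>t. A (S (\<eta> n) (z t)))" by simp
    obtain D \<kappa> where D: "0 < \<kappa>" "0 \<le> D" "\<And>t \<eta>1 \<eta>2. \<epsilon> \<le> t \<Longrightarrow> t \<le> T \<Longrightarrow> 0 < \<eta>1 \<Longrightarrow> \<eta>1 \<le> \<eta>2 \<Longrightarrow> \<eta>2 \<le> T \<Longrightarrow>
        norm (A (S \<eta>2 (z t)) - A (S \<eta>1 (z t))) \<le> D * \<eta>2 powr \<kappa>"
      using rate[OF \<epsilon>] by blast
    have bound: "norm (A (S (\<eta> m) (z t)) - y t) \<le> D * \<eta> m powr \<kappa>" if t: "t \<in> {\<epsilon>..T}" for m t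
    proof (rule tendsto_upperbound)
      show "(\<lambda>n. norm (A (S (\<eta> m) (z t)) - A (S (\<eta> n) (z t)))) \<longlonglongrightarrow> norm (A (S (\<eta> m) (z t)) - y t)"
        using t \<epsilon> by (intro tendsto_intros y) auto
      show "\<forall>\<^sub>F n in sequentially. norm (A (S (\<eta> m) (z t)) - A (S (\<eta> n) (z t))) \<le> D * \<eta> m powr \<kappa>"
        unfolding eventually_sequentially using t D(3)[OF _ _ \<eta>(1) \<eta>_mono \<eta>(2)] by (intro exI[of _ m]) auto
    qed simp
    show "uniform_limit {\<epsilon>..T} (\<lambda>n t. A (S (\<eta> n) (z t))) y sequentially"
    proof (rule uniform_limitI)
      fix e :: real assume "0 < e"
      then have "\<forall>\<^sub>F n in sequentially. D * \<eta> n powr \<kappa> < e"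
        by (rule order_tendstoD(2)[OF null[OF D(1)]])
      then show "\<forall>\<^sub>F n in sequentially. \<forall>t\<in>{\<epsilon>..T}. dist (A (S (\<eta> n) (z t))) (y t) < e"
        by eventually_elim (use le_less_trans[OF bound] in \<open>simp add: dist_norm\<close>)
    qed
  qed simp
  have "continuous_on {\<epsilon>..T} (\<lambda>t. A (mild u0 g t))" if \<epsilon>: "0 < \<epsilon>" for \<epsilon>
  proof (rule continuous_on_eq)
    have sub: "{\<epsilon>..T} \<subseteq> {0<..T}" using \<epsilon> by auto
    show "continuous_on {\<epsilon>..T} (\<lambda>t. A (S t u0) + y t + (S t (c t) - c t))"
      using \<epsilon> T_pos by (intro continuous_on_add continuous_on_diff y_cont S_continuous_pair continuous_on_id
        continuous_on_subset[OF c_cont sub] continuous_on_subset[OF AS_continuous]) auto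
    show "A (S t u0) + y t + (S t (c t) - c t) = A (mild u0 g t)" if "t \<in> {\<epsilon>..T}" for t
      using D(2)[of t] that \<epsilon> by simp
  qed
  then have *: "continuous_on {t/2..T} (\<lambda>t. A (mild u0 g t))" if "0 < t" for t using that by simp
  show "continuous_on {0<..T} (\<lambda>t. A (mild u0 g t))"
    unfolding continuous_on_eq_continuous_within
  proof
    fix t assume t: "t \<in> {0<..T}"
    have "continuous (at t within {t/2..T}) (\<lambda>t. A (mild u0 g t))"
      using *[of t] t by (auto simp: continuous_on_eq_continuous_within)
    moreover have "at t within {t/2..T} = at t within {0<..T}"
      using t by (intro at_within_nhd[of _ "{t/2<..}"]) auto
    ultimately show "continuous (at t within {0<..T}) (\<lambda>t. A (mild u0 g t))" by (simp add: continuous_within)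
  qed
qed

text \<open>The increment is estimated between any two times \<open>t1 \<le> t2\<close> close to
  \<open>t\<close> and always restarted at the earlier one, so that left and right derivatives are
  covered by one estimate. It uses that \<open>A\<close> after the mild solution and
  \<open>g\<close> are continuous at \<open>t\<close>, and that orbits of \<open>S\<close> are
  continuous at 0.\<close>

lemma mild_has_derivative:
  assumes g: "forcing \<xi> G g" and \<xi>: "0 \<le> \<xi>" "\<xi> < 1" and D: "\<And>t. 0 < t \<Longrightarrow> t \<le> T \<Longrightarrow> mild u0 g t \<in> Dom"
    and cont: "continuous_on {0<..T} (\<lambda>t. A (mild u0 g t))" and t: "0 < t" "t \<le> T"
  shows "(mild u0 g has_vector_derivative (A (mild u0 g t) + g t)) (at t within {0<..T})"
proof -
  define a where "a = A (mild u0 g t)"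
  define u where "u = mild u0 g"
  have main: "\<exists>d>0. \<forall>t1 t2. 0 < t1 \<and> t1 \<le> t2 \<and> t2 \<le> T \<and> \<bar>t1 - t\<bar> < d \<and> \<bar>t2 - t\<bar> < d \<longrightarrow>
      norm (u t2 - u t1 - (t2 - t1) *\<^sub>R (a + g t)) \<le> e * (t2 - t1)" if e: "0 < e" for e
  proof -
    \<comment> \<open>The factor \<open>M + 1\<close> compensates for the operator bound of
      \<open>S\<close>: the deviation at the nearby time and the deviation of the orbit from its
      start are then each at most \<open>e / 4\<close>.\<close>
    define e' where "e' = e / 4 / (M + 1)"
    have e': "0 < e'" "M * e' \<le> e / 4"
      using e M_pos by (auto simp: e'_def field_simps)
    have "\<forall>\<^sub>F r in at_right 0. norm (S r a - a) < e / 4 \<and> norm (S r (g t) - g t) < e / 4"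
      using tendstoD[OF S_tendsto_0[of a], of "e / 4"] tendstoD[OF S_tendsto_0[of "g t"], of "e / 4"] e
      by (intro eventually_conj) (auto simp: dist_norm)
    then obtain d1 where d1: "0 < d1" "\<And>r. 0 < r \<Longrightarrow> r < d1 \<Longrightarrow> norm (S r a - a) < e / 4 \<and> norm (S r (g t) - g t) < e / 4"
      unfolding eventually_at_right_field by auto
    obtain d2 where d2: "0 < d2" "\<And>s. 0 < s \<Longrightarrow> s \<le> T \<Longrightarrow> \<bar>s - t\<bar> < d2 \<Longrightarrow> norm (A (u s) - a) < e'"
      using cont[unfolded continuous_on_iff, rule_format, of t e'] t e' unfolding a_def u_def
      by (auto simp: dist_norm)
    obtain d3 where d3: "0 < d3" "\<And>s. 0 < s \<Longrightarrow> s \<le> T \<Longrightarrow> \<bar>s - t\<bar> < d3 \<Longrightarrow> norm (g s - g t) < e'"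
      using forcing_continuous[OF g order_refl, unfolded continuous_on_iff, rule_format, of t e'] t e'
      by (auto simp: dist_norm)
    define d where "d = Min {d1 / 2, d2, d3}"
    have d: "0 < d" "2 * d \<le> d1" "d \<le> d2" "d \<le> d3" using d1 d2 d3 by (auto simp: d_def)
    have "norm (u t2 - u t1 - (t2 - t1) *\<^sub>R (a + g t)) \<le> e * (t2 - t1)"
      if h: "0 < t1" "t1 \<le> t2" "t2 \<le> T" "\<bar>t1 - t\<bar> < d" "\<bar>t2 - t\<bar> < d" for t1 t2
    proof -
      have near: "norm (S r v - v') \<le> e / 2" if r: "0 \<le> r" "r \<le> t2 - t1" and v: "norm (v - v') < e'"
          and v': "v' = a \<or> v' = g t" for r v v'
      proof -
        have rT: "r \<le> 2 * T" "r < d1" using r h d by auto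
        have "norm (S r v - S r v') \<le> M * norm (v - v')" using S_bound[OF r(1) rT(1), of "v - v'"] r by (simp add: S_diff)
        also have "\<dots> \<le> M * e'" using v M_pos by (intro mult_left_mono) auto
        also have "\<dots> \<le> e / 4" by (rule e'(2))
        finally have "norm (S r v - S r v') \<le> e / 4" .
        moreover have "norm (S r v' - v') \<le> e / 4"
          using d1(2)[of r] r rT v' e by (cases "r = 0") auto
        ultimately show ?thesis
          using norm_triangle_ineq[of "S r v - S r v'" "S r v' - v'"] by simp
      qed
      have u1: "u t1 \<in> Dom" using D h unfolding u_def by simp
      have h0: "0 \<le> t2 - t1" using h by simp
      have i1: "norm (S (t2 - t1) (u t1) - u t1 - (t2 - t1) *\<^sub>R a) \<le> e / 2 * (t2 - t1)"
      proof -
        have "((\<lambda>s. S s (A (u t1)) - a) has_integral (S (t2 - t1) (u t1) - u t1) - (t2 - t1) *\<^sub>R a) {0..t2 - t1}"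
          using has_integral_diff[OF S_integral_Dom[OF u1 h0] has_integral_const_real[of a 0 "t2 - t1"]] h0 by simp
        then have eq: "integral {0..t2 - t1} (\<lambda>s. S s (A (u t1)) - a) = S (t2 - t1) (u t1) - u t1 - (t2 - t1) *\<^sub>R a"
          by (rule integral_unique)
        have "norm (A (u t1) - a) < e'" using h d by (intro d2(2)) auto
        then have "norm (integral {0..t2 - t1} (\<lambda>s. S s (A (u t1)) - a)) \<le> e / 2 * (t2 - t1 - 0)"
          by (intro integral_bound h0 continuous_intros continuous_on_subset[OF S_continuous] near) auto
        then show ?thesis by (simp add: eq)
      qed
      have i2: "norm (integral {t1..t2} (\<lambda>s. S (t2 - s) (g s)) - (t2 - t1) *\<^sub>R g t) \<le> e / 2 * (t2 - t1)"
      proof -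
        note c = step_integral_continuous[OF g h(1-3)]
        have "((\<lambda>s. S (t2 - s) (g s) - g t) has_integral integral {t1..t2} (\<lambda>s. S (t2 - s) (g s)) - (t2 - t1) *\<^sub>R g t) {t1..t2}"
          using has_integral_diff[OF integrable_integral[OF integrable_continuous_real[OF c]] has_integral_const_real[of "g t" t1 t2]] h by simp
        then have eq: "integral {t1..t2} (\<lambda>s. S (t2 - s) (g s) - g t) = integral {t1..t2} (\<lambda>s. S (t2 - s) (g s)) - (t2 - t1) *\<^sub>R g t"
          by (rule integral_unique)
        have "norm (integral {t1..t2} (\<lambda>s. S (t2 - s) (g s) - g t)) \<le> e / 2 * (t2 - t1)"
        proof (rule integral_bound[OF h(2)])
          show "continuous_on {t1..t2} (\<lambda>s. S (t2 - s) (g s) - g t)" by (intro continuous_intros c)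
          fix s assume s: "s \<in> {t1..t2}"
          have "norm (g s - g t) < e'" using s h d by (intro d3(2)) auto
          then show "norm (S (t2 - s) (g s) - g t) \<le> e / 2" using s by (intro near) auto
        qed
        then show ?thesis by (simp add: eq)
      qed
      have eq: "u t2 - u t1 - (t2 - t1) *\<^sub>R (a + g t) = (S (t2 - t1) (u t1) - u t1 - (t2 - t1) *\<^sub>R a) +
          (integral {t1..t2} (\<lambda>s. S (t2 - s) (g s)) - (t2 - t1) *\<^sub>R g t)"
        unfolding u_def mild_step[OF g \<xi>(2) less_imp_le[OF h(1)] h(2,3)] by (simp add: scaleR_add_right)
      have "norm (u t2 - u t1 - (t2 - t1) *\<^sub>R (a + g t)) \<le> e / 2 * (t2 - t1) + e / 2 * (t2 - t1)"
        unfolding eq by (rule norm_triangle_le[OF add_mono[OF i1 i2]])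
      then show ?thesis by (simp add: field_simps)
    qed
    with d(1) show ?thesis by blast
  qed
  show ?thesis
    unfolding has_vector_derivative_def has_derivative_within_alt
  proof (intro conjI allI impI)
    show "bounded_linear (\<lambda>h. h *\<^sub>R (A (mild u0 g t) + g t))" by (rule bounded_linear_scaleR_left)
    fix e :: real assume "0 < e"
    then obtain d where d: "0 < d" "\<And>t1 t2. 0 < t1 \<Longrightarrow> t1 \<le> t2 \<Longrightarrow> t2 \<le> T \<Longrightarrow> \<bar>t1 - t\<bar> < d \<Longrightarrow> \<bar>t2 - t\<bar> < d \<Longrightarrow>
        norm (u t2 - u t1 - (t2 - t1) *\<^sub>R (a + g t)) \<le> e * (t2 - t1)"
      using main by metis
    have "norm (u s - u t - (s - t) *\<^sub>R (a + g t)) \<le> e * norm (s - t)" if s: "s \<in> {0<..T}" "norm (s - t) < d" for s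
    proof (cases "s \<le> t")
      case True
      have eq: "u s - u t - (s - t) *\<^sub>R (a + g t) = - (u t - u s - (t - s) *\<^sub>R (a + g t))"
        by (simp add: algebra_simps)
      have "norm (u s - u t - (s - t) *\<^sub>R (a + g t)) = norm (u t - u s - (t - s) *\<^sub>R (a + g t))"
        by (simp only: eq norm_minus_cancel)
      also have "\<dots> \<le> e * (t - s)"
        using s t True d(1) by (intro d(2)) auto
      also have "t - s = norm (s - t)" using True by simp
      finally show ?thesis .
    qed (use d(2)[of t s] s t d(1) in auto)
    then show "\<exists>d>0. \<forall>s\<in>{0<..T}. norm (s - t) < d \<longrightarrow>
        norm (mild u0 g s - mild u0 g t - (s - t) *\<^sub>R (A (mild u0 g t) + g t)) \<le> e * norm (s - t)"
      using d(1) unfolding u_def a_def by blast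
  qed
qed

text \<open>The bound is of order \<open>\<tau> powr (\<gamma> - 2)\<close> with
  \<open>\<tau> = \<eta> + (t - s)\<close>. The gain \<open>\<gamma>\<close> is halved: the exponent
  \<open>\<gamma> / 2 - 1\<close> goes to \<open>\<eta>\<close> and the same to
  \<open>t - s\<close>, so both are integrable.\<close>

lemma regular_forcing_interp:
  assumes bound: "\<And>s \<tau>. 0 < s \<Longrightarrow> s \<le> T \<Longrightarrow> 0 < \<tau> \<Longrightarrow> \<tau> \<le> 2 * T \<Longrightarrow>
      norm (A (S \<tau> (g s))) \<le> N * \<tau> powr (\<gamma> - 1) * s powr - \<xi>"
    and \<gamma>: "0 < \<gamma>" "\<gamma> \<le> 1" and N: "0 \<le> N"
  shows "regular_forcing \<xi> g (\<lambda>_. 0)"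
  unfolding regular_forcing_def
proof (intro conjI allI impI continuous_on_const)
  fix \<epsilon> :: real assume "0 < \<epsilon>"
  define K where "K = 2 * M * N * (1/2) powr (\<gamma> - 1)"
  have K: "0 \<le> K" using M_pos N by (simp add: K_def)
  have "norm (AAS (\<eta> + (t - s)) (g s - 0)) \<le> K * \<eta> powr (\<gamma> / 2 - 1) * ((t - s) powr (\<gamma> / 2 - 1) * s powr - \<xi>)"
    if h: "t \<le> T" "0 < s" "s < t" "0 < \<eta>" "\<eta> \<le> T" for t s \<eta>
  proof -
    define \<tau> where "\<tau> = \<eta> + (t - s)"
    have \<tau>: "0 < \<tau>" "\<tau> \<le> 2 * T" using h by (auto simp: \<tau>_def)
    have "norm (AAS \<tau> (g s)) \<le> 2 * M / \<tau> * norm (A (S (\<tau> / 2) (g s)))"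
      using \<tau> T_pos by (intro norm_AAS_le) auto
    also have "\<dots> \<le> 2 * M / \<tau> * (N * (\<tau> / 2) powr (\<gamma> - 1) * s powr - \<xi>)"
      using bound[of s "\<tau> / 2"] h \<tau> M_pos by (intro mult_left_mono) auto
    also have "(\<tau> / 2) powr (\<gamma> - 1) = \<tau> powr (\<gamma> - 1) * (1/2) powr (\<gamma> - 1)"
      using \<tau> powr_mult[of \<tau> "1/2" "\<gamma> - 1"] by simp
    also have "2 * M / \<tau> * (N * (\<tau> powr (\<gamma> - 1) * (1/2) powr (\<gamma> - 1)) * s powr - \<xi>) = K * (\<tau> powr (\<gamma> - 1) * \<tau> powr - 1) * s powr - \<xi>"
      using \<tau> by (simp add: K_def)
    also have "\<tau> powr (\<gamma> - 1) * \<tau> powr - 1 = (\<eta> + (t - s)) powr ((\<gamma> / 2 - 1) + (\<gamma> / 2 - 1))"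
    proof -
      have "\<gamma> - 1 + - 1 = (\<gamma> / 2 - 1) + (\<gamma> / 2 - 1)" by simp
      then show ?thesis by (simp only: \<tau>_def powr_add[symmetric])
    qed
    also have "K * \<dots> * s powr - \<xi> \<le> K * (\<eta> powr (\<gamma> / 2 - 1) * (t - s) powr (\<gamma> / 2 - 1)) * s powr - \<xi>"
      using h \<gamma> K by (intro mult_right_mono mult_left_mono powr_add_le) auto
    finally show ?thesis by (simp add: \<tau>_def mult_ac)
  qed
  then show "\<exists>K \<kappa> \<nu>. 0 < \<kappa> \<and> 0 < \<nu> \<and> 0 \<le> K \<and> (\<forall>t s \<eta>. \<epsilon> \<le> t \<and> t \<le> T \<and> 0 < s \<and> s < t \<and> 0 < \<eta> \<and> \<eta> \<le> T \<longrightarrow>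
        norm (AAS (\<eta> + (t - s)) (g s - 0)) \<le> K * \<eta> powr (\<kappa> - 1) * ((t - s) powr (\<nu> - 1) * s powr - \<xi>))"
    using K \<gamma> by (intro exI[of _ K] exI[of _ "\<gamma> / 2"]) auto
qed

text \<open>Here \<open>AAS\<close> costs \<open>\<tau> powr - 2\<close>. The exponent
  \<open>\<mu> / 2 - 1\<close> goes to \<open>\<eta>\<close> and \<open>- 1 - \<mu> / 2\<close> to
  \<open>t - s\<close>; the Hoelder factor \<open>(t - s) powr \<mu>\<close> raises the latter to
  \<open>\<mu> / 2 - 1\<close>.\<close>

lemma regular_forcing_hoelder:
  assumes g: "forcing \<xi> G g" and \<xi>: "0 \<le> \<xi>" and \<mu>: "0 < \<mu>" "\<mu> \<le> 1"
    and hoelder: "\<And>\<epsilon>. 0 < \<epsilon> \<Longrightarrow> \<exists>H\<ge>0. \<forall>t1 t2. \<epsilon> \<le> t1 \<longrightarrow> t1 < t2 \<longrightarrow> t2 \<le> T \<longrightarrow> norm (g t2 - g t1) \<le> H * (t2 - t1) powr \<mu>"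
  shows "regular_forcing \<xi> g g"
  unfolding regular_forcing_def
proof (intro conjI allI impI forcing_continuous[OF g order_refl])
  fix \<epsilon> :: real assume \<epsilon>: "0 < \<epsilon>"
  then have e2: "0 < \<epsilon> / 2" by simp
  obtain H where H: "0 \<le> H" "\<And>t1 t2. \<epsilon> / 2 \<le> t1 \<Longrightarrow> t1 < t2 \<Longrightarrow> t2 \<le> T \<Longrightarrow> norm (g t2 - g t1) \<le> H * (t2 - t1) powr \<mu>"
    using hoelder[OF e2] by blast
  have G: "0 \<le> G" by (rule forcing_nonneg[OF g])
  \<comment> \<open>The first summand serves \<open>s \<ge> \<epsilon> / 2\<close>, where
    \<open>g\<close> is Hoelder continuous. For \<open>s < \<epsilon> / 2\<close> one has
    \<open>t - s \<ge> \<epsilon> / 2\<close>, and the size bound of the forcing gives the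
    second.\<close>
  define L where "L = H * T powr \<xi> + 2 * G / (\<epsilon> / 2) powr \<mu>"
  have L: "0 \<le> L" using H(1) G by (simp add: L_def)
  have diff: "norm (g s - g t) \<le> L * (t - s) powr \<mu> * s powr - \<xi>" if h: "\<epsilon> \<le> t" "t \<le> T" "0 < s" "s < t" for t s
  proof (cases "\<epsilon> / 2 \<le> s")
    case True
    have "1 \<le> T powr \<xi> * s powr - \<xi>"
      using powr_mono2[of \<xi> s T] h \<xi> by (simp add: powr_minus divide_simps)
    then have "H * (t - s) powr \<mu> * 1 \<le> H * (t - s) powr \<mu> * (T powr \<xi> * s powr - \<xi>)"
      using H(1) by (intro mult_left_mono) auto
    moreover have "norm (g s - g t) \<le> H * (t - s) powr \<mu>" using H(2)[OF True h(4,2)] by (simp add: norm_minus_commute)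
    ultimately have "norm (g s - g t) \<le> (H * T powr \<xi>) * ((t - s) powr \<mu> * s powr - \<xi>)" by (simp add: mult_ac)
    also have "\<dots> \<le> L * ((t - s) powr \<mu> * s powr - \<xi>)"
      using G by (intro mult_right_mono) (auto simp: L_def)
    finally show ?thesis by (simp add: mult.assoc)
  next
    case False
    then have ts: "\<epsilon> / 2 \<le> t - s" using h by simp
    have "norm (g t) \<le> G * t powr - \<xi>" using forcing_bound[OF g, of t] h by simp
    also have "\<dots> \<le> G * s powr - \<xi>" using h \<xi> G by (intro mult_left_mono powr_mono2') auto
    finally have "norm (g s - g t) \<le> 2 * G * s powr - \<xi>"
      using forcing_bound[OF g, of s] h norm_triangle_ineq4[of "g s" "g t"] by simp
    also have "\<dots> = 2 * G / (\<epsilon> / 2) powr \<mu> * ((\<epsilon> / 2) powr \<mu> * s powr - \<xi>)" using \<epsilon> by simp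
    also have "\<dots> \<le> 2 * G / (\<epsilon> / 2) powr \<mu> * ((t - s) powr \<mu> * s powr - \<xi>)"
      using ts \<mu> G \<epsilon> by (intro mult_left_mono mult_right_mono powr_mono2) auto
    also have "\<dots> \<le> L * ((t - s) powr \<mu> * s powr - \<xi>)"
      using H(1) by (intro mult_right_mono) (auto simp: L_def)
    finally show ?thesis by (simp add: mult.assoc)
  qed
  define K where "K = 4 * M * M * L"
  have K: "0 \<le> K" using L M_pos by (simp add: K_def)
  have "norm (AAS (\<eta> + (t - s)) (g s - g t)) \<le> K * \<eta> powr (\<mu> / 2 - 1) * ((t - s) powr (\<mu> / 2 - 1) * s powr - \<xi>)"
    if h: "\<epsilon> \<le> t" "t \<le> T" "0 < s" "s < t" "0 < \<eta>" "\<eta> \<le> T" for t s \<eta>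
  proof -
    define \<tau> where "\<tau> = \<eta> + (t - s)"
    have \<tau>: "0 < \<tau>" "\<tau> \<le> 2 * T" using h by (auto simp: \<tau>_def)
    have "norm (AAS \<tau> (g s - g t)) \<le> 2 * M / \<tau> * norm (A (S (\<tau> / 2) (g s - g t)))"
      using \<tau> T_pos by (intro norm_AAS_le) auto
    also have "\<dots> \<le> 2 * M / \<tau> * (M / (\<tau> / 2) * norm (g s - g t))"
      using \<tau> T_pos M_pos by (intro mult_left_mono AS_bound) auto
    also have "\<dots> \<le> 2 * M / \<tau> * (M / (\<tau> / 2) * (L * (t - s) powr \<mu> * s powr - \<xi>))"
      using \<tau> M_pos by (intro mult_left_mono diff h) auto
    also have "\<dots> = K * \<tau> powr - 2 * ((t - s) powr \<mu> * s powr - \<xi>)"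
    proof -
      have "\<tau> powr - 2 = 1 / \<tau> * (1 / \<tau>)" using \<tau> by (simp add: powr_minus_divide power2_eq_square)
      then show ?thesis by (simp add: K_def)
    qed
    also have "\<tau> powr - 2 = (\<eta> + (t - s)) powr ((\<mu> / 2 - 1) + (- 1 - \<mu> / 2))" by (simp add: \<tau>_def)
    also have "K * \<dots> * ((t - s) powr \<mu> * s powr - \<xi>) \<le>
        K * (\<eta> powr (\<mu> / 2 - 1) * (t - s) powr (- 1 - \<mu> / 2)) * ((t - s) powr \<mu> * s powr - \<xi>)"
      using h \<mu> K by (intro mult_right_mono mult_left_mono powr_add_le) auto
    also have "\<dots> = K * \<eta> powr (\<mu> / 2 - 1) * (((t - s) powr (- 1 - \<mu> / 2) * (t - s) powr \<mu>) * s powr - \<xi>)"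
      by (simp only: mult_ac)
    also have "(t - s) powr (- 1 - \<mu> / 2) * (t - s) powr \<mu> = (t - s) powr (\<mu> / 2 - 1)"
      by (simp flip: powr_add)
    finally show ?thesis by (simp add: \<tau>_def)
  qed
  then show "\<exists>K \<kappa> \<nu>. 0 < \<kappa> \<and> 0 < \<nu> \<and> 0 \<le> K \<and> (\<forall>t s \<eta>. \<epsilon> \<le> t \<and> t \<le> T \<and> 0 < s \<and> s < t \<and> 0 < \<eta> \<and> \<eta> \<le> T \<longrightarrow>
        norm (AAS (\<eta> + (t - s)) (g s - g t)) \<le> K * \<eta> powr (\<kappa> - 1) * ((t - s) powr (\<nu> - 1) * s powr - \<xi>))"
    using K \<mu> by (intro exI[of _ K] exI[of _ "\<mu> / 2"]) auto
qed

lemma powr_tendsto_0_right: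
  fixes p :: real
  assumes "0 < p"
  shows "((\<lambda>t. a * t powr p) \<longlongrightarrow> 0) (at_right 0)"
proof -
  have "((\<lambda>t::real. t powr p) \<longlongrightarrow> 0 powr p) (at_right 0)"
    using assms by (intro tendsto_powr') (auto simp: eventually_at_filter)
  then show ?thesis by (auto intro: tendsto_mult_right_zero)
qed

lemma mild_0 [simp]: "mild x g 0 = x"
  by (simp add: mild_def conv_def)

end

section \<open>Continuity at the initial time\<close>

context smoothing_space
begin

text \<open>On the domain the graph norm reduces the claim to strong continuity in
  \<open>E_0\<close>, applied to \<open>y\<close> and to \<open>A y\<close>. Density of the domain
  in \<open>X\<close> and the uniform bound \<open>c\<close> for \<open>S t\<close> on
  \<open>X\<close> extend it to all of \<open>X\<close>.\<close>

lemma S_nrm_tendsto_0: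
  assumes x: "x \<in> carr X"
  shows "((\<lambda>t. nrm X (S t x - x)) \<longlongrightarrow> 0) (at_right 0)"
proof (rule tendstoI)
  fix e :: real assume e: "0 < e"
  define d where "d = e / 2 / (c + 1)"
  have c1: "c + 1 \<noteq> 0" using c_pos by simp
  have "(c + 1) * d = e / 2"
    unfolding d_def using c1 by (subst times_divide_eq_right, intro nonzero_mult_div_cancel_left)
  moreover have "0 < d" using e c_pos by (simp add: d_def)
  ultimately have d: "0 < d" "(c + 1) * d = e / 2" by auto
  obtain y where y: "y \<in> Dom" "nrm X (x - y) < d" using Dom_dense[OF x d(1)] by blast
  note yX = Dom_mem[OF y(1)]
  have "((\<lambda>t. c * (norm (S t y - y) + norm (S t (A y) - A y))) \<longlongrightarrow> c * (0 + 0)) (at_right 0)"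
    by (intro tendsto_intros tendsto_norm_zero LIM_zero S_tendsto_0)
  then have "\<forall>\<^sub>F t in at_right 0. c * (norm (S t y - y) + norm (S t (A y) - A y)) < e / 2"
    using e by (intro order_tendstoD(2)) auto
  moreover have "\<forall>\<^sub>F t in at_right 0. t < 2 * T"
    using T_pos by (intro eventually_at_right_less[THEN eventually_mono] order_tendstoD(2)[OF tendsto_ident_at]) auto
  ultimately show "\<forall>\<^sub>F t in at_right 0. dist (nrm X (S t x - x)) 0 < e"
    using eventually_ge0
  proof eventually_elim
    case (elim t)
    then have t: "0 \<le> t" "t \<le> 2 * T" by auto
    have Sx: "S t x \<in> carr X" and Sy: "S t y \<in> carr X" using S_nrm[OF t] x yX by auto
    have 1: "nrm X (S t x - S t y) \<le> c * nrm X (x - y)"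
      using S_nrm[OF t diff_mem[OF x yX]] t by (simp add: S_diff)
    have 2: "nrm X (S t y - y) \<le> c * (norm (S t y - y) + norm (S t (A y) - A y))"
      using nrm_le_graph[OF A_diff(1)[OF S_Dom(1)[OF y(1) t(1)] y(1)]] A_diff(2)[OF S_Dom(1)[OF y(1) t(1)] y(1)]
        S_Dom(2)[OF y(1) t(1)] by simp
    have "nrm X (S t x - x) \<le> nrm X (S t x - S t y) + nrm X (S t y - x)"
      by (rule nrm_diff_triangle[OF Sx Sy x])
    also have "nrm X (S t y - x) \<le> nrm X (S t y - y) + nrm X (y - x)"
      by (rule nrm_diff_triangle[OF Sy yX x])
    also have "nrm X (y - x) = nrm X (x - y)" by (rule nrm_diff_commute[OF yX x])
    finally have "nrm X (S t x - x) \<le> (c + 1) * nrm X (x - y) + c * (norm (S t y - y) + norm (S t (A y) - A y))"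
      using 1 2 by (simp add: distrib_right)
    also have "\<dots> < (c + 1) * d + e / 2"
      using y(2) c_pos elim by (intro add_strict_mono mult_strict_left_mono) auto
    finally show ?case using d(2) nrm_ge0[OF diff_mem[OF Sx x]] by simp
  qed
qed

lemma mild_continuous_at_0:
  assumes g: "forcing \<xi> G g" and \<xi>: "0 \<le> \<xi>" "\<xi> < 1" and \<gamma>: "0 \<le> \<gamma>" "\<gamma> < 1" and \<alpha>: "\<alpha> < 1 + \<gamma> - \<xi>"
    and bound: "\<And>s \<tau>. 0 < s \<Longrightarrow> s \<le> T \<Longrightarrow> 0 < \<tau> \<Longrightarrow> \<tau> \<le> 2 * T \<Longrightarrow>
      norm (A (S \<tau> (g s))) \<le> N * \<tau> powr (\<gamma> - 1) * s powr - \<xi>"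
    and x: "x \<in> carr X"
  shows "continuous_map (top_of_set {0..T}) (ntop X) (mild x g)"
  unfolding continuous_map_ntop_iff
proof (intro ballI conjI)
  fix t assume t: "t \<in> {0..T}"
  show "mild x g t \<in> carr X"
    using mild_mem[OF \<xi>(2) g, of t x] t x by (cases "t = 0") auto
  show "((\<lambda>s. nrm X (mild x g s - mild x g t)) \<longlongrightarrow> 0) (at t within {0..T})"
  proof (cases "t = 0")
    case False
    then have "((\<lambda>s. nrm X (mild x g s - mild x g t)) \<longlongrightarrow> 0) (at t within {0<..T})"
      using mild_continuous[OF \<xi> g, of x] t unfolding continuous_map_ntop_iff by auto
    moreover have "at t within {0..T} = at t within {0<..T}"
      using t False by (intro at_within_nhd[of _ "{0<..}"]) auto
    ultimately show ?thesis by simp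
  next
    case True
    define m where "m = max \<alpha> \<gamma>"
    \<comment> \<open>The midpoint lies strictly above both \<open>\<alpha>\<close> and
      \<open>\<gamma>\<close> and strictly below both 1 and \<open>1 + \<gamma> - \<xi>\<close>. The
      last inequality makes the exponent \<open>1 - (\<beta> - \<gamma>) - \<xi>\<close> positive,
      so that the convolution vanishes at 0 in \<open>X\<close>.\<close>
    define \<beta> where "\<beta> = (m + min 1 (1 + \<gamma> - \<xi>)) / 2"
    have \<beta>: "\<alpha> < \<beta>" "\<gamma> \<le> \<beta>" "\<beta> < 1" "\<beta> < 1 + \<gamma> - \<xi>"
      using \<alpha> \<gamma> \<xi> \<alpha>_less1 by (auto simp: \<beta>_def m_def max_def min_def field_simps)
    obtain k where k: "0 < k" "\<And>w N. decay \<beta> N w \<Longrightarrow> w \<in> carr X" "\<And>w N \<tau>. decay \<beta> N w \<Longrightarrow> 0 < \<tau> \<Longrightarrow> \<tau> \<le> T \<Longrightarrow>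
        nrm X w \<le> k * (\<tau> powr - \<alpha> * norm w + N * \<tau> powr (\<beta> - \<alpha>))"
      by (rule nrm_le_decay[OF \<beta>(1) less_imp_le[OF \<beta>(3)]]) (rule that)
    define B1 where "B1 = k * T powr - \<alpha> * (M * G * Beta (1 - \<xi>) 1)"
    define B2 where "B2 = k * T powr (\<beta> - \<alpha>) * (N * Beta (1 - \<xi>) (1 - (\<beta> - \<gamma>)))"
    have conv_le: "conv g s \<in> carr X \<and> nrm X (conv g s) \<le> B1 * s powr (1 - \<xi>) + B2 * s powr (1 - (\<beta> - \<gamma>) - \<xi>)"
      if s: "0 < s" "s \<le> T" for s
    proof
      have d: "decay \<beta> (N * Beta (1 - \<xi>) (1 - (\<beta> - \<gamma>)) * s powr (1 - (\<beta> - \<gamma>) - \<xi>)) (conv g s)"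
        using \<beta> \<gamma> by (intro decay_conv[OF g \<xi>(2) s _ _ _ bound]) auto
      show "conv g s \<in> carr X" by (rule k(2)[OF d])
      have "nrm X (conv g s) \<le> k * (T powr - \<alpha> * norm (conv g s) +
          N * Beta (1 - \<xi>) (1 - (\<beta> - \<gamma>)) * s powr (1 - (\<beta> - \<gamma>) - \<xi>) * T powr (\<beta> - \<alpha>))"
        by (rule k(3)[OF d T_pos order_refl])
      also have "\<dots> \<le> k * (T powr - \<alpha> * (M * G * Beta (1 - \<xi>) 1 * s powr (1 - \<xi>)) +
          N * Beta (1 - \<xi>) (1 - (\<beta> - \<gamma>)) * s powr (1 - (\<beta> - \<gamma>) - \<xi>) * T powr (\<beta> - \<alpha>))"
        using k(1) by (intro mult_left_mono add_right_mono norm_conv_le[OF g \<xi>(2) s]) auto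
      also have "\<dots> = B1 * s powr (1 - \<xi>) + B2 * s powr (1 - (\<beta> - \<gamma>) - \<xi>)"
        by (simp add: B1_def B2_def algebra_simps)
      finally show "nrm X (conv g s) \<le> B1 * s powr (1 - \<xi>) + B2 * s powr (1 - (\<beta> - \<gamma>) - \<xi>)" .
    qed
    have p: "0 < 1 - \<xi>" "0 < 1 - (\<beta> - \<gamma>) - \<xi>" using \<xi> \<beta> by auto
    have lim: "((\<lambda>s. nrm X (S s x - x) + (B1 * s powr (1 - \<xi>) + B2 * s powr (1 - (\<beta> - \<gamma>) - \<xi>))) \<longlongrightarrow> 0) (at_right 0)"
      using tendsto_add[OF S_nrm_tendsto_0[OF x] tendsto_add[OF powr_tendsto_0_right[OF p(1)] powr_tendsto_0_right[OF p(2)]]]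
      by simp
    have bd: "norm (nrm X (mild x g s - x)) \<le> nrm X (S s x - x) + (B1 * s powr (1 - \<xi>) + B2 * s powr (1 - (\<beta> - \<gamma>) - \<xi>))"
      if s: "0 < s" "s \<le> T" for s
    proof -
      have Sx: "S s x - x \<in> carr X" using S_nrm[of s x] s T_pos x by (intro diff_mem) auto
      have eq: "mild x g s - x = (S s x - x) + conv g s" by (simp add: mild_def)
      have "nrm X (mild x g s - x) \<le> nrm X (S s x - x) + nrm X (conv g s)"
        unfolding eq using conv_le[OF s] by (intro nrm_triangle Sx) auto
      moreover have "0 \<le> nrm X (mild x g s - x)"
        unfolding eq using conv_le[OF s] by (intro nrm_ge0 add_mem Sx) auto
      ultimately show ?thesis using conv_le[OF s] by auto
    qed
    have "((\<lambda>s. nrm X (mild x g s - x)) \<longlongrightarrow> 0) (at 0 within {0<..T})"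
    proof (rule Lim_null_comparison)
      show "\<forall>\<^sub>F s in at 0 within {0<..T}. norm (nrm X (mild x g s - x)) \<le> nrm X (S s x - x) + (B1 * s powr (1 - \<xi>) + B2 * s powr (1 - (\<beta> - \<gamma>) - \<xi>))"
        unfolding eventually_at_filter using bd by (intro always_eventually) auto
      show "((\<lambda>s. nrm X (S s x - x) + (B1 * s powr (1 - \<xi>) + B2 * s powr (1 - (\<beta> - \<gamma>) - \<xi>))) \<longlongrightarrow> 0) (at 0 within {0<..T})"
        by (rule tendsto_within_subset[OF lim]) auto
    qed
    moreover have "at 0 within {0..T} = at 0 within {0<..T}"
    proof -
      have "{0..T} - {0} = {0<..T} - {0}" by auto
      then show ?thesis by (simp add: at_within_def)
    qed
    ultimately show ?thesis using True by simp
  qed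
qed

end

section \<open>From the structural hypotheses on \<open>f\<close> to the strong solution\<close>

lemma rpow_le:
  assumes "0 \<le> x" "x \<le> B" "0 \<le> a"
  shows "rpow x a \<le> 1 + B powr a"
  using assms powr_mono2[of a x B] by (auto simp: rpow_def intro: add_increasing)

text \<open>Away from 0 the mild solution is Hoelder continuous into \<open>X\<close> with exponent
  \<open>\<delta>\<close>. A change of time contributes the exponent \<open>\<theta>0\<close>, and a
  change of the argument contributes \<open>\<delta> * \<theta> j\<close> for each \<open>j\<close>.
  The common exponent \<open>\<mu>\<close> does not depend on \<open>\<epsilon>\<close>; only the
  constants do.\<close>

lemma (in semilinear_problem) superposition_hoelder:
  assumes J: "finite J" "\<And>j. j \<in> J \<Longrightarrow> 0 < \<theta> j \<and> \<theta> j \<le> q j"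
    and diff: "\<And>t u v. 0 < t \<Longrightarrow> t \<le> T \<Longrightarrow> u \<in> carr X \<Longrightarrow> v \<in> carr X \<Longrightarrow> norm (f t u - f t v) \<le>
      C' * (\<Sum>j\<in>J. (1 + rpow (nrm X u) (q j - \<theta> j) + rpow (nrm X v) (q j - \<theta> j)) * rpow (nrm X (u - v)) (\<theta> j))"
    and C': "0 \<le> C'" and \<theta>0: "0 < \<theta>0" "\<theta>0 < 1"
    and time: "\<And>R. 0 < R \<Longrightarrow> \<exists>KR>0. \<forall>t\<in>{0<..T}. \<forall>s\<in>{0<..T}. \<forall>u\<in>carr X \<inter> cball 0 R.
      norm (f t u - f s u) \<le> KR * \<bar>t - s\<bar> powr \<theta>0"
    and g: "forcing \<alpha> G g" and M2: "\<And>t. 0 < t \<Longrightarrow> t \<le> T \<Longrightarrow> nrm X (mild u0 g t) \<le> M2 * t powr - \<alpha>"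
  shows "\<exists>\<mu>. 0 < \<mu> \<and> \<mu> \<le> 1 \<and> (\<forall>\<epsilon>>0. \<exists>H\<ge>0. \<forall>t1 t2. \<epsilon> \<le> t1 \<longrightarrow> t1 < t2 \<longrightarrow> t2 \<le> T \<longrightarrow>
     norm (f t2 (mild u0 g t2) - f t1 (mild u0 g t1)) \<le> H * (t2 - t1) powr \<mu>)"
proof -
  define \<beta> where "\<beta> = (\<alpha> + 1) / 2"
  define \<delta> where "\<delta> = \<beta> - \<alpha>"
  have \<beta>: "\<alpha> < \<beta>" "\<beta> < 1" "0 < \<delta>" using \<alpha>_less1 by (auto simp: \<beta>_def \<delta>_def)
  define \<mu> where "\<mu> = Min (insert \<theta>0 ((\<lambda>j. \<delta> * \<theta> j) ` J))"
  have \<mu>: "0 < \<mu>" "\<mu> \<le> \<theta>0" using J \<theta>0 \<beta> by (auto simp: \<mu>_def)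
  have \<mu>\<theta>: "\<mu> \<le> \<delta> * \<theta> j" if "j \<in> J" for j
    unfolding \<mu>_def using J(1) that by (intro Min_le) auto
  define u where "u = mild u0 g"
  have u_mem: "u t \<in> carr X" if "0 < t" "t \<le> T" for t unfolding u_def by (rule mild_mem[OF \<alpha>_less1 g that])
  \<comment> \<open>The time-Hoelder hypothesis concerns balls of \<open>E_0\<close>; the mild
    solution remains in one such ball up to \<open>t = 0\<close>, although its norm in
    \<open>X\<close> may blow up.\<close>
  define R where "R = \<bar>M * norm u0 + M * G * Beta (1 - \<alpha>) 1 * T powr (1 - \<alpha>)\<bar> + 1"
  have R: "0 < R" by (simp add: R_def)
  have u_R: "norm (u t) \<le> R" if "0 < t" "t \<le> T" for t
    using mild_bounded[OF g, of t] that by (simp add: u_def R_def)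
  obtain KR where KR: "KR > 0" "\<And>t s u. t \<in> {0<..T} \<Longrightarrow> s \<in> {0<..T} \<Longrightarrow> u \<in> carr X \<inter> cball 0 R \<Longrightarrow>
      norm (f t u - f s u) \<le> KR * \<bar>t - s\<bar> powr \<theta>0"
    using time[OF R] by blast
  have main: "\<exists>H\<ge>0. \<forall>t1 t2. \<epsilon> \<le> t1 \<longrightarrow> t1 < t2 \<longrightarrow> t2 \<le> T \<longrightarrow> norm (f t2 (u t2) - f t1 (u t1)) \<le> H * (t2 - t1) powr \<mu>"
    if \<epsilon>: "0 < \<epsilon>" for \<epsilon>
  proof -
    obtain H0 where H0: "\<And>g t1 t2. forcing \<alpha> G g \<Longrightarrow> \<epsilon> \<le> t1 \<Longrightarrow> t1 \<le> t2 \<Longrightarrow> t2 \<le> T \<Longrightarrow>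
        nrm X (mild u0 g t2 - mild u0 g t1) \<le> H0 * (t2 - t1) powr (\<beta> - \<alpha>)"
      using mild_nrm_hoelder[OF \<alpha>_ge0 \<alpha>_less1 \<beta>(1,2) \<epsilon>] by blast
    define H1 where "H1 = \<bar>H0\<bar>"
    define B where "B = \<bar>M2\<bar> * \<epsilon> powr - \<alpha>"
    have B: "nrm X (u t) \<le> B" if t: "\<epsilon> \<le> t" "t \<le> T" for t
    proof -
      have "nrm X (u t) \<le> M2 * t powr - \<alpha>" using M2[of t] t \<epsilon> by (simp add: u_def)
      also have "\<dots> \<le> \<bar>M2\<bar> * \<epsilon> powr - \<alpha>" using t \<epsilon> \<alpha>_ge0 by (intro mult_mono powr_mono2') auto
      finally show ?thesis by (simp add: B_def)
    qed
    define L where "L j = (1 + (1 + B powr (q j - \<theta> j)) + (1 + B powr (q j - \<theta> j))) * (H1 powr \<theta> j * T powr (\<delta> * \<theta> j - \<mu>))" for j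
    define H where "H = KR * T powr (\<theta>0 - \<mu>) + C' * (\<Sum>j\<in>J. L j)"
    have L: "0 \<le> L j" for j by (simp add: L_def)
    have H: "0 \<le> H" using KR(1) C' L by (simp add: H_def sum_nonneg)
    \<comment> \<open>As increments are at most \<open>T\<close>, any exponent above
      \<open>\<mu>\<close> can be lowered to \<open>\<mu>\<close> at the cost of a power of
      \<open>T\<close>.\<close>
    have absorb: "h powr a \<le> T powr (a - \<mu>) * h powr \<mu>" if "0 < h" "h \<le> T" "\<mu> \<le> a" for h a
    proof -
      have "h powr ((a - \<mu>) + \<mu>) = h powr (a - \<mu>) * h powr \<mu>" by (rule powr_add)
      also have "\<dots> \<le> T powr (a - \<mu>) * h powr \<mu>" using that by (intro mult_right_mono powr_mono2) auto
      finally show ?thesis by simp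
    qed
    have "norm (f t2 (u t2) - f t1 (u t1)) \<le> H * (t2 - t1) powr \<mu>" if t: "\<epsilon> \<le> t1" "t1 < t2" "t2 \<le> T" for t1 t2
    proof -
      define h where "h = t2 - t1"
      have h: "0 < h" "h \<le> T" using t \<epsilon> by (auto simp: h_def)
      have t1: "0 < t1" "t1 \<le> T" and t2: "0 < t2" "t2 \<le> T" using t \<epsilon> by auto
      note m1 = u_mem[OF t1] and m2 = u_mem[OF t2]
      have 1: "norm (f t2 (u t2) - f t1 (u t2)) \<le> (KR * T powr (\<theta>0 - \<mu>)) * h powr \<mu>"
      proof -
        have "norm (f t2 (u t2) - f t1 (u t2)) \<le> KR * \<bar>t2 - t1\<bar> powr \<theta>0"
          using m2 u_R[OF t2] t1 t2 by (intro KR(2)) auto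
        also have "\<dots> \<le> KR * (T powr (\<theta>0 - \<mu>) * h powr \<mu>)"
          using absorb[OF h \<mu>(2)] KR(1) t by (intro mult_left_mono) (auto simp: h_def)
        finally show ?thesis by (simp add: mult.assoc)
      qed
      have d: "0 \<le> nrm X (u t2 - u t1)" "nrm X (u t2 - u t1) \<le> H1 * h powr \<delta>"
      proof -
        show "0 \<le> nrm X (u t2 - u t1)" by (rule nrm_ge0[OF diff_mem[OF m2 m1]])
        have "nrm X (u t2 - u t1) \<le> H0 * h powr \<delta>"
          using H0[OF g t(1) less_imp_le[OF t(2)] t(3)] by (simp add: u_def h_def \<delta>_def)
        also have "\<dots> \<le> H1 * h powr \<delta>" by (intro mult_right_mono) (auto simp: H1_def)
        finally show "nrm X (u t2 - u t1) \<le> H1 * h powr \<delta>" .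
      qed
      have 2: "norm (f t1 (u t2) - f t1 (u t1)) \<le> C' * (\<Sum>j\<in>J. L j * h powr \<mu>)"
      proof (rule order_trans[OF diff[OF t1 m2 m1]], intro mult_left_mono sum_mono C')
        fix j assume j: "j \<in> J"
        have r: "rpow (nrm X (u t)) (q j - \<theta> j) \<le> 1 + B powr (q j - \<theta> j)" if "\<epsilon> \<le> t" "t \<le> T" for t
          using B[OF that] u_mem[of t] that \<epsilon> J(2)[OF j] by (intro rpow_le nrm_ge0) auto
        have "rpow (nrm X (u t2 - u t1)) (\<theta> j) = nrm X (u t2 - u t1) powr \<theta> j"
          using J(2)[OF j] by (simp add: rpow_def)
        also have "\<dots> \<le> (H1 * h powr \<delta>) powr \<theta> j" using d J(2)[OF j] by (intro powr_mono2) auto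
        also have "\<dots> = H1 powr \<theta> j * h powr (\<delta> * \<theta> j)" by (simp add: powr_mult powr_powr H1_def)
        also have "\<dots> \<le> H1 powr \<theta> j * (T powr (\<delta> * \<theta> j - \<mu>) * h powr \<mu>)"
          by (intro mult_left_mono absorb h \<mu>\<theta> j) simp
        finally have 3: "rpow (nrm X (u t2 - u t1)) (\<theta> j) \<le> H1 powr \<theta> j * T powr (\<delta> * \<theta> j - \<mu>) * h powr \<mu>"
          by (simp add: mult.assoc)
        have "(1 + rpow (nrm X (u t2)) (q j - \<theta> j) + rpow (nrm X (u t1)) (q j - \<theta> j)) * rpow (nrm X (u t2 - u t1)) (\<theta> j) \<le>
            (1 + (1 + B powr (q j - \<theta> j)) + (1 + B powr (q j - \<theta> j))) * (H1 powr \<theta> j * T powr (\<delta> * \<theta> j - \<mu>) * h powr \<mu>)"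
          using r[of t2] r[of t1] t \<epsilon> by (intro mult_mono 3 add_mono) (auto simp: rpow_def)
        then show "(1 + rpow (nrm X (u t2)) (q j - \<theta> j) + rpow (nrm X (u t1)) (q j - \<theta> j)) * rpow (nrm X (u t2 - u t1)) (\<theta> j)
            \<le> L j * h powr \<mu>"
          by (simp add: L_def mult.assoc)
      qed
      have "norm (f t2 (u t2) - f t1 (u t1)) \<le> norm (f t2 (u t2) - f t1 (u t2)) + norm (f t1 (u t2) - f t1 (u t1))"
        using norm_triangle_ineq[of "f t2 (u t2) - f t1 (u t2)" "f t1 (u t2) - f t1 (u t1)"] by simp
      also have "\<dots> \<le> (KR * T powr (\<theta>0 - \<mu>)) * h powr \<mu> + C' * (\<Sum>j\<in>J. L j * h powr \<mu>)"
        by (rule add_mono[OF 1 2])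
      also have "\<dots> = H * h powr \<mu>"
        by (simp add: H_def distrib_right mult.assoc flip: sum_distrib_right)
      finally show ?thesis by (simp add: h_def)
    qed
    with H show ?thesis by blast
  qed
  show ?thesis
    using main \<mu> \<theta>0 unfolding u_def by (intro exI[of _ \<mu>]) auto
qed

theorem theorem1p2:
  fixes K :: "complex set"
    and scl :: "complex \<Rightarrow> 'a::banach \<Rightarrow> 'a"
    and E1 :: "'a nspace"
    and F :: "real \<Rightarrow> 'a nspace \<Rightarrow> 'a nspace \<Rightarrow> 'a nspace"
    and A :: "'a \<Rightarrow> 'a"
    and f :: "real \<Rightarrow> 'a \<Rightarrow> 'a"
    and q \<theta> :: "nat \<Rightarrow> real"
    and m :: nat
    and T \<gamma> \<xi> C :: real
    and u0 :: 'a
  assumes "K = \<real> \<or> K = UNIV"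
    and "scalar_action K scl"
    and "banach_space K scl E1"
    and "densely_embedded E1 whole_space"
    and "compactly_embedded E1 whole_space"
    and "\<And>\<sigma>. 0 < \<sigma> \<Longrightarrow> \<sigma> < 1 \<Longrightarrow> admissible_functor K scl \<sigma> (F \<sigma>)"
    and "generates_analytic_semigroup K scl (carr E1) A"
    and "0 < T"
    and "m \<ge> 1"
    and "0 \<le> \<gamma>" "\<gamma> < 1"
    and "\<And>j. 1 \<le> j \<Longrightarrow> j \<le> m \<Longrightarrow> 0 < \<theta> j \<and> \<theta> j \<le> q j"
    and "0 < \<xi>" "\<xi> < min 1 (1 / Max (q ` {1..m}))"
    and "continuous_map (prod_topology (top_of_set {0<..T}) (ntop (interp_scale F E1 \<xi>)))
           (ntop (interp_scale F E1 \<gamma>)) (\<lambda>(t, u). f t u)"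
    and "0 < C"
    and "\<And>t u. t \<in> {0<..T} \<Longrightarrow> u \<in> carr (interp_scale F E1 \<xi>) \<Longrightarrow>
           nrm (interp_scale F E1 \<gamma>) (f t u) \<le> C * (1 + nrm (interp_scale F E1 \<xi>) u)"
    and "\<And>t u v. t \<in> {0<..T} \<Longrightarrow> u \<in> carr (interp_scale F E1 \<xi>) \<Longrightarrow>
           v \<in> carr (interp_scale F E1 \<xi>) \<Longrightarrow>
           nrm (interp_scale F E1 \<gamma>) (f t u - f t v)
             \<le> C * (\<Sum>j=1..m. (1 + rpow (nrm (interp_scale F E1 \<xi>) u) (q j - \<theta> j)
                                   + rpow (nrm (interp_scale F E1 \<xi>) v) (q j - \<theta> j))
                              * rpow (nrm (interp_scale F E1 \<xi>) (u - v)) (\<theta> j))"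
    and "\<gamma> = 0 \<Longrightarrow>
           \<exists>\<theta>0. 0 < \<theta>0 \<and> \<theta>0 < 1 \<and>
             (\<forall>R>0. \<exists>KR>0. \<forall>t\<in>{0<..T}. \<forall>s\<in>{0<..T}.
                \<forall>u \<in> carr (interp_scale F E1 \<xi>) \<inter> cball 0 R.
                  norm (f t u - f s u) \<le> KR * \<bar>t - s\<bar> powr \<theta>0)"
  shows "\<exists>u. global_strong_solution T E1 A f u0 u \<and>
           (\<forall>\<alpha>. 0 \<le> \<alpha> \<and> \<alpha> < min 1 (1 + \<gamma> - \<xi>) \<and> u0 \<in> carr (interp_scale F E1 \<alpha>) \<longrightarrow>
              continuous_map (top_of_set {0..T}) (ntop (interp_scale F E1 \<alpha>)) u)"
proof -
  note K = assms(1) and scl = assms(2) and bE = assms(3) and dE = assms(4) and cE = assms(5)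
    and F = assms(6) and gen = assms(7) and T = assms(8) and \<gamma> = assms(10,11) and J = assms(12)
    and \<xi> = assms(13,14) and f_cont = assms(15) and C = assms(16) and f_growth = assms(17)
    and f_diff = assms(18) and f_time = assms(19)
  obtain S where S: "analytic_semigroup K scl S" and AS: "is_generator S (carr E1) A"
    using gen unfolding generates_analytic_semigroup_def by blast
  have "C0_semigroup K scl S"
    using S unfolding analytic_semigroup_def by (rule conjunct1)
  then have comm: "S t (scl k x) = scl k (S t x)" if "0 \<le> t" "k \<in> K" for t k x
    using that unfolding C0_semigroup_def by blast
  obtain M where "smoothing_semigroup S (carr E1) A T M"
    using analytic_semigroup_imp_smoothing[OF K scl S AS T] by blast
  then interpret smoothing_semigroup S "carr E1" A T M .
  have scale: "\<exists>c. smoothing_space S (carr E1) A T M (interp_scale F E1 \<theta>) \<theta> c" if "0 \<le> \<theta>" "\<theta> < 1" for \<theta>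
    by (rule smoothing_space_interp_scale[OF K scl comm bE refl dE F that])
  have \<xi>1: "\<xi> < 1" "0 \<le> \<xi>" using \<xi> by auto
  obtain cg where "smoothing_space S (carr E1) A T M (interp_scale F E1 \<gamma>) \<gamma> cg"
    using scale[OF \<gamma>] by blast
  then interpret G: smoothing_space S "carr E1" A T M "interp_scale F E1 \<gamma>" \<gamma> cg .
  obtain cx where X: "smoothing_space S (carr E1) A T M (interp_scale F E1 \<xi>) \<xi> cx"
    using scale[OF \<xi>1(2,1)] by blast
  then interpret X: smoothing_space S "carr E1" A T M "interp_scale F E1 \<xi>" \<xi> cx .
  let ?X = "interp_scale F E1 \<xi>" and ?G = "interp_scale F E1 \<gamma>"
  interpret E: banach_subspace E1
    by (rule banach_space_imp_subspace[OF K scl bE]) (use dE in \<open>simp add: densely_embedded_def\<close>)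
  obtain cE where cE_pos: "0 < cE" and nrm_E: "\<And>x. x \<in> carr E1 \<Longrightarrow> nrm E1 x \<le> cE * (norm x + norm (A x))"
    using nrm_graph_equiv[OF E.banach_subspace_axioms refl] by metis
  have f_mem: "f t u \<in> carr ?G" if "t \<in> {0<..T}" "u \<in> carr ?X" for t u
  proof -
    have "(t, u) \<in> topspace (prod_topology (top_of_set {0<..T}) (ntop ?X))"
      using that by simp
    from continuous_map_image_subset_topspace[OF f_cont] imageI[OF this, of "\<lambda>(t, u). f t u"]
    show ?thesis by auto
  qed
  obtain ce where ce: "0 < ce" "\<And>x. x \<in> carr ?G \<Longrightarrow> norm x \<le> ce * nrm ?G x"
    using G.embed_const by blast
  have f_cont0: "continuous_map (prod_topology (top_of_set {0<..T}) (ntop ?X)) euclidean (\<lambda>(t, u). f t u)"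
    using continuous_map_compose[OF f_cont G.continuous_map_id_ntop] by (simp add: o_def case_prod_unfold)
  \<comment> \<open>Graph-norm bounds are converted to bounds in \<open>E1\<close>, and the sequence
    is scaled into the unit ball; the summand 1 in \<open>a\<close> keeps the scaling factor
    positive.\<close>
  have compact: "\<exists>r. strict_mono r \<and> convergent (\<lambda>n. s (r n))"
    if s: "\<And>n. s n \<in> carr E1" and R: "\<And>n. norm (s n) + norm (A (s n)) \<le> R" for s :: "nat \<Rightarrow> 'a" and R
  proof -
    define a where "a = cE * \<bar>R\<bar> + 1"
    have a: "0 < a" using cE_pos by (simp add: a_def add_nonneg_pos)
    define B where "B = {x \<in> carr E1. nrm E1 x \<le> 1}"
    have comp: "compact (closure B)"
      using cE by (simp add: compactly_embedded_def B_def)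
    have "(1 / a) *\<^sub>R s n \<in> closure B" for n
    proof -
      have "nrm E1 (s n) \<le> cE * (norm (s n) + norm (A (s n)))" by (rule nrm_E[OF s])
      also have "\<dots> \<le> cE * \<bar>R\<bar>" using R[of n] cE_pos by (intro mult_left_mono) auto
      also have "\<dots> \<le> a" by (simp add: a_def)
      finally have "(1 / a) *\<^sub>R s n \<in> B"
        using E.scale_mem[OF s] E.nrm_scale[OF s] a by (simp add: B_def field_simps)
      then show ?thesis using closure_subset by blast
    qed
    then obtain l r where r: "strict_mono r" "((\<lambda>n. (1 / a) *\<^sub>R s n) \<circ> r) \<longlonglongrightarrow> l"
      using comp unfolding compact_def by metis
    have "(\<lambda>n. a *\<^sub>R ((1 / a) *\<^sub>R s (r n))) \<longlonglongrightarrow> a *\<^sub>R l"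
      using r(2) by (intro tendsto_scaleR tendsto_const) (simp add: o_def)
    then show ?thesis using r(1) a by (auto simp: convergent_def)
  qed
  \<comment> \<open>For existence \<open>f\<close> is regarded as a map into \<open>E_0\<close>,
    whence the constant \<open>ce * C\<close>; the index \<open>\<gamma>\<close> enters afterwards,
    through the decay of the forcing.\<close>
  interpret P: semilinear_problem S "carr E1" A T M ?X \<xi> cx f "ce * C" u0
  proof unfold_locales
    show "0 < ce * C" using ce C by simp
    show "norm (f t u) \<le> ce * C * (1 + nrm ?X u)" if "0 < t" "t \<le> T" "u \<in> carr ?X" for t u
    proof -
      have "norm (f t u) \<le> ce * nrm ?G (f t u)" using that by (intro ce(2) f_mem) auto
      also have "\<dots> \<le> ce * (C * (1 + nrm ?X u))" using that ce(1) by (intro mult_left_mono f_growth) auto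
      finally show ?thesis by (simp add: mult.assoc)
    qed
    show "\<exists>r. strict_mono r \<and> convergent (\<lambda>n. s (r n))"
      if "\<And>n. s n \<in> carr E1" "\<And>n. norm (s n) + norm (A (s n)) \<le> R" for s :: "nat \<Rightarrow> 'a" and R
      by (rule compact[OF that])
  qed (use \<xi> f_cont0 in auto)
  obtain v G0 M2 where v_cont: "continuous_map (top_of_set {0<..T}) (ntop ?X) v"
    and v_forcing: "forcing \<xi> G0 (\<lambda>s. f s (v s))"
    and v_bound: "\<And>t. t \<in> {0<..T} \<Longrightarrow> nrm ?X (v t) \<le> M2 * t powr - \<xi>"
    and v_eq: "\<And>t. t \<in> {0<..T} \<Longrightarrow> v t = mild u0 (\<lambda>s. f s (v s)) t"
    using P.mild_solution_exists by blast
  define g where "g s = f s (v s)" for s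
  \<comment> \<open>The function \<open>v\<close> is determined on \<open>{0<..T}\<close> only; the
    mild formula agrees with it there and takes the value \<open>u0\<close> at 0.\<close>
  define u where "u = mild u0 g"
  have uv: "u t = v t" if "t \<in> {0<..T}" for t using v_eq[OF that] by (simp add: u_def g_def[abs_def])
  have g: "forcing \<xi> G0 g" using v_forcing by (simp add: g_def[abs_def])
  have v_mem: "v t \<in> carr ?X" if "t \<in> {0<..T}" for t
    using v_cont that unfolding continuous_map_def by auto
  \<comment> \<open>From linear growth and the singular bound on \<open>v\<close>, the forcing has
    norm at most \<open>C * (T powr \<xi> + \<bar>M2\<bar>) * s powr - \<xi>\<close> in the space of
    index \<open>\<gamma>\<close>; \<open>cg\<close> is the smoothing constant of that
    space.\<close>
  define N where "N = \<bar>cg\<bar> * (C * (T powr \<xi> + \<bar>M2\<bar>))"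
  have N: "0 \<le> N" using C by (simp add: N_def)
  have g_bound: "norm (A (S \<tau> (g s))) \<le> N * \<tau> powr (\<gamma> - 1) * s powr - \<xi>"
    if s: "0 < s" "s \<le> T" and \<tau>: "0 < \<tau>" "\<tau> \<le> 2 * T" for s \<tau>
  proof -
    have sT: "s \<in> {0<..T}" using s by simp
    have "1 \<le> T powr \<xi> * s powr - \<xi>"
      using powr_mono2[of \<xi> s T] s \<xi>1 by (simp add: powr_minus divide_simps)
    moreover have "M2 * s powr - \<xi> \<le> \<bar>M2\<bar> * s powr - \<xi>" by (intro mult_right_mono) auto
    ultimately have "1 + nrm ?X (v s) \<le> (T powr \<xi> + \<bar>M2\<bar>) * s powr - \<xi>"
      using v_bound[OF sT] by (simp add: distrib_right)
    then have "C * (1 + nrm ?X (v s)) \<le> C * ((T powr \<xi> + \<bar>M2\<bar>) * s powr - \<xi>)"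
      using C by (intro mult_left_mono) auto
    then have nG: "nrm ?G (g s) \<le> C * ((T powr \<xi> + \<bar>M2\<bar>) * s powr - \<xi>)"
      using f_growth[OF sT v_mem[OF sT]] by (simp add: g_def)
    have gG: "g s \<in> carr ?G" unfolding g_def by (rule f_mem[OF sT v_mem[OF sT]])
    have "norm (A (S \<tau> (g s))) \<le> cg * \<tau> powr (\<gamma> - 1) * nrm ?G (g s)" by (rule G.AS_smooth[OF \<tau> gG])
    also have "\<dots> \<le> cg * \<tau> powr (\<gamma> - 1) * (C * ((T powr \<xi> + \<bar>M2\<bar>) * s powr - \<xi>))"
      using nG G.c_pos by (intro mult_left_mono) auto
    also have "\<dots> = N * \<tau> powr (\<gamma> - 1) * s powr - \<xi>" using G.c_pos by (simp add: N_def mult_ac)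
    finally show ?thesis .
  qed
  have "\<exists>c. regular_forcing \<xi> g c"
  proof (cases "\<gamma> = 0")
    case False
    then show ?thesis
      using regular_forcing_interp[of g N \<gamma> \<xi>, OF g_bound _ _ N] \<gamma> by auto
  next
    case True
    then obtain \<theta>0 where \<theta>0: "0 < \<theta>0" "\<theta>0 < 1"
      and time: "\<And>R. 0 < R \<Longrightarrow> \<exists>KR>0. \<forall>t\<in>{0<..T}. \<forall>s\<in>{0<..T}. \<forall>u\<in>carr ?X \<inter> cball 0 R.
        norm (f t u - f s u) \<le> KR * \<bar>t - s\<bar> powr \<theta>0"
      using f_time by metis
    have W: "?G = whole_space" using True by (simp add: interp_scale_def)
    have "\<exists>\<mu>. 0 < \<mu> \<and> \<mu> \<le> 1 \<and> (\<forall>\<epsilon>>0. \<exists>H\<ge>0. \<forall>t1 t2. \<epsilon> \<le> t1 \<longrightarrow> t1 < t2 \<longrightarrow> t2 \<le> T \<longrightarrow>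
        norm (f t2 (mild u0 g t2) - f t1 (mild u0 g t1)) \<le> H * (t2 - t1) powr \<mu>)"
    proof (rule P.superposition_hoelder[of "{1..m}" \<theta> q C \<theta>0 G0 g M2])
      show "norm (f t u - f t w) \<le> C * (\<Sum>j\<in>{1..m}. (1 + rpow (nrm ?X u) (q j - \<theta> j) + rpow (nrm ?X w) (q j - \<theta> j)) *
          rpow (nrm ?X (u - w)) (\<theta> j))" if "0 < t" "t \<le> T" "u \<in> carr ?X" "w \<in> carr ?X" for t u w
        using f_diff[of t u w] that by (simp add: W)
      show "nrm ?X (mild u0 g t) \<le> M2 * t powr - \<xi>" if "0 < t" "t \<le> T" for t
        using v_bound[of t] uv[of t] that by (simp add: u_def)
    qed (use J C \<theta>0 time g in auto)
    then obtain \<mu> where \<mu>: "0 < \<mu>" "\<mu> \<le> 1" and hoelder: "\<And>\<epsilon>. 0 < \<epsilon> \<Longrightarrow> \<exists>H\<ge>0. \<forall>t1 t2. \<epsilon> \<le> t1 \<longrightarrow> t1 < t2 \<longrightarrow> t2 \<le> T \<longrightarrow>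
        norm (f t2 (mild u0 g t2) - f t1 (mild u0 g t1)) \<le> H * (t2 - t1) powr \<mu>"
      by blast
    have "regular_forcing \<xi> g g"
    proof (rule regular_forcing_hoelder[OF g \<xi>1(2) \<mu>])
      fix \<epsilon> :: real assume \<epsilon>: "0 < \<epsilon>"
      then obtain H where H: "0 \<le> H" "\<And>t1 t2. \<epsilon> \<le> t1 \<Longrightarrow> t1 < t2 \<Longrightarrow> t2 \<le> T \<Longrightarrow>
          norm (f t2 (mild u0 g t2) - f t1 (mild u0 g t1)) \<le> H * (t2 - t1) powr \<mu>"
        using hoelder by metis
      have "norm (g t2 - g t1) \<le> H * (t2 - t1) powr \<mu>" if t: "\<epsilon> \<le> t1" "t1 < t2" "t2 \<le> T" for t1 t2
        using H(2)[OF t] uv[of t1] uv[of t2] t \<epsilon> by (simp add: g_def u_def)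
      with H(1) show "\<exists>H\<ge>0. \<forall>t1 t2. \<epsilon> \<le> t1 \<longrightarrow> t1 < t2 \<longrightarrow> t2 \<le> T \<longrightarrow> norm (g t2 - g t1) \<le> H * (t2 - t1) powr \<mu>"
        by blast
    qed
    then show ?thesis by blast
  qed
  then obtain c where reg: "regular_forcing \<xi> g c" by blast
  have u_Dom: "u t \<in> carr E1" if "0 < t" "t \<le> T" for t
    unfolding u_def by (rule mild_in_Dom(1)[OF g \<xi>1(2,1) reg that])
  have Au: "continuous_on {0<..T} (\<lambda>t. A (u t))"
    unfolding u_def by (rule mild_in_Dom(2)[OF g \<xi>1(2,1) reg])
  have deriv: "(u has_vector_derivative (A (u t) + f t (u t))) (at t within {0<..T})" if t: "t \<in> {0<..T}" for t
    using mild_has_derivative[OF g \<xi>1(2,1) u_Dom[unfolded u_def] Au[unfolded u_def], of t] t uv[OF t]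
    by (simp add: u_def g_def)
  have u_E1: "continuous_map (top_of_set {0<..T}) (ntop E1) u"
    unfolding E.continuous_map_ntop_iff
  proof (intro ballI conjI)
    fix t assume t: "t \<in> {0<..T}"
    then show "u t \<in> carr E1" using u_Dom by simp
    have "(u \<longlongrightarrow> u t) (at t within {0<..T})"
      using has_vector_derivative_continuous[OF deriv[OF t]] by (simp add: continuous_within)
    moreover have "((\<lambda>s. A (u s)) \<longlongrightarrow> A (u t)) (at t within {0<..T})"
      using Au t by (simp add: continuous_on_def)
    ultimately have "((\<lambda>s. cE * (norm (u s - u t) + norm (A (u s) - A (u t)))) \<longlongrightarrow> cE * (0 + 0)) (at t within {0<..T})"
      by (intro tendsto_mult tendsto_add tendsto_const tendsto_norm_zero LIM_zero)
    then have lim: "((\<lambda>s. cE * (norm (u s - u t) + norm (A (u s) - A (u t)))) \<longlongrightarrow> 0) (at t within {0<..T})" by simp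
    have bd: "norm (nrm E1 (u s - u t)) \<le> cE * (norm (u s - u t) + norm (A (u s) - A (u t)))" if s: "s \<in> {0<..T}" for s
    proof -
      have mem: "u s \<in> carr E1" "u t \<in> carr E1" using u_Dom s t by auto
      show ?thesis
        using nrm_E[OF E.diff_mem[OF mem]] E.nrm_ge0[OF E.diff_mem[OF mem]] A_diff(2)[OF mem] by simp
    qed
    show "((\<lambda>s. nrm E1 (u s - u t)) \<longlongrightarrow> 0) (at t within {0<..T})"
    proof (rule Lim_null_comparison[OF _ lim])
      show "\<forall>\<^sub>F s in at t within {0<..T}. norm (nrm E1 (u s - u t)) \<le> cE * (norm (u s - u t) + norm (A (u s) - A (u t)))"
        unfolding eventually_at_filter by (intro always_eventually allI impI bd)
    qed
  qed
  have cont_alpha: "continuous_map (top_of_set {0..T}) (ntop (interp_scale F E1 \<alpha>)) u"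
    if \<alpha>: "0 \<le> \<alpha>" "\<alpha> < min 1 (1 + \<gamma> - \<xi>)" and u0: "u0 \<in> carr (interp_scale F E1 \<alpha>)" for \<alpha>
  proof -
    obtain ca where "smoothing_space S (carr E1) A T M (interp_scale F E1 \<alpha>) \<alpha> ca"
      using scale[of \<alpha>] \<alpha> by auto
    then interpret Y: smoothing_space S "carr E1" A T M "interp_scale F E1 \<alpha>" \<alpha> ca .
    show ?thesis
      unfolding u_def using \<alpha> by (intro Y.mild_continuous_at_0[OF g \<xi>1(2,1) \<gamma> _ g_bound u0]) auto
  qed
  \<comment> \<open>Index 0 is admissible because \<open>\<xi> < 1 + \<gamma>\<close>, and the space
    of index 0 is \<open>E_0\<close> itself; continuity of the solution in \<open>E_0\<close> at
    \<open>t = 0\<close> is thus a special case.\<close>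
  have "continuous_map (top_of_set {0..T}) (ntop (interp_scale F E1 0)) u"
    using \<gamma> \<xi>1 by (intro cont_alpha) (auto simp: interp_scale_def)
  then have u_cont: "continuous_on {0..T} u" by (simp add: interp_scale_def)
  have "continuous_on {0<..T} (\<lambda>t. A (u t) + g t)"
    by (intro continuous_on_add Au forcing_continuous[OF g order_refl])
  then have u'_cont: "continuous_on {0<..T} (\<lambda>t. A (u t) + f t (u t))"
    by (rule continuous_on_eq) (simp add: g_def uv)
  have "global_strong_solution T E1 A f u0 u"
    unfolding global_strong_solution_def
  proof (intro conjI exI[of _ "\<lambda>t. A (u t) + f t (u t)"] ballI)
    show "u 0 = u0" by (simp add: u_def)
  qed (use deriv u_E1 u_cont u'_cont in auto)
  with cont_alpha show ?thesis by blast
qed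

end
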